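(* For each of the following eighteen quadruples $(B,S,A,(a,q))$: $(20,1,\{0\},(1,2))$; $(21,1,\{1\},(1,1))$; $(25,1,\{0\},(1,1))$; $(30,1,\{1\},(1,1))$; $(35,1,\{0\},(1,1))$; $(39,1,\{1\},(1,1))$; $(40,2,\{0,1\},(1,1))$; $(50,2,\{3,4\},(1,1))$; $(59,2,\{0,1\},(1,1))$; $(60,3,\{0,1,2\},(1,1))$; $(70,3,\{0,1,4\},(1,1))$; $(79,3,\{3,4,5\},(1,1))$; $(80,4,\{1,2,3,4\},(1,1))$; $(90,4,\{0,1,2,3\},(1,1))$; $(99,4,\{0,1,3,4\},(1,1))$; $(100,5,\{1,2,3,4,7\},(1,1))$; $(110,5,\{0,1,2,3,4\},(1,1))$; $(119,5,\{0,1,2,3,4\},(1,1))$, one has $\gcd\bigl(H_B,\Phi(a,q)\bigr)=1$. Consequently $\operatorname{den}\bigl(q^S\widehat q_B(a/q)\bigr)=H_B$ for that pair $(a,q)$, and $$\max_{\gcd(a',q')=1}\operatorname{den}\bigl(q'^S\,\widehat q_B(a'/q')\bigr)=H_B,$$ where the maximum is over all coprime pairs of integers $(a',q')$ with $q'\ge1$. Here $H_B$, $\Phi$ and $\widehat q_B$ are those attached to $(B,S,A)$.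
   Context: For integers $m\ge 0$ put $S_{m-1}=\sum_{k=0}^{m-1}\frac{(-1)^k}{(2k+1)^2}$ and $u_m(t)=\frac{(-1)^m(t-S_{m-1})}{2m+1}\in\mathbb Q[t]$. For integers $B>S>0$ let $\Pi_i=\prod_{h=1}^{B}\bigl(2(h+i)+1\bigr)^2$ ($i\ge0$), and for $0\le a\le S+2$, $1\le j\le S$ let $$\mathcal R_{a,j}(t)=\sum_{i=0}^{a+2B}(-1)^i\binom{a+2B}{i}\Pi_i\,u_{i+j}(t).$$ Put $J=\{1,\dots,S\}$, $N=2B+S+3$, $F_B=\prod_{r=0}^{2B-1}r!$. For an $S$-element set $A\subset\{0,\dots,S+2\}$ write $\mathcal R[A,J](t)=(\mathcal R_{a,j}(t))_{a\in A,\,j\in J}$ and define (up to a sign, which is irrelevant here) $$\widehat q_B(t)=\pm\frac{F_B\,\det\mathcal R[A,J](t)}{\prod_{i=0}^{N-1}\Pi_i}=\sum_{k=0}^{S}c_kt^k,\qquad c_k\in\mathbb Q .$$ For a rational number $x$, $\operatorname{den}(x)$ is its positive denominator in lowest terms. Put $H_B=\operatorname{lcm}_{0\le k\le S}\operatorname{den}(c_k)$, $x_k=c_kH_B\in\mathbb Z$, and $\Phi(a,q)=\sum_{k=0}^{S}x_ka^kq^{S-k}$, so that $q^S\widehat q_B(a/q)=\Phi(a,q)/H_B$. *)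

theory Defs
  imports
    "HOL-Computational_Algebra.Polynomial"
    "Jordan_Normal_Form.Determinant"
begin

(* ssum m is the sum with the terms k = 0, ..., m - 1, written S_{m-1} informally;
   ssum 0 = 0. *)
definition ssum :: "nat \<Rightarrow> rat" where
  "ssum m = (\<Sum>k<m. (-1) ^ k / of_nat ((2 * k + 1) ^ 2))"

definition u :: "nat \<Rightarrow> rat poly" where
  "u m = smult ((-1) ^ m / of_nat (2 * m + 1)) [:- ssum m, 1:]"

definition PiB :: "nat \<Rightarrow> nat \<Rightarrow> nat" where
  "PiB B i = (\<Prod>h=1..B. (2 * (h + i) + 1) ^ 2)"

definition Rpoly :: "nat \<Rightarrow> nat \<Rightarrow> nat \<Rightarrow> rat poly" where
  "Rpoly B a j = (\<Sum>i\<le>a + 2 * B.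
     smult ((-1) ^ i * of_nat ((a + 2 * B) choose i) * of_nat (PiB B i)) (u (i + j)))"

(* Rows are indexed by the elements of A in increasing order, columns by j = 1, ..., S;
   matrix indices start at 0. *)
definition Rmat :: "nat \<Rightarrow> nat \<Rightarrow> nat set \<Rightarrow> rat poly mat" where
  "Rmat B S A = mat S S (\<lambda>(r, c). Rpoly B (sorted_list_of_set A ! r) (c + 1))"

definition F :: "nat \<Rightarrow> nat" where
  "F B = (\<Prod>r<2 * B. fact r)"

(* The polynomial is only specified up to a sign; the sign is the parameter \<epsilon>,
   which is meant to be 1 or -1. *)
definition qhat :: "rat \<Rightarrow> nat \<Rightarrow> nat \<Rightarrow> nat set \<Rightarrow> rat poly" where
  "qhat \<epsilon> B S A =
     smult (\<epsilon> * of_nat (F B) / of_nat (\<Prod>i<2 * B + S + 3. PiB B i)) (det (Rmat B S A))"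

definition den :: "rat \<Rightarrow> int" where
  "den x = snd (quotient_of x)"

definition H :: "rat \<Rightarrow> nat \<Rightarrow> nat \<Rightarrow> nat set \<Rightarrow> int" where
  "H \<epsilon> B S A = Lcm ((\<lambda>k. den (coeff (qhat \<epsilon> B S A) k)) ` {0..S})"

(* The floor only converts the type: its argument is an integer, see of_int_xcoeff. *)
definition xcoeff :: "rat \<Rightarrow> nat \<Rightarrow> nat \<Rightarrow> nat set \<Rightarrow> nat \<Rightarrow> int" where
  "xcoeff \<epsilon> B S A k = \<lfloor>coeff (qhat \<epsilon> B S A) k * of_int (H \<epsilon> B S A)\<rfloor>"

definition Phi :: "rat \<Rightarrow> nat \<Rightarrow> nat \<Rightarrow> nat set \<Rightarrow> int \<Rightarrow> int \<Rightarrow> int" where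
  "Phi \<epsilon> B S A a q = (\<Sum>k=0..S. xcoeff \<epsilon> B S A k * a ^ k * q ^ (S - k))"

(* q^S * qhat (a / q) *)
definition qval :: "rat \<Rightarrow> nat \<Rightarrow> nat \<Rightarrow> nat set \<Rightarrow> int \<Rightarrow> int \<Rightarrow> rat" where
  "qval \<epsilon> B S A a q = of_int q ^ S * poly (qhat \<epsilon> B S A) (of_int a / of_int q)"

lemma den_pos: "den x > 0"
  by (simp add: den_def quotient_of_denom_pos')

lemma H_pos: "H \<epsilon> B S A > 0"
proof -
  have "0 \<notin> (\<lambda>k. den (coeff (qhat \<epsilon> B S A) k)) ` {0..S}"
    using den_pos by (metis (no_types, lifting) imageE less_irrefl)
  then have "H \<epsilon> B S A \<noteq> 0"
    unfolding H_def by (subst Lcm_0_iff) auto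
  moreover have "H \<epsilon> B S A \<ge> 0"
    unfolding H_def by simp
  ultimately show ?thesis by linarith
qed

lemma of_int_xcoeff:
  assumes "k \<le> S"
  shows "of_int (xcoeff \<epsilon> B S A k) = coeff (qhat \<epsilon> B S A) k * of_int (H \<epsilon> B S A)"
proof -
  let ?c = "coeff (qhat \<epsilon> B S A) k"
  have "den ?c dvd H \<epsilon> B S A"
    unfolding H_def using assms by (intro dvd_Lcm) auto
  then obtain m where m: "H \<epsilon> B S A = den ?c * m" ..
  have "?c = of_int (fst (quotient_of ?c)) / of_int (den ?c)"
    unfolding den_def by (rule quotient_of_div) simp
  then have "?c * of_int (den ?c) = of_int (fst (quotient_of ?c))"
    using den_pos[of ?c] by (simp add: nonzero_eq_divide_eq)
  then have "?c * of_int (H \<epsilon> B S A) = of_int (fst (quotient_of ?c) * m)"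
    by (simp add: m flip: mult.assoc)
  then show ?thesis
    unfolding xcoeff_def by (metis floor_of_int)
qed

lemma degree_qhat: "degree (qhat \<epsilon> B S A) \<le> S"
proof -
  have "degree (u m) \<le> 1" for m
    unfolding u_def by (rule order_trans[OF degree_smult_le]) simp
  then have "degree (Rpoly B a j) \<le> 1" for a j
    unfolding Rpoly_def
    by (intro degree_sum_le) (auto intro: order_trans[OF degree_smult_le])
  then have "degree (det (Rmat B S A)) \<le> 1 * S"
    by (intro degree_det_le) (auto simp: Rmat_def)
  then show ?thesis
    unfolding qhat_def by (intro order_trans[OF degree_smult_le]) simp
qed

lemma qval_eq_Phi:
  assumes "q \<noteq> 0"
  shows "qval \<epsilon> B S A a q = of_int (Phi \<epsilon> B S A a q) / of_int (H \<epsilon> B S A)"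
proof -
  let ?c = "coeff (qhat \<epsilon> B S A)"
  have "poly (qhat \<epsilon> B S A) (of_int a / of_int q) = (\<Sum>k\<le>S. ?c k * (of_int a / of_int q) ^ k)"
    unfolding poly_altdef using degree_qhat
    by (intro sum.mono_neutral_left) (auto simp: not_le coeff_eq_0)
  then have "qval \<epsilon> B S A a q
      = (\<Sum>k\<le>S. of_int q ^ S * (?c k * (of_int a / of_int q) ^ k))"
    by (simp add: qval_def sum_distrib_left)
  also have "\<dots> = (\<Sum>k\<le>S. ?c k * of_int a ^ k * of_int q ^ (S - k))"
    using assms by (intro sum.cong) (auto simp: power_divide power_diff)
  finally have "qval \<epsilon> B S A a q * of_int (H \<epsilon> B S A)
      = (\<Sum>k\<le>S. ?c k * of_int (H \<epsilon> B S A) * of_int a ^ k * of_int q ^ (S - k))"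
    by (simp add: sum_distrib_left ac_simps)
  also have "\<dots> = of_int (Phi \<epsilon> B S A a q)"
    by (simp add: Phi_def atMost_atLeast0 of_int_xcoeff)
  finally show ?thesis
    using H_pos[of \<epsilon> B S A] by (simp add: nonzero_eq_divide_eq)
qed

end

theory Submission
  imports Defs "HOL-Computational_Algebra.Primes"
begin

text \<open>The gcd is 1 as soon as, for every prime $p$, all coefficients of the polynomial are $p$-integral,
or all of them are $p$-integral multiples of its (scaled) value at the given point
(\<open>gcd_H_Phi_eq_1\<close>): in both situations $p$ cannot divide the lcm of the denominators
and the form at once. The statement about the maximum follows, because every value has a denominator
that divides this lcm.

The first alternative holds for $p = 2$ and for $p > 6B + 2S + 5$, where all denominators that occur
are units (\<open>zpoly_qhat\<close>). For the other primes the determinant is first brought to a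
form without cancellation. The summands of the entries have a factor $u_{i+j}$, which involves the
partial sum up to $i+j$. Replacing this partial sum by the one up to $i+1$ changes an entry by a
finite difference of order higher than the degree of a polynomial, hence not at all. After that the
columns differ only in the factor $1/(2i+2j+1)$, and a change of basis of polynomials of degree
below $S$ turns these factors into powers of $n-i$, while the rows become binomial coefficients in
$n-i$. So up to a constant the polynomial is $\det(t M_1 - M_s)$, where $M_1$ and $M_s$ are matrices
of moments of one positive weight (\<open>qhat_eq_det_moments\<close>).

Let $t_0$ be the given point, $X = t_0 M_1 - M_s$ and $T = M_1$, both multiplied by the same scalar.
If $Z$ is a matrix such that $ZX$ is $p$-integral with unit determinant and $ZT$ is $p$-integral,
then $Z(X + (t-t_0)T)$ is a $p$-integral polynomial matrix whose determinant is a unit at $t_0$;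
dividing by this unit shows that the coefficients are $p$-integral multiples of the value at $t_0$
(\<open>coeff_det_affine\<close>). The denominators of the partial sums provide such a $Z$: if $p^e$
is the largest power of $p$ that divides one of the odd numbers that occur, then the scaling that
makes $X$ integral makes $T$ divisible by $p^{2e}$. So it is enough that $X$ is invertible modulo
$p$, or that $p^d X^{-1}$ is integral for some $d \<le> 2e$.

This is a finite computation for each of the 128 odd primes below 730. It is carried out by
rewriting with the equations of a checker that works on binary numerals. All quantities are
represented as $p^v x$ with $x$ a residue modulo a fixed power of $p$; residues are multiplied by
Montgomery reduction, which replaces division by halvings. The relation \<open>approx\<close>
between a rational number and a numeral that represents it modulo $p^k$ carries the correctness
proof, which leads to \<open>prime_ok_sound\<close>. A certificate for a prime contains the
exponents at which the sums are scaled and, where $X$ is singular modulo $p$, the matrix $Z$.\<close>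

section \<open>Rational numbers integral at a prime\<close>

text \<open>Membership in the localization of the integers at $p$, and in its group of
units.\<close>

definition zp :: "int \<Rightarrow> rat \<Rightarrow> bool" where
  "zp p x \<longleftrightarrow> (\<exists>a b. \<not> p dvd b \<and> x = of_int a / of_int b)"

definition zp_unit :: "int \<Rightarrow> rat \<Rightarrow> bool" where
  "zp_unit p x \<longleftrightarrow> (\<exists>a b. \<not> p dvd a \<and> \<not> p dvd b \<and> x = of_int a / of_int b)"

locale prime_int =
  fixes p :: int
  assumes prime: "prime p"
begin

lemma zpI: "\<not> p dvd b \<Longrightarrow> x = of_int a / of_int b \<Longrightarrow> zp p x"
  unfolding zp_def by blast

lemma zp_of_int: "zp p (of_int a)"
  using prime by (intro zpI[of 1 _ a]) (auto simp: not_prime_unit)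

lemma zp_of_nat: "zp p (of_nat a)"
  using zp_of_int[of "int a"] by simp

lemma zp_numeral: "zp p (numeral a)"
  using zp_of_int[of "numeral a"] by simp

lemma zp_0: "zp p 0"
  using zp_of_int[of 0] by simp

lemma zp_1: "zp p 1"
  using zp_of_int[of 1] by simp

lemma zp_inverse_int: "\<not> p dvd b \<Longrightarrow> zp p (1 / of_int b)"
  by (intro zpI[of b _ 1]) auto

lemma zp_mult: assumes "zp p x" "zp p y" shows "zp p (x * y)"
proof -
  obtain a b c d where "\<not> p dvd b" "x = of_int a / of_int b" "\<not> p dvd d" "y = of_int c / of_int d"
    using assms unfolding zp_def by blast
  then show ?thesis
    using prime by (intro zpI[of "b * d" _ "a * c"]) (auto simp: prime_dvd_mult_iff)
qed

lemma zp_add: assumes "zp p x" "zp p y" shows "zp p (x + y)"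
proof -
  obtain a b c d where *: "\<not> p dvd b" "x = of_int a / of_int b" "\<not> p dvd d" "y = of_int c / of_int d"
    using assms unfolding zp_def by blast
  then have "b \<noteq> 0" "d \<noteq> 0" by auto
  then have "x + y = of_int (a * d + c * b) / of_int (b * d)"
    unfolding * by (simp add: add_frac_eq)
  with * show ?thesis
    using prime by (intro zpI[of "b * d" _ "a * d + c * b"]) (auto simp: prime_dvd_mult_iff)
qed

lemma zp_uminus: "zp p x \<Longrightarrow> zp p (- x)"
  using zp_mult[OF zp_of_int[of "-1"]] by simp

lemma zp_diff: "zp p x \<Longrightarrow> zp p y \<Longrightarrow> zp p (x - y)"
  using zp_add[OF _ zp_uminus] by simp

lemma zp_sum: "(\<And>i. i \<in> I \<Longrightarrow> zp p (f i)) \<Longrightarrow> zp p (\<Sum>i\<in>I. f i)"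
  by (induction I rule: infinite_finite_induct) (auto intro: zp_0 zp_add)

lemma zp_prod: "(\<And>i. i \<in> I \<Longrightarrow> zp p (f i)) \<Longrightarrow> zp p (\<Prod>i\<in>I. f i)"
  by (induction I rule: infinite_finite_induct) (auto intro: zp_1 zp_mult)

lemma zp_power: "zp p x \<Longrightarrow> zp p (x ^ k)"
  by (induction k) (auto intro: zp_1 zp_mult)

lemma zp_unit_imp_zp: "zp_unit p x \<Longrightarrow> zp p x"
  unfolding zp_unit_def zp_def by blast

lemma zp_unit_inverse: "zp_unit p x \<Longrightarrow> zp_unit p (1 / x)"
  unfolding zp_unit_def by (elim exE conjE, intro exI conjI) auto

lemma zp_unit_nonzero: "zp_unit p x \<Longrightarrow> x \<noteq> 0"
  unfolding zp_unit_def by auto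

lemma zp_unit_mult: assumes "zp_unit p x" "zp_unit p y" shows "zp_unit p (x * y)"
proof -
  obtain a b c d where *: "\<not> p dvd a" "\<not> p dvd b" "x = of_int a / of_int b"
    "\<not> p dvd c" "\<not> p dvd d" "y = of_int c / of_int d"
    using assms unfolding zp_unit_def by blast
  then have "\<not> p dvd a * c" "\<not> p dvd b * d" using prime by (auto simp: prime_dvd_mult_iff)
  moreover have "x * y = of_int (a * c) / of_int (b * d)" using * by simp
  ultimately show ?thesis unfolding zp_unit_def by blast
qed

lemma zp_unit_of_int: "\<not> p dvd a \<Longrightarrow> zp_unit p (of_int a)"
  using prime unfolding zp_unit_def by (intro exI[of _ a] exI[of _ 1]) (auto simp: not_prime_unit)

lemma zp_unit_cong:
  assumes "zp p ((x - of_int m) / of_int p)" "\<not> p dvd m" shows "zp_unit p x"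
proof -
  obtain c d where *: "\<not> p dvd d" "(x - of_int m) / of_int p = of_int c / of_int d"
    using assms(1) unfolding zp_def by blast
  moreover have "p \<noteq> 0" "d \<noteq> 0" using prime * by auto
  ultimately have "x = of_int (m * d + p * c) / of_int d" by (simp add: field_simps)
  moreover have "\<not> p dvd m * d + p * c"
    using assms(2) * prime by (auto simp: prime_dvd_mult_iff dvd_add_left_iff)
  ultimately show ?thesis unfolding zp_unit_def using * by blast
qed

definition zpoly :: "rat poly \<Rightarrow> bool" where "zpoly f \<longleftrightarrow> (\<forall>k. zp p (coeff f k))"

lemma zpoly_add: "zpoly f \<Longrightarrow> zpoly g \<Longrightarrow> zpoly (f + g)"
  unfolding zpoly_def by (auto intro: zp_add)

lemma zpoly_mult: "zpoly f \<Longrightarrow> zpoly g \<Longrightarrow> zpoly (f * g)"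
  unfolding zpoly_def coeff_mult by (auto intro!: zp_sum zp_mult)

lemma zpoly_smult: "zp p c \<Longrightarrow> zpoly g \<Longrightarrow> zpoly (smult c g)"
  unfolding zpoly_def by (auto intro!: zp_mult)

lemma zpoly_sum: "(\<And>i. i \<in> I \<Longrightarrow> zpoly (f i)) \<Longrightarrow> zpoly (\<Sum>i\<in>I. f i)"
  unfolding zpoly_def coeff_sum by (auto intro!: zp_sum)

lemma zpoly_1: "zpoly 1"
  unfolding zpoly_def by (auto simp: coeff_pCons one_pCons zp_0 zp_1 split: nat.split)

lemma zpoly_prod: "(\<And>i. i \<in> I \<Longrightarrow> zpoly (f i)) \<Longrightarrow> zpoly (\<Prod>i\<in>I. f i)"
  by (induction I rule: infinite_finite_induct) (auto intro: zpoly_mult zpoly_1)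

lemma zpoly_pCons: "zp p a \<Longrightarrow> zpoly f \<Longrightarrow> zpoly (pCons a f)"
  unfolding zpoly_def by (auto simp: coeff_pCons split: nat.split)

lemma zpoly_0: "zpoly 0"
  unfolding zpoly_def by (simp add: zp_0)

lemma zpoly_det:
  assumes "\<And>i j. i < n \<Longrightarrow> j < n \<Longrightarrow> zpoly (A $$ (i, j))" and "A \<in> carrier_mat n n"
  shows "zpoly (det A)"
proof -
  have "zpoly (signof \<pi> * (\<Prod>i = 0..<n. A $$ (i, \<pi> i)))" if "\<pi> permutes {0..<n}" for \<pi>
  proof (intro zpoly_mult zpoly_prod assms)
    have "signof \<pi> = (1 :: rat poly) \<or> signof \<pi> = (-1 :: rat poly)"
      by (auto simp: sign_def)
    then show "zpoly (signof \<pi>)"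
      using zp_0 zp_1 zp_uminus[OF zp_1] by (auto simp: zpoly_def coeff_pCons one_pCons split: nat.split)
  qed (use permutes_in_image[OF that] in auto)
  then show ?thesis
    unfolding det_def'[OF assms(2)] by (auto intro!: zpoly_sum)
qed

text \<open>Determinants are polynomials with integer coefficients in the entries, so congruences of
entries carry over. With the Leibniz formula it suffices to compare products of entries.\<close>

lemma zp_det_cong:
  assumes "\<And>i j. i < n \<Longrightarrow> j < n \<Longrightarrow> zp p (A $$ (i, j))"
    and "\<And>i j. i < n \<Longrightarrow> j < n \<Longrightarrow> zp p ((A $$ (i, j) - B $$ (i, j)) / of_int p)"
    and "A \<in> carrier_mat n n" "B \<in> carrier_mat n n"
    and "\<And>i j. i < n \<Longrightarrow> j < n \<Longrightarrow> zp p (B $$ (i, j))"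
  shows "zp p ((det A - det B) / of_int p)"
proof -
  have prod: "zp p (((\<Prod>i\<in>I. f i) - (\<Prod>i\<in>I. g i)) / of_int p)"
    if "\<And>i. i \<in> I \<Longrightarrow> zp p (f i)" "\<And>i. i \<in> I \<Longrightarrow> zp p (g i)"
      "\<And>i. i \<in> I \<Longrightarrow> zp p ((f i - g i) / of_int p)" for I :: "nat set" and f g
    using that
  proof (induction I rule: infinite_finite_induct)
    case (insert x F)
    have "((\<Prod>i\<in>insert x F. f i) - (\<Prod>i\<in>insert x F. g i)) / of_int p
      = (f x - g x) / of_int p * (\<Prod>i\<in>F. f i) + g x * (((\<Prod>i\<in>F. f i) - (\<Prod>i\<in>F. g i)) / of_int p)"
      using insert.hyps prime by (simp add: field_simps)
    also have "zp p \<dots>"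
      using insert by (intro zp_add zp_mult zp_prod) auto
    finally show ?case .
  qed (auto simp: zp_0)
  have "zp p ((signof \<pi> * (\<Prod>i = 0..<n. A $$ (i, \<pi> i)) - signof \<pi> * (\<Prod>i = 0..<n. B $$ (i, \<pi> i))) / of_int p)"
    if "\<pi> permutes {0..<n}" for \<pi>
  proof -
    have "zp p (signof \<pi>)" by (auto simp: sign_def intro: zp_1 zp_uminus)
    moreover have "zp p (((\<Prod>i = 0..<n. A $$ (i, \<pi> i)) - (\<Prod>i = 0..<n. B $$ (i, \<pi> i))) / of_int p)"
      by (intro prod) (use assms permutes_in_image[OF that] in auto)
    ultimately show ?thesis
      unfolding right_diff_distrib[symmetric] times_divide_eq_right[symmetric] by (rule zp_mult)
  qed
  then have "zp p (\<Sum>\<pi> | \<pi> permutes {0..<n}. (signof \<pi> * (\<Prod>i = 0..<n. A $$ (i, \<pi> i)) - signof \<pi> * (\<Prod>i = 0..<n. B $$ (i, \<pi> i))) / of_int p)"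
    by (auto intro!: zp_sum)
  then show ?thesis
    unfolding det_def'[OF assms(3)] det_def'[OF assms(4)] 
    by (simp add: sum_subtractf diff_divide_distrib sum_divide_distrib)
qed

end

section \<open>Denominators of the values\<close>

lemma den_dvd:
  assumes "x * of_int m = of_int k" "m > 0"
  shows "den x dvd m"
proof -
  obtain a b where q: "quotient_of x = (a, b)" by force
  then have b: "b > 0" "coprime a b" "x = of_int a / of_int b"
    using quotient_of_denom_pos quotient_of_coprime quotient_of_div by auto
  then have "(of_int (a * m) :: rat) = (x * of_int m) * of_int b" by simp
  also have "\<dots> = of_int (k * b)" unfolding assms by simp
  finally have "(of_int (a * m) :: rat) = of_int (k * b)" .
  then have "a * m = k * b" by (simp only: of_int_eq_iff)
  then have "b dvd a * m" by simp
  with b have "b dvd m" by (simp add: coprime_commute coprime_dvd_mult_right_iff)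
  then show ?thesis by (simp add: den_def q)
qed

lemma den_fraction:
  assumes "coprime a b" "b > 0" shows "den (of_int a / of_int b) = b"
proof -
  have "quotient_of (of_int a / of_int b) = (a, b)"
    unfolding Fract_of_int_quotient[symmetric] quotient_of_Fract using assms by (intro normalize_stable)
  then show ?thesis by (simp add: den_def)
qed

text \<open>Suppose that $p$ divides both numbers, $H = ph$ and $\Phi = pf$. In the first
alternative all coefficients are $p$-integral, so their denominators already divide $h$. In the
second one the value is $f/h$; hence $h$ times each coefficient is $p$-integral as well as of
denominator dividing $p$, so it is an integer, and again all denominators divide $h$. Both
contradict the minimality of the lcm.\<close>

lemma gcd_H_Phi_eq_1:
  assumes q: "q \<noteq> 0"
    and loc: "\<And>p. prime p \<Longrightarrow> (\<forall>k\<le>S. zp p (coeff (qhat \<epsilon> B S A) k)) \<or>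
      (\<forall>k\<le>S. \<exists>r. zp p r \<and> coeff (qhat \<epsilon> B S A) k = r * qval \<epsilon> B S A a q)"
  shows "gcd (H \<epsilon> B S A) (Phi \<epsilon> B S A a q) = 1"
proof (rule ccontr)
  let ?H = "H \<epsilon> B S A" and ?P = "Phi \<epsilon> B S A a q" and ?c = "coeff (qhat \<epsilon> B S A)"
  assume "gcd ?H ?P \<noteq> 1"
  moreover have "gcd ?H ?P \<noteq> 0" using H_pos[of \<epsilon> B S A] by auto
  ultimately obtain p where p: "prime p" "p dvd gcd ?H ?P"
    by (metis gcd_ge_0_int is_unit_gcd_iff prime_divisor_exists)
  then obtain h f where h: "?H = p * h" and f: "?P = p * f" by (auto elim!: dvdE)
  interpret prime_int p by standard (fact p)
  have p0: "p > 0" using p prime_gt_0_int by blast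
  have h0: "h > 0" using H_pos[of \<epsilon> B S A] h p0 by (simp add: zero_less_mult_iff)
  have "den (?c k) dvd h" if k: "k \<le> S" for k
    using loc[OF p(1)]
  proof
    assume "\<forall>k\<le>S. zp p (?c k)"
    then obtain x y where xy: "\<not> p dvd y" "?c k = of_int x / of_int y"
      using k unfolding zp_def by blast
    have "y \<noteq> 0" using xy by auto
    with xy have "den (?c k) dvd \<bar>y\<bar>"
      by (intro den_dvd[of _ _ "x * sgn y"]) (auto simp: abs_if sgn_if)
    then have "\<not> p dvd den (?c k)" using xy dvd_trans by auto
    then have "coprime (den (?c k)) p" using p(1) by (simp add: coprime_commute prime_imp_coprime)
    moreover have "den (?c k) dvd p * h"
      unfolding h[symmetric] H_def using k by (intro dvd_Lcm) auto
    ultimately show ?thesis by (simp add: coprime_dvd_mult_right_iff)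
  next
    assume "\<forall>k\<le>S. \<exists>r. zp p r \<and> ?c k = r * qval \<epsilon> B S A a q"
    then obtain r where r: "zp p r" "?c k = r * qval \<epsilon> B S A a q" using k by blast
    then obtain x y where xy: "\<not> p dvd y" "r = of_int x / of_int y" unfolding zp_def by blast
    have y0: "y \<noteq> 0" using xy by auto
    have "?c k * of_int ?H = r * of_int ?P"
      using qval_eq_Phi[OF q, of \<epsilon> B S A a] H_pos[of \<epsilon> B S A] r by simp
    then have "of_int (xcoeff \<epsilon> B S A k) = r * (of_int ?P :: rat)"
      using of_int_xcoeff[OF k] by simp
    then have "(of_int (xcoeff \<epsilon> B S A k * y) :: rat) = of_int (x * ?P)"
      using xy y0 by (simp add: field_simps)
    then have "xcoeff \<epsilon> B S A k * y = x * ?P" by (simp only: of_int_eq_iff)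
    then have "p dvd xcoeff \<epsilon> B S A k * y" by (simp add: f)
    then have "p dvd xcoeff \<epsilon> B S A k" using xy p(1) by (simp add: prime_dvd_mult_iff)
    then obtain z where z: "xcoeff \<epsilon> B S A k = p * z" by (auto elim: dvdE)
    have "?c k * of_int h = of_int z"
      using of_int_xcoeff[OF k, of \<epsilon> B A] p0 by (simp add: z h)
    then show ?thesis using h0 by (intro den_dvd)
  qed
  then have "?H dvd h" unfolding H_def by (auto intro!: Lcm_least)
  then have "?H \<le> h" using h0 zdvd_imp_le by blast
  moreover have "p > 1" using p(1) prime_gt_1_int by blast
  then have "1 * h < p * h" using h0 by (intro mult_strict_right_mono) auto
  ultimately show False using h by simp
qed

text \<open>The value at any coprime pair is an integer divided by $H$, so its denominator divides
$H$; the bound is attained where numerator and $H$ are coprime.\<close>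

lemma den_qval_max:
  assumes q: "q \<ge> 1" "coprime a q" and gcd: "gcd (H \<epsilon> B S A) (Phi \<epsilon> B S A a q) = 1"
  shows "den (qval \<epsilon> B S A a q) = H \<epsilon> B S A"
    and "finite {den (qval \<epsilon> B S A a' q') | a' q'. coprime a' q' \<and> q' \<ge> 1}"
    and "Max {den (qval \<epsilon> B S A a' q') | a' q'. coprime a' q' \<and> q' \<ge> 1} = H \<epsilon> B S A"
proof -
  let ?H = "H \<epsilon> B S A" and ?D = "{den (qval \<epsilon> B S A a' q') | a' q'. coprime a' q' \<and> q' \<ge> 1}"
  show *: "den (qval \<epsilon> B S A a q) = ?H"
    using gcd q qval_eq_Phi[of q \<epsilon> B S A a] H_pos[of \<epsilon> B S A]
    by (simp add: den_fraction coprime_iff_gcd_eq_1 gcd.commute)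
  have sub: "?D \<subseteq> {0..?H}"
  proof
    fix d assume "d \<in> ?D"
    then obtain a' q' where d: "d = den (qval \<epsilon> B S A a' q')" "q' \<ge> 1" by blast
    then have "d dvd ?H"
      using qval_eq_Phi[of q' \<epsilon> B S A a'] H_pos[of \<epsilon> B S A] 
      by (auto intro!: den_dvd[of _ _ "Phi \<epsilon> B S A a' q'"])
    then show "d \<in> {0..?H}"
      using d den_pos[of "qval \<epsilon> B S A a' q'"] zdvd_imp_le H_pos[of \<epsilon> B S A] by auto
  qed
  then show fin: "finite ?D" using finite_subset by blast
  have "?H \<in> ?D" unfolding *[symmetric] using q by blast
  then show "Max ?D = ?H" using sub
    by (intro Max_eqI[OF fin]) (use subsetD[OF sub] in \<open>simp only: atLeastAtMost_iff\<close>, assumption)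
qed

section \<open>A local criterion for determinants of affine matrices\<close>

text \<open>The polynomial matrix $cZ(M_0 + (t - t_0) T)$ has $p$-integral entries, so its
determinant $Q$ has $p$-integral coefficients, and $Q(t_0)$ is a unit. Since $Q$ is a constant
multiple of the determinant without $Z$, the quotients of coefficients by the value at $t_0$ are the
same for both.\<close>

lemma (in prime_int) coeff_det_affine:
  fixes M0 T Z :: "rat mat" and t0 c :: rat
  assumes car: "M0 \<in> carrier_mat n n" "T \<in> carrier_mat n n" "Z \<in> carrier_mat n n"
    and V: "\<And>i j. i < n \<Longrightarrow> j < n \<Longrightarrow> zp p (c * (Z * M0) $$ (i, j))"
    and W: "\<And>i j. i < n \<Longrightarrow> j < n \<Longrightarrow> zp p (c * (Z * T) $$ (i, j))"
    and unit: "zp_unit p (det (c \<cdot>\<^sub>m (Z * M0)))"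
    and t0: "zp p t0"
  shows "\<exists>r. zp p r \<and> coeff (det (mat n n (\<lambda>ij. [:M0 $$ ij - t0 * T $$ ij, T $$ ij:]))) k
    = r * poly (det (mat n n (\<lambda>ij. [:M0 $$ ij - t0 * T $$ ij, T $$ ij:]))) t0"
proof -
  let ?N = "mat n n (\<lambda>ij. [:M0 $$ ij - t0 * T $$ ij, T $$ ij:])"
  interpret cst: comm_ring_hom "\<lambda>x :: rat. [:x:]"
    by unfold_locales (auto simp: one_pCons)
  interpret ev: comm_ring_hom "\<lambda>f :: rat poly. poly f t0"
    by unfold_locales auto
  define D where "D = map_mat (\<lambda>x. [:x:]) (c \<cdot>\<^sub>m Z)"
  have carD: "D \<in> carrier_mat n n" and carN: "?N \<in> carrier_mat n n"
    using car by (auto simp: D_def)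
  define Q where "Q = det (D * ?N)"
  have Q: "Q = [:det (c \<cdot>\<^sub>m Z):] * det ?N"
    unfolding Q_def det_mult[OF carD carN] by (simp add: D_def)
  have entry: "(D * ?N) $$ (i, j) = [:c * (Z * M0) $$ (i, j):] + [:- t0, 1:] * [:c * (Z * T) $$ (i, j):]"
    if "i < n" "j < n" for i j
  proof -
    have "(D * ?N) $$ (i, j) = (\<Sum>l<n. [:c * Z $$ (i, l):] * [:M0 $$ (l, j) - t0 * T $$ (l, j), T $$ (l, j):])"
      using that car carD carN by (simp add: scalar_prod_def D_def lessThan_atLeast0)
    also have "\<dots> = (\<Sum>l<n. [:c * (Z $$ (i, l) * M0 $$ (l, j)):] + [:- t0, 1:] * [:c * (Z $$ (i, l) * T $$ (l, j)):])"
      by (intro sum.cong) (auto simp: algebra_simps)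
    also have "\<dots> = [:\<Sum>l<n. c * (Z $$ (i, l) * M0 $$ (l, j)):] + [:- t0, 1:] * [:\<Sum>l<n. c * (Z $$ (i, l) * T $$ (l, j)):]"
      by (simp only: sum.distrib cst.hom_sum sum_distrib_left)
    also have "\<dots> = [:c * (Z * M0) $$ (i, j):] + [:- t0, 1:] * [:c * (Z * T) $$ (i, j):]"
      using that car by (simp add: scalar_prod_def sum_distrib_left lessThan_atLeast0)
    finally show ?thesis .
  qed
  have "zpoly Q"
    unfolding Q_def
  proof (rule zpoly_det)
    show "zpoly ((D * ?N) $$ (i, j))" if "i < n" "j < n" for i j
      unfolding entry[OF that] using that V W t0
      by (intro zpoly_add zpoly_mult zpoly_pCons zpoly_0 zp_uminus zp_1)
  qed (use carD in auto)
  have "poly Q t0 = det (map_mat (\<lambda>f. poly f t0) (D * ?N))"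
    unfolding Q_def by simp
  also have "map_mat (\<lambda>f. poly f t0) (D * ?N) = c \<cdot>\<^sub>m (Z * M0)"
    using car carD carN entry by (intro eq_matI) (auto simp del: index_mult_mat(1))
  finally have uQ: "zp_unit p (poly Q t0)" using unit by simp
  define d where "d = det (c \<cdot>\<^sub>m Z)"
  have Qd: "poly Q t0 = d * poly (det ?N) t0" "coeff Q k = d * coeff (det ?N) k"
    unfolding Q d_def by simp_all
  with zp_unit_nonzero[OF uQ] have d0: "d \<noteq> 0" and N0: "poly (det ?N) t0 \<noteq> 0" by auto
  have "zp p (coeff Q k * (1 / poly Q t0))"
    using \<open>zpoly Q\<close> uQ by (intro zp_mult zp_unit_imp_zp[OF zp_unit_inverse]) (auto simp: zpoly_def)
  moreover have "coeff (det ?N) k = coeff Q k * (1 / poly Q t0) * poly (det ?N) t0"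
    unfolding Qd using d0 N0 by simp
  ultimately show ?thesis by blast
qed

section \<open>Reduction to matrices of moments\<close>

text \<open>The sum is an $n$-th finite difference, and each difference lowers the degree.\<close>

lemma alternating_sum_poly_eq_0:
  fixes f :: "rat poly"
  assumes "degree f < n"
  shows "(\<Sum>i\<le>n. (-1) ^ i * of_nat (n choose i) * poly f (of_nat i)) = 0"
  using assms
proof (induction n arbitrary: f)
  case (Suc n)
  let ?g = "f - f \<circ>\<^sub>p [:1, 1:]"
  have "(\<Sum>i\<le>Suc n. (-1) ^ i * of_nat (Suc n choose i) * poly f (of_nat i))
     = (\<Sum>i\<le>Suc n. (-1) ^ i * of_nat (n choose i) * poly f (of_nat i))
       + (\<Sum>i\<le>n. (-1) ^ Suc i * of_nat (n choose i) * poly f (of_nat (Suc i)))"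
    unfolding sum.atMost_Suc_shift
    by (simp add: algebra_simps sum.distrib sum_subtractf sum_negf)
  also have "\<dots> = (\<Sum>i\<le>n. (-1) ^ i * of_nat (n choose i) * poly ?g (of_nat i))"
    by (simp add: poly_pcompose algebra_simps sum_subtractf sum_negf)
  also have "\<dots> = 0"
  proof (cases "degree f = 0")
    case True
    then obtain a where "f = [:a:]" by (meson degree_eq_zeroE)
    then show ?thesis by simp
  next
    case False
    have "degree ?g < degree f"
    proof -
      have "coeff ?g (degree f) = 0"
        using lead_coeff_comp[of "[:1, 1:]" f] by (simp add: degree_pcompose)
      moreover have "degree ?g \<le> degree f" by (intro degree_diff_le) (auto simp: degree_pcompose)
      ultimately show ?thesis
        using False eq_zero_or_degree_less[of ?g "degree f"] by auto
    qed
    then show ?thesis using Suc.prems by (intro Suc.IH) auto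
  qed
  finally show ?case .
qed simp

text \<open>The summands of all entries share this factor: the denominator collects the factors
$2(i+j)+1$ of all columns.\<close>

definition weight :: "nat \<Rightarrow> nat \<Rightarrow> nat \<Rightarrow> nat \<Rightarrow> rat" where
  "weight n B S i = of_nat (n choose i) * of_nat (PiB B i) / (\<Prod>j=1..S. of_nat (2 * (i + j) + 1))"

definition moment :: "nat \<Rightarrow> nat \<Rightarrow> nat \<Rightarrow> nat \<Rightarrow> nat \<Rightarrow> (nat \<Rightarrow> rat) \<Rightarrow> rat" where
  "moment n B S d l y = (\<Sum>i\<le>n. weight n B S i * y i * (of_nat ((n - i) choose d) * of_nat (n - i) ^ l))"

lemma moment_diff: "moment n B S d l (\<lambda>i. y i - z i) = moment n B S d l y - moment n B S d l z"
  unfolding moment_def by (simp add: algebra_simps sum_subtractf)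

lemma moment_cmult: "moment n B S d l (\<lambda>i. c * y i) = c * moment n B S d l y"
  unfolding moment_def by (simp add: algebra_simps sum_distrib_left)

text \<open>Both sides count disjoint pairs of subsets of sizes $d$ and $i$. This identity moves the
dependence on the row from the upper index of the binomial coefficient to a factor in $n - i$, so
that all rows have the same weight.\<close>

lemma choose_mult_swap: "(n choose d) * ((n - d) choose i) = (n choose i) * ((n - i) choose d)"
proof (cases "d + i \<le> n")
  case True
  have "(n choose (d + i)) * ((d + i) choose d) = (n choose d) * ((n - d) choose i)"
    using choose_mult[of d "d + i" n] True by simp
  moreover have "(n choose (d + i)) * ((d + i) choose i) = (n choose i) * ((n - i) choose d)"
    using choose_mult[of i "d + i" n] True by simp
  moreover have "(d + i) choose d = (d + i) choose i"
    using binomial_symmetric[of d "d + i"] by simp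
  ultimately show ?thesis by simp
next
  case False
  then show ?thesis by (cases "d \<le> n"; cases "i \<le> n") (auto simp: binomial_eq_0)
qed

text \<open>The squares in \<^const>\<open>PiB\<close> cancel both denominators, which leaves a
polynomial in $i$ of degree $2B - 3 < n$.\<close>

lemma PiB_shift_eq_0:
  assumes "1 \<le> l" "l < j" "j \<le> B" "2 * B \<le> n"
  shows "(\<Sum>i\<le>n. (-1) ^ i * of_nat (n choose i) *
    (of_nat (PiB B i) / of_nat (2 * (i + j) + 1) / of_nat ((2 * (i + l) + 1) ^ 2)) :: rat) = 0"
proof -
  let ?f = "[:of_nat (2 * j + 1), 2:] * (\<Prod>h\<in>{1..B} - {j, l}. [:of_nat (2 * h + 1), 2:] ^ 2) :: rat poly"
  have "degree ?f \<le> 1 + (\<Sum>h\<in>{1..B} - {j, l}. 2)"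
  proof (rule order_trans[OF degree_mult_le add_mono])
    show "degree (\<Prod>h\<in>{1..B} - {j, l}. [:of_nat (2 * h + 1), 2:] ^ 2 :: rat poly) \<le> (\<Sum>h\<in>{1..B} - {j, l}. 2)"
      by (rule order_trans[OF degree_prod_sum_le sum_mono])
        (auto intro!: order_trans[OF degree_power_le])
  qed simp
  also have "\<dots> < n"
    using assms by (simp add: card_Diff_subset)
  finally have "(\<Sum>i\<le>n. (-1) ^ i * of_nat (n choose i) * poly ?f (of_nat i)) = 0"
    by (rule alternating_sum_poly_eq_0)
  moreover have "poly ?f (of_nat i) =
    of_nat (PiB B i) / of_nat (2 * (i + j) + 1) / of_nat ((2 * (i + l) + 1) ^ 2)" for i
  proof -
    let ?g = "\<lambda>h. of_nat ((2 * (h + i) + 1) ^ 2) :: rat"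
    have nz: "of_nat (2 * (i + h) + 1) \<noteq> (0 :: rat)" for h
      unfolding of_nat_eq_0_iff by simp
    have "of_nat (PiB B i) = (\<Prod>h\<in>insert j (insert l ({1..B} - {j, l})). ?g h)"
      unfolding PiB_def of_nat_prod by (rule prod.cong) (use assms in auto)
    also have "\<dots> = ?g j * (?g l * (\<Prod>h\<in>{1..B} - {j, l}. ?g h))"
      using assms by (subst prod.insert) (auto simp: prod.insert)
    finally have P: "of_nat (PiB B i) = of_nat (2 * (i + j) + 1) ^ 2 *
        (of_nat (2 * (i + l) + 1) ^ 2 * (\<Prod>h\<in>{1..B} - {j, l}. ?g h))"
      by (simp only: of_nat_power add.commute)
    have "P / x / y ^ 2 = x * X" if "x \<noteq> 0" "y \<noteq> 0" "P = x ^ 2 * (y ^ 2 * X)" for P x y X :: rat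
      using that by (simp add: power2_eq_square)
    from this[OF nz nz P]
    have "of_nat (PiB B i) / of_nat (2 * (i + j) + 1) / of_nat ((2 * (i + l) + 1) ^ 2)
      = of_nat (2 * (i + j) + 1) * (\<Prod>h\<in>{1..B} - {j, l}. ?g h)"
      by (simp only: of_nat_power)
    then show ?thesis
      by (simp add: poly_prod algebra_simps)
  qed
  ultimately show ?thesis by simp
qed

lemma ssum_diff:
  assumes "1 \<le> j"
  shows "ssum (i + j) - ssum (Suc i) = (\<Sum>l\<in>{1..<j}. (-1) ^ (i + l) / of_nat ((2 * (i + l) + 1) ^ 2))"
proof -
  let ?f = "\<lambda>k. (-1) ^ k / of_nat ((2 * k + 1) ^ 2) :: rat"
  have "{..<i + j} = {..<Suc i} \<union> {1 + i..<j + i}" using assms by auto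
  then have "ssum (i + j) = sum ?f ({..<Suc i} \<union> {1 + i..<j + i})"
    unfolding ssum_def by (rule arg_cong)
  also have "\<dots> = sum ?f {..<Suc i} + sum ?f {1 + i..<j + i}"
    by (rule sum.union_disjoint) auto
  also have "sum ?f {1 + i..<j + i} = (\<Sum>l\<in>{1..<j}. ?f (l + i))"
    by (rule sum.shift_bounds_nat_ivl)
  also have "\<dots> = (\<Sum>l\<in>{1..<j}. ?f (i + l))"
    by (intro sum.cong refl) (simp only: add.commute)
  finally show ?thesis unfolding ssum_def by (simp only: add_diff_cancel_left')
qed

text \<open>Here the partial sum of length $i + j$ is replaced by the one of length $i + 1$: the
terms in between contribute finite differences that vanish by \<open>PiB_shift_eq_0\<close>. The
signs of the binomial sum and of \<^const>\<open>u\<close> cancel up to $(-1)^j$.\<close>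

lemma Rpoly_eq:
  assumes "1 \<le> j" "j \<le> B"
  shows "Rpoly B a j = smult ((-1) ^ j)
    [: - (\<Sum>i\<le>a + 2 * B. of_nat ((a + 2 * B) choose i) * (of_nat (PiB B i) / of_nat (2 * (i + j) + 1)) * ssum (Suc i)),
       (\<Sum>i\<le>a + 2 * B. of_nat ((a + 2 * B) choose i) * (of_nat (PiB B i) / of_nat (2 * (i + j) + 1))) :]"
proof -
  let ?n = "a + 2 * B"
  let ?w = "\<lambda>i. of_nat (?n choose i) * (of_nat (PiB B i) / of_nat (2 * (i + j) + 1)) :: rat"
  have "Rpoly B a j = (\<Sum>i\<le>?n. smult ((-1) ^ j) [: - (?w i * ssum (i + j)), ?w i:])"
    unfolding Rpoly_def
  proof (rule sum.cong)
    fix i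
    have "(-1) ^ i * (-1) ^ (i + j) = ((-1) ^ j :: rat)"
      by (simp add: power_add flip: mult.assoc)
    then show "smult ((-1) ^ i * of_nat (?n choose i) * of_nat (PiB B i)) (u (i + j))
      = smult ((-1) ^ j) [: - (?w i * ssum (i + j)), ?w i:]"
      unfolding u_def by (simp add: divide_simps mult_ac del: of_nat_add of_nat_mult of_nat_Suc)
  qed simp
  also have "\<dots> = smult ((-1) ^ j) [: - (\<Sum>i\<le>?n. ?w i * ssum (i + j)), (\<Sum>i\<le>?n. ?w i) :]"
  proof -
    have "(\<Sum>i\<in>I. smult c [: - f i, g i:]) = smult c [: - (\<Sum>i\<in>I. f i), (\<Sum>i\<in>I. g i):]"
      for I :: "nat set" and c :: rat and f g
      by (induction I rule: infinite_finite_induct) (auto simp: algebra_simps)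
    then show ?thesis .
  qed
  also have "(\<Sum>i\<le>?n. ?w i * ssum (i + j)) = (\<Sum>i\<le>?n. ?w i * ssum (Suc i))"
  proof -
    have "(\<Sum>i\<le>?n. ?w i * ssum (i + j)) - (\<Sum>i\<le>?n. ?w i * ssum (Suc i))
      = (\<Sum>i\<le>?n. ?w i * (ssum (i + j) - ssum (Suc i)))"
      by (simp add: right_diff_distrib sum_subtractf)
    also have "\<dots> = (\<Sum>i\<le>?n. \<Sum>l\<in>{1..<j}. (-1) ^ l * ((-1) ^ i * of_nat (?n choose i) *
        (of_nat (PiB B i) / of_nat (2 * (i + j) + 1) / of_nat ((2 * (i + l) + 1) ^ 2))))"
      unfolding ssum_diff[OF assms(1)] sum_distrib_left
      by (intro sum.cong refl) (simp add: power_add del: of_nat_add of_nat_mult of_nat_Suc of_nat_power)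
    also have "\<dots> = (\<Sum>l\<in>{1..<j}. (-1) ^ l * (\<Sum>i\<le>?n. (-1) ^ i * of_nat (?n choose i) *
        (of_nat (PiB B i) / of_nat (2 * (i + j) + 1) / of_nat ((2 * (i + l) + 1) ^ 2))))"
      unfolding sum_distrib_left by (rule sum.swap)
    also have "\<dots> = 0"
      using assms by (intro sum.neutral ballI) (subst PiB_shift_eq_0, auto)
    finally show ?thesis by simp
  qed
  finally show ?thesis .
qed

text \<open>Multiplying by the factors of the other columns turns $1/(2i+2j+1)$ into the weight
times a polynomial in $n - i$ of degree $S - 1$, whose coefficients are those of a change of
basis.\<close>

lemma sum_weight_eq_moment:
  assumes "1 \<le> j" "j \<le> S" and n: "n = a + d + 2 * B"
  shows "(\<Sum>i\<le>a + 2 * B. of_nat ((a + 2 * B) choose i) * (of_nat (PiB B i) / of_nat (2 * (i + j) + 1)) * y i)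
    = (\<Sum>l<S. coeff (\<Prod>k\<in>{1..S} - {j}. [:of_nat (2 * n + 2 * k + 1), -2:]) l * moment n B S d l y) / of_nat (n choose d)"
proof -
  let ?g = "\<Prod>k\<in>{1..S} - {j}. [:of_nat (2 * n + 2 * k + 1), -2:] :: rat poly"
  have nd: "a + 2 * B = n - d" and dn: "d \<le> n" using n by auto
  have S: "0 < S" using assms by simp
  have "degree ?g \<le> (\<Sum>k\<in>{1..S} - {j}. 1)"
    by (rule order_trans[OF degree_prod_sum_le sum_mono]) auto
  also have "\<dots> < S" using assms by (simp add: card_Diff_subset)
  finally have deg: "degree ?g < S" .
  have g: "poly ?g (of_nat (n - i)) = (\<Sum>l<S. coeff ?g l * of_nat (n - i) ^ l)" for i
    unfolding poly_altdef using deg by (intro sum.mono_neutral_left) (auto simp: coeff_eq_0)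
  have main: "of_nat ((a + 2 * B) choose i) * (of_nat (PiB B i) / of_nat (2 * (i + j) + 1))
    = weight n B S i * of_nat ((n - i) choose d) * poly ?g (of_nat (n - i)) / of_nat (n choose d)"
    if i: "i \<le> n" for i
  proof -
    have nz: "of_nat (2 * (i + h) + 1) \<noteq> (0 :: rat)" for h
      unfolding of_nat_eq_0_iff by simp
    have G: "poly ?g (of_nat (n - i)) = (\<Prod>k\<in>{1..S} - {j}. of_nat (2 * (i + k) + 1))"
      using i by (simp add: poly_prod of_nat_diff algebra_simps)
    have PR: "(\<Prod>k=1..S. of_nat (2 * (i + k) + 1)) = of_nat (2 * (i + j) + 1) * (\<Prod>k\<in>{1..S} - {j}. of_nat (2 * (i + k) + 1) :: rat)"
      using assms by (intro prod.remove) auto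
    have X0: "(\<Prod>k\<in>{1..S} - {j}. of_nat (2 * (i + k) + 1) :: rat) \<noteq> 0"
      using nz by (simp del: of_nat_add of_nat_mult of_nat_Suc)
    have CH: "of_nat ((n - d) choose i) = of_nat (n choose i) * of_nat ((n - i) choose d) / (of_nat (n choose d) :: rat)"
    proof -
      have "of_nat (n choose d) \<noteq> (0 :: rat)" using dn by simp
      moreover have "of_nat (n choose d) * of_nat ((n - d) choose i) = (of_nat (n choose i) * of_nat ((n - i) choose d) :: rat)"
        using choose_mult_swap[of n d i] by (metis of_nat_mult)
      ultimately show ?thesis by (simp add: field_simps)
    qed
    have gen: "c1 * (P / x) = c2 * P / (x * X) * c3 * X / c4"
      if "x \<noteq> 0" "X \<noteq> 0" "c1 = c2 * c3 / c4" for c1 c2 c3 c4 P x X :: rat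
      using that(1, 2) unfolding that(3) by (simp add: mult_ac)
    show ?thesis
      unfolding nd weight_def G PR by (rule gen[OF nz X0 CH])
  qed
  have "(\<Sum>i\<le>a + 2 * B. of_nat ((a + 2 * B) choose i) * (of_nat (PiB B i) / of_nat (2 * (i + j) + 1)) * y i)
    = (\<Sum>i\<le>n. of_nat ((a + 2 * B) choose i) * (of_nat (PiB B i) / of_nat (2 * (i + j) + 1)) * y i)"
    using n by (intro sum.mono_neutral_left) auto
  also have "\<dots> = (\<Sum>i\<le>n. \<Sum>l<S. coeff ?g l * (weight n B S i * y i * (of_nat ((n - i) choose d) * of_nat (n - i) ^ l)) / of_nat (n choose d))"
  proof (rule sum.cong)
    fix i assume "i \<in> {..n}"
    then show "of_nat ((a + 2 * B) choose i) * (of_nat (PiB B i) / of_nat (2 * (i + j) + 1)) * y i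
      = (\<Sum>l<S. coeff ?g l * (weight n B S i * y i * (of_nat ((n - i) choose d) * of_nat (n - i) ^ l)) / of_nat (n choose d))"
      by (simp only: main atMost_iff g sum_distrib_left sum_distrib_right sum_divide_distrib)
        (intro sum.cong refl, simp add: mult_ac)
  qed simp
  also have "\<dots> = (\<Sum>l<S. coeff ?g l * moment n B S d l y) / of_nat (n choose d)"
    unfolding moment_def sum_distrib_left sum_divide_distrib by (rule sum.swap)
  finally show ?thesis .
qed

definition moment_mat :: "nat \<Rightarrow> nat \<Rightarrow> nat \<Rightarrow> nat list \<Rightarrow> (nat \<Rightarrow> rat) \<Rightarrow> rat mat" where
  "moment_mat n B S ds y = mat S S (\<lambda>(r, l). moment n B S (ds ! r) l y)"

text \<open>The matrix is a product of a diagonal matrix for the rows, the matrix of moments, and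
the constant matrix of the change of basis for the columns.\<close>

lemma qhat_eq_det_moments:
  assumes "S \<le> B" "length ds = S"
    and A: "\<And>r. r < S \<Longrightarrow> sorted_list_of_set A ! r + ds ! r + 2 * B = n"
  shows "\<exists>\<kappa>. qhat \<epsilon> B S A = smult \<kappa> (det (mat S S (\<lambda>ij.
    [: - moment_mat n B S ds (\<lambda>i. ssum (Suc i)) $$ ij, moment_mat n B S ds (\<lambda>_. 1) $$ ij :])))"
proof -
  let ?N = "mat S S (\<lambda>ij. [: - moment_mat n B S ds (\<lambda>i. ssum (Suc i)) $$ ij, moment_mat n B S ds (\<lambda>_. 1) $$ ij :])"
  let ?D = "mat S S (\<lambda>(r, c). if r = c then 1 / of_nat (n choose (ds ! r)) else 0 :: rat)"
  let ?G = "mat S S (\<lambda>(l, c). (-1) ^ (c + 1) * coeff (\<Prod>k\<in>{1..S} - {c + 1}. [:of_nat (2 * n + 2 * k + 1), -2:]) l :: rat)"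
  interpret cst: comm_ring_hom "\<lambda>x :: rat. [:x:]"
    by unfold_locales (auto simp: one_pCons)
  let ?D' = "map_mat (\<lambda>x. [:x:]) ?D" and ?G' = "map_mat (\<lambda>x. [:x:]) ?G"
  have "Rmat B S A = ?D' * (?N * ?G')"
  proof (rule eq_matI)
    fix r c assume "r < dim_row (?D' * (?N * ?G'))" "c < dim_col (?D' * (?N * ?G'))"
    then have rc: "r < S" "c < S" by auto
    let ?a = "sorted_list_of_set A ! r" and ?d = "ds ! r"
    let ?c = "\<lambda>l. (-1) ^ (c + 1) * coeff (\<Prod>k\<in>{1..S} - {c + 1}. [:of_nat (2 * n + 2 * k + 1), -2:]) l :: rat"
    have "(?D' * (?N * ?G')) $$ (r, c) = (\<Sum>k<S. ?D' $$ (r, k) * (?N * ?G') $$ (k, c))"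
      using rc by (simp add: scalar_prod_def lessThan_atLeast0)
    also have "\<dots> = (\<Sum>k<S. if k = r then [:1 / of_nat (n choose ?d):] * (?N * ?G') $$ (r, c) else 0)"
      using rc by (intro sum.cong) (auto simp del: index_mult_mat)
    also have "\<dots> = smult (1 / of_nat (n choose ?d)) ((?N * ?G') $$ (r, c))"
      using rc by (simp del: index_mult_mat)
    also have "(?N * ?G') $$ (r, c) = (\<Sum>l<S. [: - moment n B S ?d l (\<lambda>i. ssum (Suc i)), moment n B S ?d l (\<lambda>_. 1) :] * [: ?c l :])"
      using rc by (simp add: scalar_prod_def lessThan_atLeast0 moment_mat_def)
    also have "\<dots> = [: - (\<Sum>l<S. ?c l * moment n B S ?d l (\<lambda>i. ssum (Suc i))), (\<Sum>l<S. ?c l * moment n B S ?d l (\<lambda>_. 1)) :]"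
    proof -
      have "(\<Sum>i\<in>I. [: - f i, g i:] * [:h i:]) = [: - (\<Sum>i\<in>I. h i * f i), (\<Sum>i\<in>I. h i * g i):]"
        for I :: "nat set" and f g h :: "nat \<Rightarrow> rat"
        by (induction I rule: infinite_finite_induct) (auto simp: algebra_simps)
      then show ?thesis .
    qed
    also have "smult (1 / of_nat (n choose ?d)) \<dots> = Rpoly B ?a (c + 1)"
    proof -
      have n: "n = ?a + ?d + 2 * B" using A[OF rc(1)] by simp
      have c: "1 \<le> c + 1" "c + 1 \<le> S" using rc by auto
      have sm: "(\<Sum>l<S. ?c l * moment n B S ?d l y) / of_nat (n choose ?d) = (-1) ^ (c + 1) *
        (\<Sum>i\<le>?a + 2 * B. of_nat ((?a + 2 * B) choose i) * (of_nat (PiB B i) / of_nat (2 * (i + (c + 1)) + 1)) * y i)" for y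
        unfolding sum_weight_eq_moment[OF c n]
        by (simp add: sum_distrib_left mult_ac)
      show ?thesis
        using sm[of "\<lambda>_. 1"] sm[of "\<lambda>i. ssum (Suc i)"] rc assms
        by (subst Rpoly_eq) (auto simp del: of_nat_add of_nat_mult of_nat_Suc power_Suc)
    qed
    finally show "Rmat B S A $$ (r, c) = (?D' * (?N * ?G')) $$ (r, c)"
      using rc by (simp add: Rmat_def)
  qed (auto simp: Rmat_def)
  moreover have carD: "?D' \<in> carrier_mat S S" and carN: "?N \<in> carrier_mat S S"
    and carG: "?G' \<in> carrier_mat S S"
    by auto
  ultimately have "det (Rmat B S A) = det ?D' * (det ?N * det ?G')"
    by (simp only: det_mult[OF carD mult_carrier_mat[OF carN carG]] det_mult[OF carN carG])
  also have "\<dots> = smult (det ?D * det ?G) (det ?N)"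
  proof -
    have "[:x:] * (f * [:y:]) = smult (x * y) f" for x y :: rat and f by (simp add: mult.commute)
    then show ?thesis unfolding cst.hom_det .
  qed
  finally have E: "det (Rmat B S A) = smult (det ?D * det ?G) (det ?N)" .
  show ?thesis
    unfolding qhat_def E smult_smult by (rule exI, rule refl)
qed

section \<open>Primes that divide none of the denominators\<close>

lemma (in prime_int) zpoly_qhat:
  assumes p: "\<And>m. m \<le> 3 * B + S + 2 \<Longrightarrow> \<not> p dvd int (2 * m + 1)"
    and A: "\<And>r. r < S \<Longrightarrow> sorted_list_of_set A ! r \<le> S + 2" and S: "S + 1 \<le> B" and eps: "\<epsilon> \<in> {1, -1}"
  shows "zpoly (qhat \<epsilon> B S A)"
proof -
  have inv: "zp p (1 / of_nat (2 * m + 1))" if "m \<le> 3 * B + S + 2" for m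
    using zp_inverse_int[OF p[OF that]] by (simp del: of_nat_add of_nat_mult of_nat_Suc)
  have m1: "zp p ((-1) ^ k)" for k
    using zp_power[OF zp_of_int[of "-1"]] by simp
  have ssum: "zp p (ssum m)" if "m \<le> 3 * B + S + 2" for m
    unfolding ssum_def
  proof (intro zp_sum)
    fix k assume "k \<in> {..<m}"
    then have "zp p ((-1) ^ k * (1 / of_nat (2 * k + 1)) * (1 / of_nat (2 * k + 1)))"
      using that by (intro zp_mult m1 inv) auto
    moreover have "(-1) ^ k * (1 / x) * (1 / x) = (-1) ^ k / x ^ 2" for x :: rat
      by (simp add: power2_eq_square)
    ultimately show "zp p ((-1) ^ k / of_nat ((2 * k + 1)\<^sup>2))"
      unfolding of_nat_power by simp
  qed
  have u: "zpoly (u m)" if "m \<le> 3 * B + S + 2" for m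
  proof -
    have "zp p ((-1) ^ m / of_nat (2 * m + 1))"
      using zp_mult[OF m1 inv[OF that]] by simp
    then show ?thesis
      unfolding u_def using ssum[OF that]
      by (intro zpoly_smult zpoly_pCons zpoly_0 zp_uminus zp_1) auto
  qed
  have "zpoly (det (Rmat B S A))"
  proof (rule zpoly_det)
    fix r c assume rc: "r < S" "c < S"
    have "zpoly (Rpoly B (sorted_list_of_set A ! r) (c + 1))"
      unfolding Rpoly_def
      by (intro zpoly_sum zpoly_smult zp_mult zp_of_nat m1 u) (use A[OF rc(1)] rc S in auto)
    then show "zpoly (Rmat B S A $$ (r, c))" using rc by (simp add: Rmat_def)
  qed (auto simp: Rmat_def)
  moreover have "zp p (\<epsilon> * of_nat (F B) / of_nat (\<Prod>i<2 * B + S + 3. PiB B i))"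
  proof -
    have "\<not> p dvd int (\<Prod>i<2 * B + S + 3. PiB B i)"
    proof
      assume "p dvd int (\<Prod>i<2 * B + S + 3. PiB B i)"
      then obtain i h where "i < 2 * B + S + 3" "h \<in> {1..B}" "p dvd int (2 * (h + i) + 1)"
        unfolding PiB_def of_nat_prod of_nat_power
        using prime by (auto simp: prime_dvd_prod_iff dest!: prime_dvd_power)
      then show False using p[of "h + i"] by auto
    qed
    from zp_inverse_int[OF this]
    have "zp p (1 / of_nat (\<Prod>i<2 * B + S + 3. PiB B i))" by (simp del: of_nat_prod)
    moreover have "zp p \<epsilon>" using eps zp_1 zp_uminus[OF zp_1] by auto
    ultimately have "zp p (\<epsilon> * of_nat (F B) * (1 / of_nat (\<Prod>i<2 * B + S + 3. PiB B i)))"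
      by (intro zp_mult zp_of_nat)
    then show ?thesis by simp
  qed
  ultimately show ?thesis
    unfolding qhat_def by (rule zpoly_smult[rotated])
qed

section \<open>A checker on binary numerals\<close>

text \<open>Montgomery reduction for an odd modulus $M$ with $h = (M+1)/2$: a step halves the
residue $x$, adding $M$ first if $x$ is odd, since $(x + M)/2 = \lfloor x/2 \rfloor + h$. The
numeral \<open>c\<close> serves only as a counter, one halving for each binary digit after the
leading one, so the result represents $x / 2^{l}$ for a fixed $l$. The number of halvings matters
for the size of the results and not for correctness.\<close>

fun redc :: "num \<Rightarrow> num \<Rightarrow> num \<Rightarrow> num" where
  "redc h num.One x = x"
| "redc h (num.Bit0 c) num.One = redc h c h"
| "redc h (num.Bit0 c) (num.Bit0 x) = redc h c x"
| "redc h (num.Bit0 c) (num.Bit1 x) = redc h c (x + h)"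
| "redc h (num.Bit1 c) num.One = redc h c h"
| "redc h (num.Bit1 c) (num.Bit0 x) = redc h c x"
| "redc h (num.Bit1 c) (num.Bit1 x) = redc h c (x + h)"

definition mmul :: "num \<Rightarrow> num \<Rightarrow> num \<Rightarrow> num \<Rightarrow> num" where
  "mmul h c a b = redc h c (a * b)"

text \<open>Loops are counted by numerals or by lists of units, so that rewriting never has to
convert between numerals and successors.\<close>

primrec iter :: "('a \<Rightarrow> 'a) \<Rightarrow> num \<Rightarrow> 'a \<Rightarrow> 'a" where
  "iter f num.One x = f x"
| "iter f (num.Bit0 n) x = iter f n (iter f n x)"
| "iter f (num.Bit1 n) x = iter f n (iter f n (f x))"

primrec scan :: "('b \<Rightarrow> 'a \<Rightarrow> 'b) \<Rightarrow> 'b \<Rightarrow> 'a list \<Rightarrow> 'b list" where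
  "scan f z [] = [z]"
| "scan f z (a # L) = z # scan f (f z a) L"

primrec drop_num :: "num \<Rightarrow> 'a list \<Rightarrow> 'a list" where
  "drop_num num.One xs = tl xs"
| "drop_num (num.Bit0 n) xs = drop_num n (drop_num n xs)"
| "drop_num (num.Bit1 n) xs = drop_num n (drop_num n (tl xs))"

primrec ppow :: "num \<Rightarrow> num \<Rightarrow> num" where
  "ppow p num.One = p"
| "ppow p (num.Bit0 n) = ppow p n * ppow p n"
| "ppow p (num.Bit1 n) = p * (ppow p n * ppow p n)"

fun half :: "num \<Rightarrow> num" where
  "half num.One = num.One"
| "half (num.Bit0 b) = b"
| "half (num.Bit1 b) = b + num.One"

fun pred :: "num \<Rightarrow> num" where
  "pred num.One = num.One"
| "pred (num.Bit0 b) = num.One"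
| "pred (num.Bit1 b) = num.Bit0 b"

text \<open>A pair of an exponent $v$ and a residue $x$ stands for the number $p^v x$. Numerals are
positive, so the exponent 0 is written \<^const>\<open>None\<close>.\<close>

type_synonym factor = "num option \<times> num"

fun oinc :: "num option \<Rightarrow> num option" where
  "oinc None = Some num.One"
| "oinc (Some v) = Some (v + num.One)"

fun factor_entry :: "bool \<Rightarrow> num \<Rightarrow> factor list \<Rightarrow> factor" where
  "factor_entry False x qs = (None, x)"
| "factor_entry True x [] = (None, x)"
| "factor_entry True x (q # qs) = (oinc (fst q), snd q)"

fun next_count :: "bool \<Rightarrow> num \<Rightarrow> num" where
  "next_count False c = c + num.One"
| "next_count True c = num.One"

fun next_quots :: "bool \<Rightarrow> factor list \<Rightarrow> factor list" where
  "next_quots False qs = qs"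
| "next_quots True qs = tl qs"

text \<open>Splits the members $x, x+s, x+2s, \dots$ of an arithmetic progression into powers of $p$
and prime-to-$p$ parts. The counter reaches $p$ exactly at the multiples of $p$; dividing those by
$p$ gives a progression with the same step, whose splitting is \<open>qs\<close>. Starting with no
information about the quotients and iterating, the $m$-th round knows all exponents below
$m$.\<close>

primrec factors :: "num \<Rightarrow> num \<Rightarrow> unit list \<Rightarrow> num \<Rightarrow> num \<Rightarrow> factor list \<Rightarrow> factor list" where
  "factors p s [] c x qs = []"
| "factors p s (f # fs) c x qs =
     factor_entry (c = p) x qs # factors p s fs (next_count (c = p) c) (x + s) (next_quots (c = p) qs)"

fun advance :: "num \<Rightarrow> num \<Rightarrow> num \<times> num \<Rightarrow> factor \<Rightarrow> num \<times> num" where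
  "advance h c (v, x) (None, a) = (v, mmul h c x a)"
| "advance h c (v, x) (Some w, a) = (v + w, mmul h c x a)"

fun square :: "num \<Rightarrow> num \<Rightarrow> num \<times> num \<Rightarrow> num \<times> num" where
  "square h c (v, x) = (num.Bit0 v, mmul h c x x)"

text \<open>Next, the values $p^{2e}(t_0 - s_i)$ for the partial sums $s_i$ of the alternating
series of inverse odd squares, all over one common denominator, which is prime to $p$. A term whose
odd denominator has exponent $v$ contributes a multiple of $p^{2(e-v)}$, and this is 0 modulo $M$
unless $v$ is close to $e$. The list \<open>gs\<close> in what follows has these powers of $p$, with
\<^const>\<open>None\<close> for 0; only the terms with another entry are computed with.\<close>

fun vals_below :: "num \<Rightarrow> factor list \<Rightarrow> bool" where
  "vals_below E [] = True"
| "vals_below E ((None, a) # L) = vals_below E L"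
| "vals_below E ((Some v, a) # L) = (v < E \<and> vals_below E L)"

primrec powers :: "num \<Rightarrow> num \<Rightarrow> unit list \<Rightarrow> num list" where
  "powers b a [] = []"
| "powers b a (f # fs) = a # powers b (a * b) fs"

fun keep :: "bool \<Rightarrow> num \<Rightarrow> num option" where
  "keep True a = Some a"
| "keep False a = None"

definition cap :: "num \<Rightarrow> num \<Rightarrow> num option" where
  "cap M a = keep (a < M) a"

fun pick :: "'a list \<Rightarrow> num option \<Rightarrow> 'a" where
  "pick xs None = hd xs"
| "pick xs (Some v) = hd (drop_num v xs)"

text \<open>The components are: the current value times the current denominator, that denominator,
the sign of the next term, the opposite sign, and the odd factor by which the denominator grew in
the last step, if it did.\<close>

type_synonym tail_state = "num option \<times> num \<times> num \<times> num \<times> num option"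

fun tail_num :: "num \<Rightarrow> num \<Rightarrow> num option \<Rightarrow> num \<Rightarrow> num \<Rightarrow> num option" where
  "tail_num h c None a t = Some (mmul h c t num.One)"
| "tail_num h c (Some y) a t = Some (mmul h c (mmul h c y a) a + mmul h c t num.One)"

fun tail_step' :: "num \<Rightarrow> num \<Rightarrow> num option \<Rightarrow> num \<Rightarrow> tail_state \<Rightarrow> tail_state" where
  "tail_step' h c None a (y, D, s, s', r) = (y, D, s', s, None)"
| "tail_step' h c (Some g) a (y, D, s, s', r) =
     (tail_num h c y a (mmul h c D (g * s)), mmul h c (mmul h c D a) a, s', s, Some a)"

fun tail_step :: "num \<Rightarrow> num \<Rightarrow> num option list \<Rightarrow> tail_state \<Rightarrow> factor \<Rightarrow> tail_state" where
  "tail_step h c gs st (v, a) = tail_step' h c (pick gs v) a st"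

text \<open>Running backwards through the states, this collects the factors by which the final
denominator exceeds that of the state.\<close>

fun codenom :: "num \<Rightarrow> num \<Rightarrow> num \<Rightarrow> tail_state \<Rightarrow> num" where
  "codenom h c D (y, E, s, s', None) = D"
| "codenom h c D (y, E, s, s', Some a) = mmul h c (mmul h c D a) a"

fun head_item :: "num \<Rightarrow> num \<Rightarrow> tail_state \<times> num \<times> (num \<times> num) \<times> (num \<times> num) \<Rightarrow> num \<times> num option" where
  "head_item h c ((None, E), D, (v, f), (w, b)) = (v + w, None)"
| "head_item h c ((Some y, E), D, (v, f), (w, b)) = (v + w, Some (mmul h c (mmul h c (mmul h c f b) y) D))"

text \<open>The four factors of a summand of a moment: the first, third and fourth are products of
integers, the second contains the partial sum and may vanish modulo $M$.\<close>

type_synonym item = "(num \<times> num) \<times> (num \<times> num option) \<times> (num \<times> num) \<times> (num \<times> num)"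

fun item_val :: "item \<Rightarrow> num" where
  "item_val ((v1, a1), (v2, x), (v3, a3), (v4, a4)) = v1 + v2 + (v3 + v4)"

text \<open>A conditional as a function on truth values, so that equations alone evaluate
it.\<close>

fun choose2 :: "bool \<Rightarrow> 'a \<Rightarrow> 'a \<Rightarrow> 'a" where
  "choose2 True a b = a"
| "choose2 False a b = b"

text \<open>The exponent $v$ of a summand is compared with the exponent $m$ that is divided out: the
result is \<open>Some (Some w)\<close> with $w = p^{v-m}$, or \<open>Some None\<close> if $p^{v-m}$
vanishes modulo $M$, or \<^const>\<open>None\<close> if $v < m$, in which case the check
fails.\<close>

primrec excess :: "num list \<Rightarrow> num \<Rightarrow> num \<Rightarrow> num option option" where
  "excess [] m v = choose2 (m \<le> v) (Some None) None"
| "excess (w # ws) m v = choose2 (v = m) (Some (Some w)) (excess ws (m + num.One) v)"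

fun item_weight :: "num \<Rightarrow> num \<Rightarrow> num option \<Rightarrow> item \<Rightarrow> num option" where
  "item_weight h c None q = None"
| "item_weight h c (Some w) ((v1, a1), (v2, None), (v3, a3), (v4, a4)) = None"
| "item_weight h c (Some w) ((v1, a1), (v2, Some x), (v3, a3), (v4, a4)) =
     Some (mmul h c (mmul h c (mmul h c x a1) a3) (a4 * w))"

fun oadd :: "num option \<Rightarrow> num option \<Rightarrow> num option" where
  "oadd None b = b"
| "oadd (Some a) None = Some a"
| "oadd (Some a) (Some b) = Some (a + b)"

text \<open>Before the summand with index $i$ the list holds the sums of $w_l \binom{i-1-l}{j}$ over
$l < i$, for all $j$. By Pascal's rule each entry grows by its predecessor, and the new summand
enters at $j = 0$.\<close>

primrec push :: "num option list \<Rightarrow> num option \<Rightarrow> num option list" where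
  "push [] w = []"
| "push (s # ss) w = oadd w s # push ss s"

fun accumulate :: "num \<Rightarrow> num \<Rightarrow> num option option \<Rightarrow> item \<Rightarrow> num option list \<Rightarrow> num option list" where
  "accumulate h c None q ss = []"
| "accumulate h c (Some w) q ss = push ss (item_weight h c w q)"

primrec moments :: "num \<Rightarrow> num \<Rightarrow> num list \<Rightarrow> num \<Rightarrow> (num \<times> num) list \<Rightarrow> (num \<times> num option) list
    \<Rightarrow> (num \<times> num) list \<Rightarrow> (num \<times> num) list \<Rightarrow> num option list \<Rightarrow> num option list" where
  "moments h c ws m [] xs bs os ss = ss"
| "moments h c ws m (f # fs) xs bs os ss =
    (let q = (f, hd xs, hd bs, hd os) in
      moments h c ws m fs (tl xs) (tl bs) (tl os) (accumulate h c (excess ws m (item_val q)) q ss))"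

lemma moments_Cons:
  "moments h c ws m (f # fs) (x # xs) (b # bs) (y # os) ss =
    moments h c ws m fs xs bs os (accumulate h c (excess ws m (item_val (f, x, b, y))) (f, x, b, y) ss)"
  by (simp add: Let_def)

fun unopt :: "num \<Rightarrow> num option \<Rightarrow> num" where
  "unopt M None = M"
| "unopt M (Some a) = a"

text \<open>Multiplication by $x$ in the basis of binomial coefficients: $x\binom{x}{j} =
j\binom{x}{j} + (j+1)\binom{x}{j+1}$. The last entry is lost, which is why the list of moments is
longer than the largest row index.\<close>

fun times_x' :: "num \<Rightarrow> num list \<Rightarrow> num list" where
  "times_x' k [] = []"
| "times_x' k [a] = []"
| "times_x' k (a # b # L) = (k * a + (k + num.One) * b) # times_x' (k + num.One) (b # L)"

fun times_x :: "num list \<Rightarrow> num list" where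
  "times_x [] = []"
| "times_x [a] = []"
| "times_x (a # b # L) = b # times_x' num.One (b # L)"

primrec columns :: "num \<Rightarrow> num \<Rightarrow> num option list \<Rightarrow> unit list \<Rightarrow> num list \<Rightarrow> num list list" where
  "columns h c ds [] mu = []"
| "columns h c ds (f # fs) mu = map (redc h c) (map (pick mu) ds) # columns h c ds fs (times_x mu)"

fun comb :: "num \<Rightarrow> num \<Rightarrow> num \<Rightarrow> num \<Rightarrow> num \<times> num \<Rightarrow> num" where
  "comb h c a n (x, y) = mmul h c a y + mmul h c n x"

text \<open>Elimination without division: the entry below and to the right of the pivot $a$ becomes
$a y - b x$, where \<open>M1\<close> represents $-1$.\<close>

fun eliminate :: "num \<Rightarrow> num \<Rightarrow> num \<Rightarrow> num \<Rightarrow> num list \<Rightarrow> num list \<Rightarrow> num list" where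
  "eliminate h c M1 a r [] = []"
| "eliminate h c M1 a r (b # bs) = map (comb h c a (mmul h c M1 b)) (zip r bs)"

text \<open>A pivot is accepted if its reduced residue is below $p$: numerals are positive, so it is
then not divisible by $p$.\<close>

fun nonsingular :: "num \<Rightarrow> num \<Rightarrow> num \<Rightarrow> num \<Rightarrow> unit list \<Rightarrow> num list list \<Rightarrow> bool" where
  "nonsingular h c M1 p [] rs = True"
| "nonsingular h c M1 p (f # fs) [] = False"
| "nonsingular h c M1 p (f # fs) ([] # rs) = False"
| "nonsingular h c M1 p (f # fs) ((a # r) # rs) =
    (redc h c a < p \<and> nonsingular h c M1 p fs (map (eliminate h c M1 (mmul h c a num.One) r) rs))"

fun dot :: "(num \<times> num) list \<Rightarrow> num" where
  "dot [] = num.One"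
| "dot [(x, y)] = x * y"
| "dot ((x, y) # q # L) = x * y + dot (q # L)"

fun row_ok :: "num \<Rightarrow> num \<Rightarrow> num list \<Rightarrow> (num list \<times> num) list \<Rightarrow> bool" where
  "row_ok h c z [] = True"
| "row_ok h c z ((y, t) # L) = (redc h c (redc h c (dot (zip z y))) = t \<and> row_ok h c z L)"

primrec rows_ok :: "num \<Rightarrow> num \<Rightarrow> num \<Rightarrow> num list list \<Rightarrow> num list \<Rightarrow> num list list \<Rightarrow> bool" where
  "rows_ok h c M cs ts [] = True"
| "rows_ok h c M cs ts (z # zs) = (row_ok h c z (zip cs ts) \<and> rows_ok h c M cs (M # ts) zs)"

primrec konst :: "'a \<Rightarrow> unit list \<Rightarrow> 'a list" where
  "konst a [] = []"
| "konst a (f # fs) = a # konst a fs"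

fun same_len :: "'a list \<Rightarrow> 'b list \<Rightarrow> bool" where
  "same_len [] [] = True"
| "same_len (x # xs) (y # ys) = same_len xs ys"
| "same_len [] (y # ys) = False"
| "same_len (x # xs) [] = False"

text \<open>No matrix is given where the moments form a matrix invertible modulo $p$. Otherwise the
entry is $(d + 1, p^d, Z)$, and the product of $Z$ with the matrix must be $p^d$ times the identity
modulo $M$. The exponent is shifted by one because numerals are positive.\<close>

type_synonym cert = "(nat \<times> nat \<times> nat list list) option"

fun mat_ok :: "num \<Rightarrow> num \<Rightarrow> num \<Rightarrow> num \<Rightarrow> num \<Rightarrow> num \<Rightarrow> unit list \<Rightarrow> cert \<Rightarrow> num list list \<Rightarrow> bool" where
  "mat_ok p K E h c M fS None cs = nonsingular h c (pred M) p fS cs"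
| "mat_ok p K E h c M fS (Some (D, P, Z)) cs =
    (num_of_nat D \<le> K \<and> num_of_nat D + num.One \<le> num.Bit0 E
     \<and> num_of_nat P * p = ppow p (num_of_nat D)
     \<and> same_len fS Z \<and> list_all (same_len fS) Z
     \<and> rows_ok h c M cs (num_of_nat P # konst M fS) (map (map num_of_nat) Z))"

fun onum :: "nat \<Rightarrow> num option" where
  "onum n = (if n = 0 then None else Some (num_of_nat n))"

declare onum.simps [simp del]

type_synonym row = "nat \<times> nat \<times> nat \<times> nat list \<times> nat"

text \<open>The rows are $(B, (n, S, q, ds, L))$ with $n = 2B + \max A$, the point $1/q$, the list
\<open>ds\<close> of the differences $\max A - a$ for $a \in A$ in increasing order, and the number
$L$ of binomial moments that are computed.\<close>

definition case_table :: "(nat \<times> row) list" where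
  "case_table = [
    (20, 40, 1, 2, [0], 1), (21, 43, 1, 1, [0], 1), (25, 50, 1, 1, [0], 1),
    (30, 61, 1, 1, [0], 1), (35, 70, 1, 1, [0], 1), (39, 79, 1, 1, [0], 1),
    (40, 81, 2, 1, [1, 0], 3), (50, 104, 2, 1, [1, 0], 3), (59, 119, 2, 1, [1, 0], 3),
    (60, 122, 3, 1, [2, 1, 0], 5), (70, 144, 3, 1, [4, 3, 0], 7), (79, 163, 3, 1, [2, 1, 0], 5),
    (80, 164, 4, 1, [3, 2, 1, 0], 7), (90, 183, 4, 1, [3, 2, 1, 0], 7), (99, 202, 4, 1, [4, 3, 1, 0], 8),
    (100, 207, 5, 1, [6, 5, 4, 3, 0], 11), (110, 224, 5, 1, [4, 3, 2, 1, 0], 9),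
    (119, 242, 5, 1, [4, 3, 2, 1, 0], 9)]"

primrec find_row :: "nat \<Rightarrow> (nat \<times> row) list \<Rightarrow> row" where
  "find_row B [] = (0, 0, 0, [], 0)"
| "find_row B (r # rs) = choose2 (B = fst r) (snd r) (find_row B rs)"

definition fuel :: "nat \<Rightarrow> unit list" where
  "fuel n = iter (Cons ()) (num_of_nat n) []"

text \<open>Several cases share the tables for one prime. An entry consists of $B$, the shift $N -
n$, the exponent that is divided out of the moments, and the certificate.\<close>

type_synonym entry = "nat \<times> nat \<times> nat \<times> cert"

text \<open>In this order: $p$; the exponent $K$ of the modulus; bounds $N$ and $B_m$ for $n$ and
$B$ (with $n < N$); $h$ and the counter \<open>c\<close> for \<^const>\<open>redc\<close>; the
modulus $M = p^K$; its powers below $M$; and the products of factors from which the summands are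
composed.\<close>

type_synonym tables = "num \<times> num \<times> num \<times> num \<times> num \<times> num \<times> num \<times> num list
  \<times> (num \<times> num) list \<times> (num \<times> num) list \<times> (num \<times> num) list"

type_synonym subgroup = "nat \<times> nat \<times> nat \<times> nat \<times> entry list"

fun env_h :: "tables \<Rightarrow> num" where "env_h (p, K, N, Bm, h, c, M, r) = h"
fun env_c :: "tables \<Rightarrow> num" where "env_c (p, K, N, Bm, h, c, M, r) = c"
fun env_M :: "tables \<Rightarrow> num" where "env_M (p, K, N, Bm, h, c, M, r) = M"

text \<open>The moments are combined without reduction, so the columns are reduced with a longer
counter.\<close>

fun moments_ok :: "tables \<Rightarrow> num \<Rightarrow> cert \<Rightarrow> row \<Rightarrow> num option list \<Rightarrow> bool" where
  "moments_ok (p, K, N, Bm, h, c, M, ws, fs, bs, os) E cert (n, S, q', ds, L) ss =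
    (same_len (fuel L) ss \<and>
     mat_ok p K E h c M (fuel S) cert
       (columns h (ppow (num.Bit0 num.One) (num_of_nat 72)) (map onum ds) (fuel S) (map (unopt M) ss)))"

fun case_ok :: "tables \<Rightarrow> num \<Rightarrow> num \<Rightarrow> num \<Rightarrow> (num \<times> num option) list \<Rightarrow> entry \<Rightarrow> row \<Rightarrow> bool" where
  "case_ok (p, K, N, Bm, h, c, M, ws, fs, bs, os) E q N' xs (B, dl, m, cert) (n, S, q', ds, L) =
    (num_of_nat n + num_of_nat dl = N \<and> num_of_nat n < N' \<and> num_of_nat B \<le> Bm \<and> num_of_nat q' = q \<and>
     moments_ok (p, K, N, Bm, h, c, M, ws, fs, bs, os) E cert (n, S, q', ds, L)
       (moments h c ws (num_of_nat m) (drop_num (num_of_nat dl) fs) xs (drop_num (num_of_nat S) bs)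
         (drop_num (num_of_nat B) os) (konst None (fuel L))))"

primrec cases_ok :: "tables \<Rightarrow> num \<Rightarrow> num \<Rightarrow> num \<Rightarrow> (num \<times> num option) list \<Rightarrow> entry list \<Rightarrow> bool" where
  "cases_ok T E q N' xs [] = True"
| "cases_ok T E q N' xs (e # es) =
    (case_ok T E q N' xs e (find_row (fst e) case_table) \<and> cases_ok T E q N' xs es)"

fun heads_ok :: "tables \<Rightarrow> num \<Rightarrow> num \<Rightarrow> num \<Rightarrow> entry list \<Rightarrow> (num \<times> num) list \<Rightarrow> (num \<times> num) list \<Rightarrow> tail_state list \<Rightarrow> bool" where
  "heads_ok T E q N' es fs' bs' Ys =
    cases_ok T E q N' (rev (map (head_item (env_h T) (env_c T)) (zip Ys (zip (scan (codenom (env_h T) (env_c T)) num.One Ys) (zip fs' bs'))))) es"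

fun tails_ok :: "tables \<Rightarrow> num \<Rightarrow> num \<Rightarrow> num \<Rightarrow> entry list \<Rightarrow> (num \<times> num) list \<Rightarrow> (num \<times> num) list \<Rightarrow> num option list \<Rightarrow> factor list \<Rightarrow> bool" where
  "tails_ok T E q N' es fs' bs' gs ON =
    (vals_below E ON \<and>
    heads_ok T E q N' es fs' bs'
      (rev (tl (scan (tail_step (env_h T) (env_c T) gs) (hd gs, q, pred (env_M T), num.One, None) ON))))"

fun subgroup_ok :: "tables \<Rightarrow> (num \<times> num) list \<Rightarrow> factor list \<Rightarrow> subgroup \<Rightarrow> bool" where
  "subgroup_ok (p, K, N, Bm, h, c, M, ws, fs, bs, os) rbs OL (E, q, N', d, es) =
    (num_of_nat N' + num_of_nat d = N + num.One \<and>
     tails_ok (p, K, N, Bm, h, c, M, ws, fs, bs, os) (num_of_nat E) (num_of_nat q) (num_of_nat N') es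
      (drop_num (num_of_nat d) fs) (drop_num (num_of_nat d) rbs)
      (rev (map (cap M) (powers (p * p) num.One (fuel E)))) (map snd (zip (fuel N') OL)))"

text \<open>The check is split into stages because rewriting evaluates arguments first: every table
is computed once, before it is copied to the places that use it. The products run downwards from
$N$, because the factorials of $n - i$ occur in the denominators. Those of odd numbers start at
index $N + 4$, since the shift by $S \le 5$ columns leads beyond $n < N$.\<close>

definition group_ok3 where
  "group_ok3 p K N Bm h c M gs OL fs rbs os \<longleftrightarrow>
    list_all (subgroup_ok (p, K, N, Bm, h, c, M, powers p num.One (iter (Cons ()) K []), fs, rev rbs, os)
      (drop_num (num.Bit0 (num.Bit0 num.One)) rbs) OL) gs"

definition group_ok2 where
  "group_ok2 p K N Bm h c M gs fN FL OL \<longleftrightarrow>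
    group_ok3 p K N Bm h c M gs OL
      (scan (advance h c) (num.One, num.One) (rev FL))
      (scan (advance h c) (num.One, num.One) (rev (tl (map snd (zip (() # () # () # () # () # fN) OL)))))
      (map (square h c) (scan (advance h c) (num.One, num.One) (tl OL)))"

text \<open>The first condition makes $p$ to the number of rounds exceed all odd numbers of the
table, so that their splitting is complete. The counter is a few digits longer than the modulus,
which keeps sums of products small after reduction.\<close>

definition group_ok1 where
  "group_ok1 p K lev N Bm gs M PL hp fN fO \<longleftrightarrow>
    num.Bit0 (N + Bm) < PL \<and> num.Bit0 hp = p + num.One \<and> num.Bit0 (half M) = M + num.One
    \<and> pred M + num.One = M \<and> num.Bit1 (num.Bit0 num.One) \<le> Bm \<and>
    group_ok2 p K N Bm (half M) (num.Bit0 (num.Bit0 (num.Bit0 M)) + num_of_nat 4096) M gs fN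
      (iter (factors p num.One fN num.One num.One) lev [])
      (iter (factors p (num.Bit0 num.One) fO hp num.One) lev [])"

type_synonym group = "(nat \<times> nat \<times> nat \<times> nat) \<times> subgroup list"

fun group_ok :: "num \<Rightarrow> group \<Rightarrow> bool" where
  "group_ok p ((K, lev, N, Bm), gs) =
    group_ok1 p (num_of_nat K) (num_of_nat lev) (num_of_nat N) (num_of_nat Bm) gs
      (ppow p (num_of_nat K)) (ppow p (num_of_nat lev)) (half p)
      (fuel N) (iter (Cons ()) (num_of_nat Bm) (fuel N))"

primrec occurs :: "nat \<Rightarrow> nat list \<Rightarrow> bool" where
  "occurs B [] = False"
| "occurs B (x # xs) = choose2 (B = x) True (occurs B xs)"

primrec covered :: "nat \<Rightarrow> nat list \<Rightarrow> (nat \<times> row) list \<Rightarrow> bool" where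
  "covered p Bs [] = True"
| "covered p Bs (r # rs) =
    (choose2 (p \<le> 6 * fst r + 2 * fst (snd (snd r)) + 5) (occurs (fst r) Bs) True \<and> covered p Bs rs)"

definition case_ids :: "group list \<Rightarrow> nat list" where
  "case_ids gs = map fst (concat (map (snd \<circ> (snd \<circ> (snd \<circ> snd))) (concat (map snd gs))))"

fun prime_ok :: "nat \<times> group list \<Rightarrow> bool" where
  "prime_ok (p, gs) = (covered p (case_ids gs) case_table \<and> list_all (group_ok (num_of_nat p)) gs)"

text \<open>The equations for evaluation. Addition with carry is a separate function, which saves
rewriting steps.\<close>

lemma num_of_nat_simps: "num_of_nat (numeral k) = k" "num_of_nat 1 = num.One"
  "onum 0 = None" "onum 1 = Some num.One" "onum (numeral k) = Some k"
  by (simp_all add: onum.simps num_of_nat_numeral_eq num_of_nat_One)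

definition addc :: "num \<Rightarrow> num \<Rightarrow> num" where
  "addc m n = m + n + num.One"

lemma add_simps:
  "num.One + num.One = num.Bit0 num.One"
  "num.One + num.Bit0 n = num.Bit1 n"
  "num.One + num.Bit1 n = num.Bit0 (n + num.One)"
  "num.Bit0 m + num.One = num.Bit1 m"
  "num.Bit0 m + num.Bit0 n = num.Bit0 (m + n)"
  "num.Bit0 m + num.Bit1 n = num.Bit1 (m + n)"
  "num.Bit1 m + num.One = num.Bit0 (m + num.One)"
  "num.Bit1 m + num.Bit0 n = num.Bit1 (m + n)"
  "num.Bit1 m + num.Bit1 n = num.Bit0 (addc m n)"
  "addc num.One num.One = num.Bit1 num.One"
  "addc num.One (num.Bit0 n) = num.Bit0 (n + num.One)"
  "addc num.One (num.Bit1 n) = num.Bit1 (n + num.One)"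
  "addc (num.Bit0 m) num.One = num.Bit0 (m + num.One)"
  "addc (num.Bit0 m) (num.Bit0 n) = num.Bit1 (m + n)"
  "addc (num.Bit0 m) (num.Bit1 n) = num.Bit0 (addc m n)"
  "addc (num.Bit1 m) num.One = num.Bit1 (m + num.One)"
  "addc (num.Bit1 m) (num.Bit0 n) = num.Bit0 (addc m n)"
  "addc (num.Bit1 m) (num.Bit1 n) = num.Bit1 (addc m n)"
  by (simp_all add: addc_def)

lemma mult_simps:
  "num.One * n = n"
  "num.Bit0 m * n = num.Bit0 (m * n)"
  "num.Bit1 m * n = n + num.Bit0 (m * n)"
  by (simp_all add: num_eq_iff nat_of_num_mult nat_of_num_add algebra_simps)

lemma and_simps: "(True \<and> Q) = Q" "(False \<and> Q) = False"
  by simp_all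

lemmas check_simps =
  redc.simps mmul_def iter.simps scan.simps drop_num.simps ppow.simps half.simps pred.simps oinc.simps
  factor_entry.simps next_count.simps next_quots.simps factors.simps advance.simps square.simps
  vals_below.simps powers.simps keep.simps cap_def pick.simps tail_num.simps tail_step'.simps
  tail_step.simps codenom.simps head_item.simps item_val.simps choose2.simps excess.simps
  item_weight.simps oadd.simps push.simps accumulate.simps moments.simps(1) moments_Cons unopt.simps
  times_x'.simps times_x.simps columns.simps comb.simps eliminate.simps nonsingular.simps dot.simps
  row_ok.simps rows_ok.simps konst.simps mat_ok.simps num_of_nat_simps find_row.simps fuel_def
  case_table_def case_ok.simps moments_ok.simps cases_ok.simps heads_ok.simps tails_ok.simps subgroup_ok.simps case_ids_def o_apply env_h.simps env_c.simps env_M.simps group_ok3_def group_ok2_def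
  group_ok1_def group_ok.simps occurs.simps covered.simps prime_ok.simps
  add_simps mult_simps le_num_simps less_num_simps eq_num_simps
  numeral_plus_numeral numeral_times_numeral numeral_le_iff numeral_eq_iff mult_1_right mult_1_left
  and_simps list.map zip_Cons_Cons zip_Nil zip.simps(1) list.sel fst_conv snd_conv fold_simps
  rev_conv_fold list.pred_inject append.simps concat.simps same_len.simps

section \<open>Residues and factor lists\<close>

primrec clen :: "num \<Rightarrow> nat" where
  "clen num.One = 0" | "clen (num.Bit0 c) = Suc (clen c)" | "clen (num.Bit1 c) = Suc (clen c)"

fun exponent_of :: "num option \<Rightarrow> nat" where
  "exponent_of None = 0" | "exponent_of (Some v) = nat_of_num v"

lemma nat_of_num_add_One: "nat_of_num (v + num.One) = Suc (nat_of_num v)"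
  by (simp add: nat_of_num_add)

lemma exponent_of_oinc: "exponent_of (oinc v) = Suc (exponent_of v)"
  by (cases v) (auto simp: nat_of_num_add_One)

lemma iter_funpow: "iter f n x = (f ^^ nat_of_num n) x"
  by (induction n arbitrary: x) (auto simp: funpow_add funpow_Suc_right simp del: funpow.simps(2))

lemma drop_num_drop: "drop_num n xs = drop (nat_of_num n) xs"
  by (induction n arbitrary: xs) (auto simp: drop_Suc)

lemma numeral_ppow: "numeral (ppow p n) = (numeral p :: 'a :: comm_semiring_1) ^ nat_of_num n"
  by (induction n) (auto simp: numeral_mult power_add simp del: numeral_plus_numeral numeral_plus_one one_plus_numeral numeral_times_numeral)

lemma numeral_nat_of_num: "numeral n = (of_nat (nat_of_num n) :: 'a :: semiring_1)"
  by (simp add: nat_of_num_numeral)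

lemma length_scan [simp]: "length (scan f z L) = Suc (length L)"
  by (induction L arbitrary: z) auto

lemma scan_nth_0 [simp]: "scan f z L ! 0 = z"
  by (cases L) auto

lemma scan_nth_Suc: "i < length L \<Longrightarrow> scan f z L ! Suc i = f (scan f z L ! i) (L ! i)"
proof (induction L arbitrary: z i)
  case (Cons a L)
  then show ?case by (cases i) auto
qed simp

lemma length_factors [simp]: "length (factors p s f cnt x qs) = length f"
  by (induction f arbitrary: cnt x qs) auto

lemma length_iter_Cons: "length (iter (Cons a) n xs) = nat_of_num n + length xs"
proof -
  have "length ((Cons a ^^ m) xs) = m + length xs" for m by (induction m) auto
  then show ?thesis by (simp add: iter_funpow)
qed

lemma length_fuel: "n > 0 \<Longrightarrow> length (fuel n) = n"
  by (simp add: fuel_def length_iter_Cons num_of_nat_inverse)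

lemma length_powers [simp]: "length (powers b a f) = length f"
  by (induction f arbitrary: a) auto

lemma nth_powers: "i < length f \<Longrightarrow> (numeral (powers b a f ! i) :: 'a :: comm_semiring_1) = numeral a * numeral b ^ i"
proof (induction f arbitrary: a i)
  case (Cons x f)
  show ?case
  proof (cases i)
    case (Suc j)
    then have "(numeral (powers b (a * b) f ! j) :: 'a) = numeral (a * b) * numeral b ^ j"
      using Cons by simp
    then show ?thesis unfolding Suc numeral_mult by (simp add: mult.assoc)
  qed simp
qed simp

text \<open>The modulus is $p^k$, and \<open>h\<close> is the inverse of 2 for it.\<close>

locale modulus = prime_int +
  fixes P h c :: num and k :: nat
  assumes p: "p = numeral P" and odd: "odd p" and k: "k \<ge> 1" and h: "2 * numeral h = p ^ k + 1"
begin

abbreviation pr :: rat where "pr \<equiv> of_int p"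

definition R :: rat where "R = 2 ^ clen c"

definition approx :: "rat \<Rightarrow> num \<Rightarrow> bool" where
  "approx x a \<longleftrightarrow> zp p ((x - numeral a) / pr ^ k)"

text \<open>A missing numeral stands for the residue 0.\<close>

definition approx_opt :: "rat \<Rightarrow> num option \<Rightarrow> bool" where
  "approx_opt x a = (case a of None \<Rightarrow> zp p (x / pr ^ k) | Some b \<Rightarrow> approx x b)"

definition represents :: "rat \<Rightarrow> num \<times> num \<Rightarrow> bool" where
  "represents x a \<longleftrightarrow> approx (x / pr ^ nat_of_num (fst a)) (snd a)"

definition represents_factor :: "rat \<Rightarrow> factor \<Rightarrow> bool" where
  "represents_factor x a \<longleftrightarrow> approx (x / pr ^ exponent_of (fst a)) (snd a)"

lemma p_0 [simp]: "p \<noteq> 0"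
  using prime by auto

lemma zp_pr: "zp p (pr ^ n)"
  by (intro zp_power zp_of_int)

lemma unit_2: "\<not> p dvd 2"
proof
  assume "p dvd 2"
  then have "p \<le> 2" by (rule zdvd_imp_le) simp
  with prime_gt_1_int[OF prime] have "p = 2" by simp
  with odd show False by simp
qed

lemma zp_half: "zp p (1 / 2)"
  using zp_inverse_int[OF unit_2] by simp

lemma approx_numeral: "approx (numeral a) a"
  by (simp add: approx_def zp_0)

lemma approx_One: "approx 1 num.One"
  using approx_numeral[of num.One] by simp

lemma approx_imp_zp: assumes "approx x a" shows "zp p x"
proof -
  have "zp p ((x - numeral a) / pr ^ k * pr ^ k + numeral a)"
    using assms unfolding approx_def by (intro zp_add zp_mult zp_pr zp_numeral)
  then show ?thesis by simp
qed

lemma approx_add: assumes "approx x a" "approx y b" shows "approx (x + y) (a + b)"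
proof -
  have "(x + y - numeral (a + b)) / pr ^ k = (x - numeral a) / pr ^ k + (y - numeral b) / pr ^ k"
    by (simp add: numeral_add diff_divide_distrib add_divide_distrib del: numeral_plus_numeral numeral_plus_one one_plus_numeral numeral_times_numeral)
  then show ?thesis using assms unfolding approx_def by (simp add: zp_add)
qed

lemma approx_mult: assumes "approx x a" "approx y b" shows "approx (x * y) (a * b)"
proof -
  have "(x * y - numeral (a * b)) / pr ^ k = (x - numeral a) / pr ^ k * y + numeral a * ((y - numeral b) / pr ^ k)"
    by (simp add: numeral_mult field_simps del: numeral_plus_numeral numeral_plus_one one_plus_numeral numeral_times_numeral)
  then show ?thesis unfolding approx_def
    by (simp only:) (intro zp_add zp_mult zp_numeral approx_imp_zp[OF assms(2)] assms[unfolded approx_def])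
qed

lemma approx_add_zero: assumes "approx x a" "zp p (z / pr ^ k)" shows "approx (x + z) a"
proof -
  have "(x + z - numeral a) / pr ^ k = (x - numeral a) / pr ^ k + z / pr ^ k"
    by (simp add: field_simps)
  then show ?thesis using assms unfolding approx_def by (simp add: zp_add)
qed

lemma approx_modulus: assumes "numeral M = p ^ k" shows "zp p (x / pr ^ k) \<longleftrightarrow> approx x M"
proof -
  have "numeral M = pr ^ k" using arg_cong[OF assms, of "of_int :: int \<Rightarrow> rat"] by simp
  then have "(x - numeral M) / pr ^ k = x / pr ^ k - 1" by (simp add: field_simps)
  then show ?thesis unfolding approx_def
    using zp_diff[OF _ zp_1, of "x / pr ^ k"] zp_add[OF _ zp_1, of "x / pr ^ k - 1"] by auto
qed

lemma approx_opt_Some: "approx_opt x (Some a) = approx x a"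
  by (simp add: approx_opt_def)

lemma approx_opt_imp_zp: assumes "approx_opt x a" shows "zp p x"
proof (cases a)
  case None
  with assms have "zp p (x / pr ^ k)" by (simp add: approx_opt_def)
  from zp_mult[OF this zp_pr[of k]] show ?thesis by simp
qed (use assms approx_imp_zp in \<open>auto simp: approx_opt_def\<close>)

lemma approx_opt_oadd: "approx_opt x a \<Longrightarrow> approx_opt y b \<Longrightarrow> approx_opt (x + y) (oadd a b)"
  using approx_add_zero[of x "the a" y] approx_add_zero[of y "the b" x] approx_add[of x "the a" y "the b"]
    zp_add[of "x / pr ^ k" "y / pr ^ k"]
  by (cases a; cases b) (auto simp: approx_opt_def add_divide_distrib add.commute)

lemma zero_mult: "zp p (x / pr ^ k) \<Longrightarrow> zp p y \<Longrightarrow> zp p (x * y / pr ^ k)"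
  using zp_mult[of "x / pr ^ k" y] by simp

text \<open>Halving is possible for residues because $2h = p^k + 1$.\<close>

lemma approx_half:
  "approx x (num.Bit0 a) \<Longrightarrow> approx (x / 2) a"
  "approx x (num.Bit1 a) \<Longrightarrow> approx (x / 2) (a + h)"
  "approx x num.One \<Longrightarrow> approx (x / 2) h"
proof -
  have eq: "(2 :: rat) * numeral h = pr ^ k + 1"
    using arg_cong[OF h, of "of_int :: int \<Rightarrow> rat"]
    by (simp only: of_int_mult of_int_numeral of_int_add of_int_power of_int_1)
  have halve: "y = z / 2" if "2 * y = z" for y z :: rat
    using that by simp
  have h': "numeral h = (pr ^ k + 1) / 2"
    by (rule halve[OF eq])
  have pk: "pr ^ k \<noteq> 0" by simp
  have even: "(x / 2 - y) / m = (x - (y + y)) / m * (1 / 2)" for x y m :: rat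
    by (cases "m = 0") (simp_all add: field_simps)
  have odd': "(x / 2 - (y + (m + 1) / 2)) / m = ((x - (y + y + 1)) / m - 1) * (1 / 2)"
    "(x / 2 - (m + 1) / 2) / m = ((x - 1) / m - 1) * (1 / 2)" if "m \<noteq> 0" for x y m :: rat
    using that by (simp_all add: field_simps)
  show "approx (x / 2) a" if "approx x (num.Bit0 a)"
    using that unfolding approx_def even numeral_Bit0[of a] by (intro zp_mult zp_half)
  show "approx (x / 2) (a + h)" if "approx x (num.Bit1 a)"
    using that unfolding approx_def numeral_add h' odd'(1)[OF pk] numeral_Bit1[of a]
    by (intro zp_mult zp_diff zp_1 zp_half)
  show "approx (x / 2) h" if "approx x num.One"
    using that unfolding approx_def h' odd'(2)[OF pk] numeral_One
    by (intro zp_mult zp_diff zp_1 zp_half)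
qed

lemma approx_redc: "approx x a \<Longrightarrow> approx (x / 2 ^ clen d) (redc h d a)"
proof (induction d arbitrary: x a)
  case (Bit0 d)
  from Bit0.prems approx_half[of x] Bit0.IH[of "x / 2"] show ?case
    by (cases a) auto
next
  case (Bit1 d)
  from Bit1.prems approx_half[of x] Bit1.IH[of "x / 2"] show ?case
    by (cases a) auto
qed simp

lemma approx_mmul: "approx x a \<Longrightarrow> approx y b \<Longrightarrow> approx (x * y / R) (mmul h c a b)"
  unfolding mmul_def R_def by (intro approx_redc approx_mult)

lemma unit_R: "zp_unit p (1 / 2 ^ d)" 
proof -
  have "\<not> p dvd 2 ^ d" using unit_2 prime prime_dvd_power by blast
  then show ?thesis using zp_unit_inverse[OF zp_unit_of_int[of "2 ^ d"]] by simp
qed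

lemma zp_R: "zp p (1 / R)"
  unfolding R_def by (intro zp_unit_imp_zp unit_R)

lemma R_0 [simp]: "R \<noteq> 0"
  by (simp add: R_def)

text \<open>The splitting is complete unless $p^d$ divides $x$.\<close>

definition split_upto :: "nat \<Rightarrow> int \<Rightarrow> factor \<Rightarrow> bool" where
  "split_upto d x a \<longleftrightarrow> represents_factor (of_int x) a \<and> (p ^ d dvd x \<or> zp_unit p (of_int x / pr ^ exponent_of (fst a)))"

text \<open>The hypothesis on \<open>y\<close> says that the next multiple of $p$ in the progression
is $py$.\<close>

lemma factors_sound:
  assumes "numeral cnt \<le> p" "p * y = numeral x + numeral s * (p - numeral cnt)" "s = num.One \<or> s = num.Bit0 num.One"
    and "\<And>j. j < length qs \<Longrightarrow> split_upto d (y + numeral s * int j) (qs ! j)"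
    and "d = 0 \<or> length f \<le> length qs" and "i < length f"
  shows "split_upto (Suc d) (numeral x + numeral s * int i) (factors P s f cnt x qs ! i)"
  using assms
proof (induction f arbitrary: cnt x qs y i)
  case (Cons a f)
  note IH = Cons.IH and pr = Cons.prems
  have shift: "(y + z) + z * int n = y + z * int (Suc n)" for y z :: int and n
    by (simp add: algebra_simps)
  have step: "p * y = (x + s) + s * (p - (c + 1))" if "p * y = x + s * (p - c)" for x y s c :: int
    using that by (simp add: algebra_simps)
  have step': "p * (y + s) = (p * y + s) + s * (p - 1)" for y s :: int
    by (simp add: algebra_simps)
  have eq: "numeral (x + s) + numeral s * int n = numeral x + numeral s * int (Suc n)" for n
    unfolding numeral_add by (rule shift)
  show ?case
  proof (cases "cnt = P")
    case True
    then have xy: "numeral x = p * y" using pr(2) p by simp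
    show ?thesis
    proof (cases i)
      case 0
      have "split_upto (Suc d) (numeral x) (factor_entry True x qs)"
      proof (cases qs)
        case Nil
        with pr(5) have "d = 0" by auto
        moreover have "p dvd numeral x" unfolding xy by simp
        ultimately show ?thesis
          using approx_numeral[of x] Nil by (auto simp: split_upto_def represents_factor_def)
      next
        case (Cons q qs')
        have q: "split_upto d y q" using pr(4)[of 0] Cons by simp
        have "(of_int (numeral x) :: rat) / pr ^ exponent_of (oinc (fst q)) = of_int y / pr ^ exponent_of (fst q)"
          unfolding xy exponent_of_oinc by simp
        with q show ?thesis
          unfolding split_upto_def represents_factor_def Cons by (auto simp: xy)
      qed
      with 0 True show ?thesis by simp
    next
      case (Suc i')
      have "split_upto (Suc d) (numeral (x + s) + numeral s * int i') (factors P s f num.One (x + s) (tl qs) ! i')"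
      proof (rule IH[where y = "y + numeral s"])
        show "numeral num.One \<le> p" using prime_gt_1_int[OF prime] by simp
        show "p * (y + numeral s) = numeral (x + s) + numeral s * (p - numeral num.One)"
          unfolding numeral_add numeral_One xy by (rule step')
        show "split_upto d (y + numeral s + numeral s * int j) (tl qs ! j)" if "j < length (tl qs)" for j
          using pr(4)[of "Suc j"] that by (simp add: nth_tl algebra_simps)
      qed (use pr Suc in auto)
      then show ?thesis unfolding eq using Suc True by simp
    qed
  next
    case False
    have lt: "numeral cnt < p" using False pr(1) p by simp
    show ?thesis
    proof (cases i)
      case 0
      have "\<not> p dvd numeral x"
      proof
        assume "p dvd numeral x"
        then have "p dvd p * y - numeral x - numeral s * p" by auto
        also have "p * y - numeral x - numeral s * p = - (numeral s * numeral cnt)"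
          using pr(2) by (simp add: algebra_simps)
        finally have "p dvd numeral s * numeral cnt"
          by (simp only: dvd_minus_iff)
        then have "p dvd numeral s \<or> p dvd numeral cnt"
          by (simp only: prime_dvd_mult_iff[OF prime])
        moreover have "\<not> p dvd numeral cnt" using lt zdvd_imp_le by fastforce
        moreover have "\<not> p dvd numeral s" using pr(3) unit_2 prime by (auto simp: not_prime_unit)
        ultimately show False by blast
      qed
      then have "zp_unit p (of_int (numeral x))" by (rule zp_unit_of_int)
      with 0 False approx_numeral[of x] show ?thesis by (simp add: split_upto_def represents_factor_def)
    next
      case (Suc i')
      have "split_upto (Suc d) (numeral (x + s) + numeral s * int i') (factors P s f (cnt + num.One) (x + s) qs ! i')"
      proof (rule IH[where y = y])
        show "numeral (cnt + num.One) \<le> p" using lt by (simp add: numeral_add del: numeral_plus_numeral numeral_plus_one one_plus_numeral numeral_times_numeral)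
        show "p * y = numeral (x + s) + numeral s * (p - numeral (cnt + num.One))"
          unfolding numeral_add numeral_One by (rule step[OF pr(2)])
      qed (use pr Suc in auto)
      then show ?thesis unfolding eq using Suc False by simp
    qed
  qed
qed simp

lemma iter_factors_sound:
  assumes "numeral cnt \<le> p" "p = 1 + numeral s * (p - numeral cnt)" "s = num.One \<or> s = num.Bit0 num.One"
    and "i < length f"
  shows "split_upto (nat_of_num lev) (1 + numeral s * int i) (iter (factors P s f cnt num.One) lev [] ! i)"
    and "length (iter (factors P s f cnt num.One) lev []) = length f"
proof -
  let ?F = "factors P s f cnt num.One"
  have *: "(\<forall>j<length ((?F ^^ d) []). split_upto d (1 + numeral s * int j) ((?F ^^ d) [] ! j))
      \<and> (d = 0 \<or> length ((?F ^^ d) []) = length f)" for d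
  proof (induction d)
    case (Suc d)
    have "split_upto (Suc d) (numeral num.One + numeral s * int j) (?F ((?F ^^ d) []) ! j)" if "j < length f" for j
      by (rule factors_sound[where y = 1]) (use Suc assms that in auto)
    then show ?case by simp
  qed simp
  have lev: "nat_of_num lev \<noteq> 0" using nat_of_num_pos[of lev] by simp
  show "length (iter ?F lev []) = length f"
    using *[of "nat_of_num lev"] lev by (simp add: iter_funpow)
  then show "split_upto (nat_of_num lev) (1 + numeral s * int i) (iter ?F lev [] ! i)"
    using *[of "nat_of_num lev"] assms by (simp add: iter_funpow)
qed

lemma represents_advance: assumes "represents z a" "represents_factor x b" shows "represents (z * x / R) (advance h c a b)"
proof -
  obtain v a' where a: "a = (v, a')" by force
  obtain w b' where b: "b = (w, b')" by force
  have "z * x / R / pr ^ (nat_of_num v + exponent_of w) = z / pr ^ nat_of_num v * (x / pr ^ exponent_of w) / R"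
    by (simp add: power_add)
  moreover have "approx (z / pr ^ nat_of_num v * (x / pr ^ exponent_of w) / R) (mmul h c a' b')"
    using assms unfolding a b represents_def represents_factor_def by (intro approx_mmul) auto
  moreover have "nat_of_num (fst (advance h c a b)) = nat_of_num v + exponent_of w"
    "snd (advance h c a b) = mmul h c a' b'"
    unfolding a b by (cases w; simp add: nat_of_num_add)+
  ultimately show ?thesis
    unfolding represents_def by (simp only:)
qed

lemma represents_scan:
  assumes "\<And>i. i < length L \<Longrightarrow> represents_factor (f i) (L ! i)" "j \<le> length L"
  shows "represents (pr * (\<Prod>i<j. f i / R)) (scan (advance h c) (num.One, num.One) L ! j)"
  using assms(2)
proof (induction j)
  case 0
  show ?case using approx_One by (simp add: represents_def)
next
  case (Suc j)
  then have "represents (pr * (\<Prod>i<j. f i / R) * f j / R) (advance h c (scan (advance h c) (num.One, num.One) L ! j) (L ! j))"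
    by (intro represents_advance assms) auto
  then show ?case using Suc.prems by (simp add: scan_nth_Suc mult_ac)
qed

lemma represents_square: assumes "represents x a" shows "represents (x ^ 2 / R) (square h c a)"
proof -
  obtain v b where a: "a = (v, b)" by force
  have "x ^ 2 / R / pr ^ (nat_of_num v + nat_of_num v) = x / pr ^ nat_of_num v * (x / pr ^ nat_of_num v) / R"
    by (simp add: power_add power2_eq_square)
  moreover have "approx (x / pr ^ nat_of_num v * (x / pr ^ nat_of_num v) / R) (mmul h c b b)"
    using assms unfolding a represents_def by (intro approx_mmul) auto
  moreover have "nat_of_num (fst (square h c a)) = nat_of_num v + nat_of_num v"
    "snd (square h c a) = mmul h c b b"
    unfolding a by simp_all
  ultimately show ?thesis
    unfolding represents_def by (simp only:)
qed

end

section \<open>Partial sums of the series\<close>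

lemma drop_num_pick: "exponent_of v < length xs \<Longrightarrow> pick xs v = xs ! exponent_of v"
  by (cases v) (auto simp: drop_num_drop hd_drop_conv_nth hd_conv_nth)

lemma excess_cases:
  assumes "excess ws m v = Some e"
  shows "case e of None \<Rightarrow> nat_of_num m + length ws \<le> nat_of_num v
    | Some w \<Rightarrow> \<exists>t<length ws. nat_of_num v = nat_of_num m + t \<and> w = ws ! t"
  using assms
proof (induction ws arbitrary: m)
  case Nil
  then show ?case by (cases "m \<le> v") (auto simp: less_eq_num_def)
next
  case (Cons w ws)
  show ?case
  proof (cases "v = m")
    case True
    with Cons.prems show ?thesis by auto
  next
    case False
    with Cons.prems have "excess ws (m + num.One) v = Some e" by simp
    note IH = Cons.IH[OF this]
    show ?thesis
    proof (cases e)
      case (Some w')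
      with IH obtain t where "t < length ws" "nat_of_num v = nat_of_num m + Suc t" "w' = ws ! t"
        by (auto simp: nat_of_num_add)
      then show ?thesis unfolding Some by (auto intro!: exI[of _ "Suc t"])
    qed (use IH in \<open>auto simp: nat_of_num_add\<close>)
  qed
qed

lemma length_push [simp]: "length (push ss w) = length ss"
  by (induction ss arbitrary: w) auto

lemma nth_push: "j < length ss \<Longrightarrow> push ss w ! j = oadd (if j = 0 then w else ss ! (j - 1)) (ss ! j)"
  by (induction ss arbitrary: w j) (auto simp: nth_Cons' split: if_splits)

lemma konst_replicate: "konst a f = replicate (length f) a"
  by (induction f) auto

lemma length_times_x' [simp]: "length (times_x' d L) = length L - 1"
  by (induction d L rule: times_x'.induct) auto

lemma nth_times_x'_numeral:
  "Suc j < length L \<Longrightarrow> numeral (times_x' d L ! j)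
    = (numeral d + of_nat j) * numeral (L ! j) + (numeral d + of_nat j + 1) * (numeral (L ! Suc j) :: rat)"
proof (induction d L arbitrary: j rule: times_x'.induct)
  case (3 d a b L)
  show ?case
  proof (cases j)
    case 0
    then show ?thesis by (simp only: times_x'.simps nth_Cons_0 nth_Cons_Suc numeral_add numeral_mult numeral_One) simp
  next
    case (Suc i)
    then have "numeral (times_x' (d + num.One) (b # L) ! i) = (numeral (d + num.One) + of_nat i) * numeral ((b # L) ! i)
      + (numeral (d + num.One) + of_nat i + 1) * (numeral ((b # L) ! Suc i) :: rat)"
      using 3 by simp
    moreover have "(numeral (d + num.One) :: rat) = numeral d + 1" by (simp only: numeral_add numeral_One)
    moreover have "(of_nat (Suc i) :: rat) = of_nat i + 1" by simp
    ultimately show ?thesis unfolding Suc times_x'.simps nth_Cons_Suc by (simp only: ac_simps)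
  qed
qed auto

lemma length_times_x [simp]: "length (times_x L) = length L - 1"
  by (cases L rule: times_x.cases) auto

lemma nth_times_x_numeral:
  assumes "Suc j < length L"
  shows "numeral (times_x L ! j)
    = of_nat j * numeral (L ! j) + (of_nat j + 1) * (numeral (L ! Suc j) :: rat)"
proof -
  obtain a b L' where L: "L = a # b # L'" using assms by (cases L rule: times_x.cases) auto
  show ?thesis
  proof (cases j)
    case (Suc i)
    then have "numeral (times_x' num.One (b # L') ! i) = (numeral num.One + of_nat i) * numeral ((b # L') ! i)
      + (numeral num.One + of_nat i + 1) * (numeral ((b # L') ! Suc i) :: rat)"
      using assms L by (intro nth_times_x'_numeral) simp
    then show ?thesis unfolding L Suc by (simp add: add.commute)
  qed (simp add: L)
qed

context modulus
begin

lemma approx_opt_add_zero: "approx_opt x a \<Longrightarrow> zp p (z / pr ^ k) \<Longrightarrow> approx_opt (x + z) a"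
  unfolding approx_opt_def by (auto simp: approx_add_zero add_divide_distrib zp_add split: option.splits)

lemma approx_minus_1: assumes M: "numeral a = p ^ k - 1" shows "approx (-1) a"
proof -
  have M1: "numeral (a) = pr ^ k - 1"
    using arg_cong[OF M, of "of_int :: int \<Rightarrow> rat"]
    by (simp only: of_int_numeral of_int_diff of_int_power of_int_1)
  have "(-1 - (y - 1)) / y = -1" if "y \<noteq> 0" for y :: rat
    using that by simp
  then have "(-1 - numeral (a)) / pr ^ k = (-1 :: rat)"
    unfolding M1 by simp
  then show ?thesis
    unfolding approx_def by (simp only: zp_uminus[OF zp_1])
qed

end

text \<open>The list \<open>ON\<close> splits the first odd numbers, and the length of
\<open>gs\<close> is $e + 1$ in the notation above.\<close>

locale tail_list = modulus +
  fixes ON :: "factor list" and gs :: "num option list" and M q :: num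
  assumes M: "numeral M = p ^ k" "numeral (pred M) = p ^ k - 1"
    and ON: "\<And>i. i < length ON \<Longrightarrow> represents_factor (of_nat (2 * i + 1)) (ON ! i)"
      "\<And>i. i < length ON \<Longrightarrow> zp_unit p (of_nat (2 * i + 1) / pr ^ exponent_of (fst (ON ! i)))"
      "\<And>i. i < length ON \<Longrightarrow> exponent_of (fst (ON ! i)) < length gs"
    and gs: "gs \<noteq> []" "\<And>v. v < length gs \<Longrightarrow> approx_opt (pr ^ (2 * (length gs - 1 - v))) (gs ! v)"
begin

text \<open>The scaled sum is kept as a numerator over the product of the squares of those odd
factors whose terms do not vanish. Every multiplication divides by $R$, which the denominators
absorb.\<close>

definition "unit_part i = of_nat (2 * i + 1) / pr ^ exponent_of (fst (ON ! i))"
definition "relevant i \<longleftrightarrow> pick gs (fst (ON ! i)) \<noteq> None"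
definition "step i = (if relevant i then unit_part i ^ 2 / R ^ 2 else 1)"
definition "common_denom i = numeral q * (\<Prod>j<i. step j)"
definition "scaled_tail i = pr ^ (2 * (length gs - 1)) * (1 / numeral q - ssum i)"

abbreviation "states \<equiv> scan (tail_step h c gs) (hd gs, q, pred M, num.One, None) ON"

definition good :: "nat \<Rightarrow> tail_state \<Rightarrow> bool" where
  "good i st = (case st of (y, D, s, s', r) \<Rightarrow> approx (common_denom i) D \<and> approx_opt (scaled_tail i * common_denom i) y
     \<and> approx (- ((-1) ^ i)) s \<and> approx ((-1) ^ i) s'
     \<and> (i > 0 \<longrightarrow> (case r of None \<Rightarrow> \<not> relevant (i - 1) | Some a \<Rightarrow> relevant (i - 1) \<and> approx (unit_part (i - 1)) a)))"

lemma unit_part_app: "i < length ON \<Longrightarrow> approx (unit_part i) (snd (ON ! i))"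
  using ON(1) by (simp add: unit_part_def represents_factor_def)

lemma unit_part_unit: "i < length ON \<Longrightarrow> zp_unit p (unit_part i)"
  using ON(2) by (simp add: unit_part_def)

lemma scaled_tail_Suc:
  assumes "i < length ON"
  shows "scaled_tail (Suc i) = scaled_tail i - (-1) ^ i * pr ^ (2 * (length gs - 1 - exponent_of (fst (ON ! i)))) * (1 / unit_part i) ^ 2"
proof -
  let ?v = "exponent_of (fst (ON ! i))"
  have "2 * (length gs - 1) = 2 * ?v + 2 * (length gs - 1 - ?v)"
    using ON(3)[OF assms] by auto
  then have split: "pr ^ (2 * (length gs - 1)) = pr ^ (2 * ?v) * pr ^ (2 * (length gs - 1 - ?v))"
    by (simp only: power_add)
  have sq: "1 / x ^ 2 * y ^ (2 * v) = (1 / (x / y ^ v)) ^ 2" for x y :: rat and v :: nat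
    by (simp add: power_divide power_even_eq)
  have inv: "1 / of_nat ((2 * i + 1) ^ 2) * pr ^ (2 * ?v) = (1 / unit_part i) ^ 2"
    unfolding unit_part_def of_nat_power by (rule sq)
  have "x * (y / z) = y * b * w" if "x = a * b" "1 / z * a = w" for x y z a b w :: rat
    unfolding that(1) that(2)[symmetric] by (simp add: mult_ac)
  from this[OF split inv] have "pr ^ (2 * (length gs - 1)) * ((-1) ^ i / of_nat ((2 * i + 1) ^ 2))
    = (-1) ^ i * pr ^ (2 * (length gs - 1 - ?v)) * (1 / unit_part i) ^ 2" .
  moreover have "ssum (Suc i) = ssum i + (-1) ^ i / of_nat ((2 * i + 1) ^ 2)"
    by (simp add: ssum_def)
  ultimately show ?thesis
    unfolding scaled_tail_def by (simp add: algebra_simps)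
qed

lemma good_states: "i \<le> length ON \<Longrightarrow> good i (states ! i)"
proof (induction i)
  case 0
  have "approx_opt (pr ^ (2 * (length gs - 1))) (hd gs)"
    using gs(2)[of 0] gs(1) by (simp add: hd_conv_nth)
  then show ?case
    using approx_minus_1[OF M(2)] approx_One approx_numeral[of q] by (simp add: good_def common_denom_def scaled_tail_def ssum_def)
next
  case (Suc i)
  then have i: "i < length ON" by simp
  obtain y D s s' r where st: "states ! i = (y, D, s, s', r)" by (metis prod.exhaust)
  from Suc st have IH: "approx (common_denom i) D" "approx_opt (scaled_tail i * common_denom i) y" "approx (- ((-1) ^ i)) s" "approx ((-1) ^ i) s'"
    by (auto simp: good_def)
  obtain v a where va: "ON ! i = (v, a)" by force
  let ?e = "2 * (length gs - 1 - exponent_of v)"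
  have a: "approx (unit_part i) a" using unit_part_app[OF i] va by simp
  have v: "exponent_of v < length gs" using ON(3)[OF i] va by simp
  have u0: "unit_part i \<noteq> 0" using zp_unit_nonzero[OF unit_part_unit[OF i]] .
  have nxt: "states ! Suc i = tail_step' h c (pick gs v) a (y, D, s, s', r)"
    using i by (simp add: scan_nth_Suc st va)
  have g: "approx_opt (pr ^ ?e) (pick gs v)" using gs(2)[OF v] drop_num_pick[OF v] by simp
  show ?case
  proof (cases "pick gs v")
    case None
    then have nrel: "\<not> relevant i" by (simp add: relevant_def va)
    then have common_denom: "common_denom (Suc i) = common_denom i" by (simp add: common_denom_def step_def)
    have "scaled_tail (Suc i) * common_denom (Suc i) = scaled_tail i * common_denom i + pr ^ ?e * (- ((-1) ^ i) * (1 / unit_part i) ^ 2 * common_denom i)"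
      unfolding common_denom scaled_tail_Suc[OF i] by (simp add: va algebra_simps)
    moreover have "zp p (pr ^ ?e * (- ((-1) ^ i) * (1 / unit_part i) ^ 2 * common_denom i) / pr ^ k)"
      using g None approx_imp_zp[OF IH(1)] approx_imp_zp[OF IH(3)] zp_unit_imp_zp[OF zp_unit_inverse[OF unit_part_unit[OF i]]]
      by (intro zero_mult zp_mult zp_power) (auto simp: approx_opt_def)
    ultimately have "approx_opt (scaled_tail (Suc i) * common_denom (Suc i)) y"
      by (simp only: approx_opt_add_zero[OF IH(2)])
    then show ?thesis
      unfolding nxt None using IH nrel common_denom by (simp add: good_def)
  next
    case (Some g')
    then have relevant: "relevant i" by (simp add: relevant_def va)
    have common_denom: "common_denom (Suc i) = common_denom i * unit_part i / R * unit_part i / R"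
      using relevant by (simp add: common_denom_def step_def power2_eq_square)
    let ?t = "common_denom i * (pr ^ ?e * - ((-1) ^ i)) / R"
    have gs': "approx ?t (mmul h c D (g' * s))"
      using g Some IH by (intro approx_mmul approx_mult) (auto simp: approx_opt_def)
    have D': "approx (common_denom (Suc i)) (mmul h c (mmul h c D a) a)"
      unfolding common_denom by (intro approx_mmul IH a)
    have t1: "approx (?t * 1 / R) (mmul h c (mmul h c D (g' * s)) num.One)"
      by (intro approx_mmul gs' approx_One)
    have yeq: "scaled_tail (Suc i) * common_denom (Suc i) = ?t * 1 / R + scaled_tail i * common_denom i * unit_part i / R * unit_part i / R"
      unfolding common_denom scaled_tail_Suc[OF i] using u0 by (simp add: va field_simps power2_eq_square)
    have "approx_opt (scaled_tail (Suc i) * common_denom (Suc i)) (tail_num h c y a (mmul h c D (g' * s)))"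
    proof (cases y)
      case None
      have "zp p (scaled_tail i * common_denom i * (unit_part i / R * unit_part i / R) / pr ^ k)"
      proof (rule zero_mult)
        show "zp p (scaled_tail i * common_denom i / pr ^ k)" using IH(2) None by (simp add: approx_opt_def)
        have "zp p (unit_part i * (1 / R) * (unit_part i * (1 / R)))"
          by (intro zp_mult zp_R approx_imp_zp[OF a])
        then show "zp p (unit_part i / R * unit_part i / R)" by simp
      qed
      moreover have "z * (y / x * y / x) = z * y / x * y / x" for x y z :: rat
        by simp
      ultimately have "zp p (scaled_tail i * common_denom i * unit_part i / R * unit_part i / R / pr ^ k)"
        by (simp only:)
      then have "approx (?t * 1 / R + scaled_tail i * common_denom i * unit_part i / R * unit_part i / R) (mmul h c (mmul h c D (g' * s)) num.One)"
        by (rule approx_add_zero[OF t1])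
      then show ?thesis unfolding yeq None by (simp add: approx_opt_def)
    next
      case (Some y')
      then have "approx (scaled_tail i * common_denom i) y'" using IH(2) by (simp add: approx_opt_def)
      then have "approx (scaled_tail i * common_denom i * unit_part i / R * unit_part i / R) (mmul h c (mmul h c y' a) a)"
        by (intro approx_mmul a)
      from approx_add[OF this t1] show ?thesis
        unfolding yeq Some by (simp add: approx_opt_def add.commute)
    qed
    then show ?thesis
      unfolding nxt Some using IH relevant D' a by (simp add: good_def)
  qed
qed

abbreviation "n \<equiv> length ON"
abbreviation "back \<equiv> rev (tl states)"
abbreviation "cod \<equiv> scan (codenom h c) num.One back"

lemma back_nth: "j < n \<Longrightarrow> back ! j = states ! (n - j)"
  by (subst rev_nth) (auto simp: nth_tl Suc_diff_Suc)

lemma approx_cod: "j \<le> n \<Longrightarrow> approx (\<Prod>i\<in>{n - j..<n}. step i) (cod ! j)"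
proof (induction j)
  case 0
  show ?case using approx_One by simp
next
  case (Suc j)
  then have j: "j < n" by simp
  let ?i = "n - Suc j"
  have IH: "approx (\<Prod>i\<in>{n - j..<n}. step i) (cod ! j)" using Suc by simp
  obtain y D s s' r where st: "states ! (n - j) = (y, D, s, s', r)" by (metis prod.exhaust)
  have "good (n - j) (states ! (n - j))" by (rule good_states) simp
  then have "case r of None \<Rightarrow> \<not> relevant (n - j - 1) | Some a \<Rightarrow> relevant (n - j - 1) \<and> approx (unit_part (n - j - 1)) a"
    using j by (simp add: good_def st)
  moreover have "n - j - 1 = ?i" by simp
  ultimately have r: "case r of None \<Rightarrow> \<not> relevant ?i | Some a \<Rightarrow> relevant ?i \<and> approx (unit_part ?i) a"
    by (simp only:)
  have "{n - Suc j..<n} = insert ?i {n - j..<n}" using j by auto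
  then have pr: "(\<Prod>i\<in>{n - Suc j..<n}. step i) = (\<Prod>i\<in>{n - j..<n}. step i) * step ?i"
    by (simp only:) (subst prod.insert, use j in auto)
  have nx: "cod ! Suc j = codenom h c (cod ! j) (y, D, s, s', r)"
    using j by (simp add: scan_nth_Suc back_nth st)
  show ?case
  proof (cases r)
    case None
    with r IH show ?thesis unfolding nx pr by (simp add: step_def)
  next
    case (Some a)
    let ?x = "\<Prod>i\<in>{n - j..<n}. step i"
    have "approx (?x * unit_part ?i / R * unit_part ?i / R) (mmul h c (mmul h c (cod ! j) a) a)"
      using r Some by (intro approx_mmul IH) auto
    with r Some show ?thesis unfolding nx pr by (simp add: step_def power2_eq_square mult.assoc)
  qed
qed

lemma common_denom_cod: "j \<le> n \<Longrightarrow> common_denom (n - j) * (\<Prod>i\<in>{n - j..<n}. step i) = common_denom n"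
proof -
  assume "j \<le> n"
  then have "{..<n} = {..<n - j} \<union> {n - j..<n}" by auto
  then have "(\<Prod>i<n. step i) = (\<Prod>i<n - j. step i) * (\<Prod>i\<in>{n - j..<n}. step i)"
    by (simp add: prod.union_disjoint[symmetric] ivl_disj_int)
  then show ?thesis by (simp add: common_denom_def mult.assoc)
qed

lemma zp_common_denom: "zp p (common_denom n)"
  using good_states[of n] by (auto simp: good_def intro: approx_imp_zp)

text \<open>Completing the denominator of each state to the common one \<open>common_denom\<close> makes the
sums comparable.\<close>

lemma head_items:
  assumes F: "\<And>j. j < n \<Longrightarrow> represents (f j) (Fs ! j)" and B: "\<And>j. j < n \<Longrightarrow> represents (b j) (Bs ! j)"
    and len: "n \<le> length Fs" "n \<le> length Bs" and j: "j < n"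
  defines "x \<equiv> map (head_item h c) (zip back (zip cod (zip Fs Bs))) ! j"
  shows "zp p (f j * b j / pr ^ nat_of_num (fst x))"
    and "approx_opt (f j * b j / pr ^ nat_of_num (fst x) * (scaled_tail (n - j) * common_denom n / R ^ 3)) (snd x)"
proof -
  obtain v f' where f: "Fs ! j = (v, f')" by force
  obtain w b' where b: "Bs ! j = (w, b')" by force
  obtain y D s s' r where st: "states ! (n - j) = (y, D, s, s', r)" by (metis prod.exhaust)
  let ?C = "\<Prod>i\<in>{n - j..<n}. step i"
  have good: "approx_opt (scaled_tail (n - j) * common_denom (n - j)) y"
    using good_states[of "n - j"] by (simp add: good_def st)
  have C: "approx ?C (cod ! j)" using approx_cod[of j] j by simp
  have x: "x = head_item h c ((y, D, s, s', r), cod ! j, (v, f'), (w, b'))"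
    unfolding x_def using j len by (simp add: back_nth st f b)
  have fx: "fst x = v + w" unfolding x by (cases y) auto
  have fa: "approx (f j / pr ^ nat_of_num v) f'" and ba: "approx (b j / pr ^ nat_of_num w) b'"
    using F[OF j] B[OF j] by (auto simp: represents_def f b)
  have fb: "f j * b j / pr ^ nat_of_num (fst x) = f j / pr ^ nat_of_num v * (b j / pr ^ nat_of_num w)"
    unfolding fx by (simp add: nat_of_num_add power_add)
  show zp: "zp p (f j * b j / pr ^ nat_of_num (fst x))"
    unfolding fb by (intro zp_mult approx_imp_zp[OF fa] approx_imp_zp[OF ba])
  have eq: "f j * b j / pr ^ nat_of_num (fst x) * (scaled_tail (n - j) * common_denom n / R ^ 3)
    = scaled_tail (n - j) * common_denom (n - j) * (f j / pr ^ nat_of_num v * (b j / pr ^ nat_of_num w) * ?C * ((1 / R) * (1 / R) * (1 / R)))"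
    unfolding fb common_denom_cod[of j, symmetric, OF less_imp_le[OF j]] by (simp add: power3_eq_cube)
  show "approx_opt (f j * b j / pr ^ nat_of_num (fst x) * (scaled_tail (n - j) * common_denom n / R ^ 3)) (snd x)"
  proof (cases y)
    case None
    have "zp p (scaled_tail (n - j) * common_denom (n - j) * (f j / pr ^ nat_of_num v * (b j / pr ^ nat_of_num w) * ?C * ((1 / R) * (1 / R) * (1 / R))) / pr ^ k)"
    proof (rule zero_mult)
      show "zp p (scaled_tail (n - j) * common_denom (n - j) / pr ^ k)"
        using good None by (simp add: approx_opt_def)
    qed (intro zp_mult zp_R approx_imp_zp[OF fa] approx_imp_zp[OF ba] approx_imp_zp[OF C])
    then show ?thesis unfolding eq unfolding x None by (simp add: approx_opt_def)
  next
    case (Some y')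
    then have ya: "approx (scaled_tail (n - j) * common_denom (n - j)) y'" using good by (simp add: approx_opt_def)
    have "approx (f j / pr ^ nat_of_num v * (b j / pr ^ nat_of_num w) / R * (scaled_tail (n - j) * common_denom (n - j)) / R * ?C / R)
      (mmul h c (mmul h c (mmul h c f' b') y') (cod ! j))"
      by (intro approx_mmul fa ba ya C)
    then show ?thesis unfolding eq unfolding x Some by (simp add: approx_opt_def mult_ac)
  qed
qed

end

section \<open>Moments\<close>

context modulus begin

lemma approx_comb:
  assumes "approx x a" "approx y b" and d: "numeral d = s * numeral a + t * (numeral b :: rat)" and "zp p s" "zp p t"
  shows "approx (s * x + t * y) d"
proof -
  have "(s * x + t * y - (s * u + t * v)) / w = s * ((x - u) / w) + t * ((y - v) / w)"
    for s x t y u v w :: rat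
    by (cases "w = 0") (simp_all add: field_simps)
  then show ?thesis
    using assms unfolding approx_def d by (simp only: zp_add zp_mult)
qed

text \<open>The factor \<open>y\<close> is the power of $p$ by which the exponent of the summand
exceeds the common one.\<close>

definition item_rep :: "rat \<Rightarrow> rat \<Rightarrow> item \<Rightarrow> bool" where
  "item_rep w z q \<longleftrightarrow> zp p (w / pr ^ nat_of_num (item_val q)) \<and>
    (\<forall>y a. approx y a \<longrightarrow> approx_opt (w / pr ^ nat_of_num (item_val q) * z / R ^ 3 * y) (item_weight h c (Some a) q))"

lemma item_repI:
  assumes f: "represents f q1" and x: "zp p (x / pr ^ nat_of_num (fst q2))" "approx_opt (x / pr ^ nat_of_num (fst q2) * z) (snd q2)"
    and b: "represents b q3" and o1: "represents s q4"
  shows "item_rep (f * x * b * s) z (q1, q2, q3, q4)"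
proof -
  obtain v1 a1 v2 a2 v3 a3 v4 a4 where q: "q1 = (v1, a1)" "q2 = (v2, a2)" "q3 = (v3, a3)" "q4 = (v4, a4)"
    by (metis prod.exhaust)
  let ?f = "f / pr ^ nat_of_num v1" and ?x = "x / pr ^ nat_of_num v2" and ?b = "b / pr ^ nat_of_num v3"
    and ?s = "s / pr ^ nat_of_num v4"
  have W: "f * x * b * s / pr ^ nat_of_num (item_val (q1, q2, q3, q4)) = ?f * ?x * ?b * ?s"
    unfolding q by (simp add: nat_of_num_add power_add)
  have fa: "approx ?f a1" and ba: "approx ?b a3" and sa: "approx ?s a4" and xz: "zp p ?x" and xa: "approx_opt (?x * z) a2"
    using assms by (auto simp: represents_def q)
  have "approx_opt (?f * ?x * ?b * ?s * z / R ^ 3 * y) (item_weight h c (Some a) (q1, q2, q3, q4))" if y: "approx y a" for y a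
  proof (cases a2)
    case None
    have eq: "?f * ?x * ?b * ?s * z / R ^ 3 * y = (?x * z) * (?f * ?b * ?s * y * (1 / R) * (1 / R) * (1 / R))"
      by (simp add: power3_eq_cube mult_ac)
    have "zp p ((?x * z) * (?f * ?b * ?s * y * (1 / R) * (1 / R) * (1 / R)) / pr ^ k)"
    proof (rule zero_mult)
      show "zp p (?x * z / pr ^ k)" using xa None by (simp add: approx_opt_def)
    qed (intro zp_mult zp_R approx_imp_zp[OF fa] approx_imp_zp[OF ba] approx_imp_zp[OF sa] approx_imp_zp[OF y])
    then show ?thesis unfolding eq unfolding q None by (simp add: approx_opt_def)
  next
    case (Some a2')
    have "approx (?x * z * ?f / R * ?b / R * (?s * y) / R)
      (mmul h c (mmul h c (mmul h c a2' a1) a3) (a4 * a))"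
      using xa Some by (intro approx_mmul approx_mult fa ba sa y) (simp add: approx_opt_def)
    moreover have "?f * ?x * ?b * ?s * z / R ^ 3 * y = ?x * z * ?f / R * ?b / R * (?s * y) / R"
      by (simp add: power3_eq_cube mult_ac)
    ultimately show ?thesis unfolding q Some item_weight.simps approx_opt_Some by (simp only:)
  qed
  moreover have "zp p (?f * ?x * ?b * ?s)"
    by (intro zp_mult approx_imp_zp[OF fa] approx_imp_zp[OF ba] approx_imp_zp[OF sa] xz)
  ultimately show ?thesis
    unfolding item_rep_def W by blast
qed

lemma item_rep_excess:
  assumes q: "item_rep w z q" and e: "excess ws m (item_val q) = Some e"
    and ws: "length ws = k" "\<And>t. t < k \<Longrightarrow> numeral (ws ! t) = pr ^ t"
  shows "zp p (w / pr ^ nat_of_num m)" "approx_opt (w / pr ^ nat_of_num m * z / R ^ 3) (item_weight h c e q)"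
proof -
  let ?v = "nat_of_num (item_val q)"
  have zp: "zp p (w / pr ^ ?v)" using q by (simp add: item_rep_def)
  have shift: "w / pr ^ nat_of_num m = w / pr ^ ?v * pr ^ t" if "?v = nat_of_num m + t" for t
    unfolding that by (simp add: power_add)
  have wz: "approx_opt (w / pr ^ ?v * z / R ^ 3 * y) (item_weight h c (Some a) q)" if "approx y a" for y a
    using q that by (simp add: item_rep_def)
  obtain t where t: "?v = nat_of_num m + t"
    and c: "(e = None \<and> k \<le> t) \<or> (t < k \<and> e = Some (ws ! t))"
  proof (cases e)
    case None
    with excess_cases[OF e] ws have "nat_of_num m + k \<le> ?v" by simp
    then show ?thesis using that[of "?v - nat_of_num m"] None by simp
  next
    case (Some a)
    with excess_cases[OF e] ws that show ?thesis by auto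
  qed
  show "zp p (w / pr ^ nat_of_num m)"
    unfolding shift[OF t] by (intro zp_mult zp zp_pr)
  show "approx_opt (w / pr ^ nat_of_num m * z / R ^ 3) (item_weight h c e q)"
    using c
  proof (elim disjE conjE)
    assume none: "e = None" and kt: "k \<le> t"
    have "zp p (w / pr ^ ?v * z / R ^ 3 * 1)" using wz[OF approx_One] by (rule approx_opt_imp_zp)
    then have "zp p (w / pr ^ ?v * z / R ^ 3 * 1 * pr ^ (t - k))" by (rule zp_mult[OF _ zp_pr])
    moreover have "pr ^ t = pr ^ (t - k) * pr ^ k" using kt by (simp flip: power_add)
    then have "w / pr ^ ?v * pr ^ t * z / R ^ 3 / pr ^ k = w / pr ^ ?v * z / R ^ 3 * 1 * pr ^ (t - k)"
      by simp
    ultimately show ?thesis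
      unfolding shift[OF t] none item_weight.simps by (simp only: approx_opt_def option.case)
  next
    assume "t < k" and some: "e = Some (ws ! t)"
    with approx_numeral[of "ws ! t"] ws(2) have "approx (pr ^ t) (ws ! t)" by simp
    from wz[OF this] show ?thesis
      unfolding shift[OF t] some by (simp add: mult_ac)
  qed
qed

text \<open>The empty list signals failure: it is never extended again, whereas a successful run
keeps the length of the list. The integrality of the scaled weights is recorded because it is what
bounds the entries of $T$.\<close>

definition partial_ok :: "(nat \<Rightarrow> rat) \<Rightarrow> (nat \<Rightarrow> rat) \<Rightarrow> nat \<Rightarrow> nat \<Rightarrow> nat \<Rightarrow> num option list \<Rightarrow> bool" where
  "partial_ok w z m L i ss \<longleftrightarrow> ss = [] \<or> (length ss = L \<and> (\<forall>j<i. zp p (w j / pr ^ m)) \<and>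
    (\<forall>j<L. approx_opt (\<Sum>l<i. w l / pr ^ m * z l / R ^ 3 * of_nat ((i - 1 - l) choose j)) (ss ! j)))"

lemma sum_choose_Suc:
  fixes x :: "nat \<Rightarrow> rat"
  shows "(\<Sum>l<Suc i. x l * of_nat ((Suc i - 1 - l) choose 0)) = x i + (\<Sum>l<i. x l * of_nat ((i - 1 - l) choose 0))"
    "(\<Sum>l<Suc i. x l * of_nat ((Suc i - 1 - l) choose Suc j)) =
      (\<Sum>l<i. x l * of_nat ((i - 1 - l) choose j)) + (\<Sum>l<i. x l * of_nat ((i - 1 - l) choose Suc j))"
proof -
  have "x l * of_nat ((i - l) choose Suc j) = x l * of_nat ((i - 1 - l) choose j) + x l * of_nat ((i - 1 - l) choose Suc j)"
    if "l < i" for l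
  proof -
    from that have "i - l = Suc (i - 1 - l)" by simp
    then have "(i - l) choose Suc j = ((i - 1 - l) choose j) + ((i - 1 - l) choose Suc j)"
      by (simp only: binomial_Suc_Suc)
    then show ?thesis by (simp add: algebra_simps)
  qed
  then show "(\<Sum>l<Suc i. x l * of_nat ((Suc i - 1 - l) choose Suc j)) =
      (\<Sum>l<i. x l * of_nat ((i - 1 - l) choose j)) + (\<Sum>l<i. x l * of_nat ((i - 1 - l) choose Suc j))"
    by (simp flip: sum.distrib)
qed simp

lemma partial_ok_accumulate:
  assumes q: "item_rep (w i) (z i) q" and ss: "partial_ok w z (nat_of_num m) L i ss"
    and ws: "length ws = k" "\<And>t. t < k \<Longrightarrow> numeral (ws ! t) = pr ^ t"
  shows "partial_ok w z (nat_of_num m) L (Suc i) (accumulate h c (excess ws m (item_val q)) q ss)"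
proof (cases "excess ws m (item_val q)")
  case None
  then show ?thesis by (simp add: partial_ok_def)
next
  case (Some e)
  note item = item_rep_excess[OF q Some ws]
  let ?x = "\<lambda>l. w l / pr ^ nat_of_num m * z l / R ^ 3"
  show ?thesis
  proof (cases "ss = []")
    case True
    then show ?thesis unfolding Some by (simp add: partial_ok_def)
  next
    case False
    with ss have len: "length ss = L" and zp: "\<And>j. j < i \<Longrightarrow> zp p (w j / pr ^ nat_of_num m)"
      and sums: "\<And>j. j < L \<Longrightarrow> approx_opt (\<Sum>l<i. ?x l * of_nat ((i - 1 - l) choose j)) (ss ! j)"
      by (auto simp: partial_ok_def)
    have "approx_opt (\<Sum>l<Suc i. ?x l * of_nat ((Suc i - 1 - l) choose j)) (push ss (item_weight h c e q) ! j)"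
      if j: "j < L" for j
    proof (cases j)
      case 0
      then show ?thesis unfolding 0 sum_choose_Suc(1)
        using j len approx_opt_oadd[OF item(2) sums[of 0]] by (simp add: nth_push)
    next
      case (Suc j')
      then show ?thesis unfolding Suc sum_choose_Suc(2)
        using j[unfolded Suc] len approx_opt_oadd[OF sums[of j'] sums[of "Suc j'"]] by (simp add: nth_push)
    qed
    moreover have "zp p (w j / pr ^ nat_of_num m)" if "j < Suc i" for j
      using that zp item(1) less_antisym by blast
    ultimately show ?thesis
      unfolding Some accumulate.simps partial_ok_def using len by simp
  qed
qed

lemma moments_sound:
  assumes "\<And>i. i < length fs \<Longrightarrow> item_rep (w (i0 + i)) (z (i0 + i)) (fs ! i, xs ! i, bs ! i, os ! i)"
    and "length fs \<le> length xs" "length fs \<le> length bs" "length fs \<le> length os"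
    and "partial_ok w z (nat_of_num m) L i0 ss"
    and ws: "length ws = k" "\<And>t. t < k \<Longrightarrow> numeral (ws ! t) = pr ^ t"
  shows "partial_ok w z (nat_of_num m) L (i0 + length fs) (moments h c ws m fs xs bs os ss)"
  using assms(1-5)
proof (induction fs arbitrary: i0 xs bs os ss)
  case (Cons f fs)
  obtain x xs' b bs' s os' where e: "xs = x # xs'" "bs = b # bs'" "os = s # os'"
    using Cons.prems(2-4) by (cases xs; cases bs; cases os) auto
  have "partial_ok w z (nat_of_num m) L (Suc i0)
      (accumulate h c (excess ws m (item_val (f, x, b, s))) (f, x, b, s) ss)"
    using Cons.prems(1)[of 0] by (intro partial_ok_accumulate Cons.prems ws) (simp_all add: e)
  then have "partial_ok w z (nat_of_num m) L (Suc i0 + length fs) (moments h c ws m fs xs' bs' os'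
      (accumulate h c (excess ws m (item_val (f, x, b, s))) (f, x, b, s) ss))"
    using Cons.prems(1)[of "Suc _"] Cons.prems(2-4) by (intro Cons.IH) (auto simp: e)
  then show ?case unfolding e moments_Cons by simp
qed simp

lemma partial_ok_init: "partial_ok w z m (length f) 0 (konst None f)"
  by (auto simp: partial_ok_def konst_replicate approx_opt_def zp_0)

lemma approx_unopt: "numeral M = p ^ k \<Longrightarrow> approx_opt x a \<Longrightarrow> approx x (unopt M a)"
  using approx_modulus by (cases a) (auto simp: approx_opt_def)

lemma mult_choose_eq: "of_nat n * of_nat (n choose j) = of_nat j * of_nat (n choose j) + (of_nat j + 1) * (of_nat (n choose Suc j) :: rat)"
proof (cases "j \<le> n")
  case True
  have "Suc j * (n choose Suc j) = (n - j) * (n choose j)"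
    by (simp only: binomial_absorption binomial_absorb_comp)
  then have "(of_nat (Suc j) :: rat) * of_nat (n choose Suc j) = of_nat (n - j) * of_nat (n choose j)"
    by (metis of_nat_mult)
  then show ?thesis using True by (simp add: of_nat_diff algebra_simps)
qed (simp add: binomial_eq_0)

text \<open>Column $l$ is obtained from the binomial moments by $l$ multiplications with $x = n -
i$.\<close>

lemma columns_sound:
  fixes y :: "nat \<Rightarrow> rat" and n :: nat
  defines "g l j \<equiv> (\<Sum>i\<le>n. y i * of_nat (n - i) ^ l * of_nat ((n - i) choose j))"
  assumes "length mu = L - l0" "\<And>j. j + l0 < L \<Longrightarrow> approx (g l0 j) (mu ! j)"
    and "l < length f" "r < length ds" "ds ! r + l0 + l < L"
  shows "approx (g (l0 + l) (ds ! r) / 2 ^ clen d) (columns h d (map onum ds) f mu ! l ! r)"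
  using assms(2-)
proof (induction f arbitrary: mu l0 l)
  case (Cons a f)
  show ?case
  proof (cases l)
    case 0
    have "approx (g l0 (ds ! r)) (pick mu (onum (ds ! r)))"
    proof -
      have "exponent_of (onum (ds ! r)) = ds ! r"
        by (cases "ds ! r = 0") (auto simp: onum.simps num_of_nat_inverse)
      then have "pick mu (onum (ds ! r)) = mu ! (ds ! r)"
        using drop_num_pick[of "onum (ds ! r)" mu] Cons.prems 0 by simp
      then show ?thesis using Cons.prems 0 by simp
    qed
    then show ?thesis using Cons.prems 0 by (simp add: approx_redc)
  next
    case (Suc l')
    have "approx (g (Suc l0) j) (times_x mu ! j)" if j: "j + Suc l0 < L" for j
    proof -
      have "g (Suc l0) j = of_nat j * g l0 j + (of_nat j + 1) * g l0 (Suc j)"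
      proof -
        have e: "y i * of_nat (n - i) ^ Suc l0 * of_nat ((n - i) choose j)
          = of_nat j * (y i * of_nat (n - i) ^ l0 * of_nat ((n - i) choose j))
            + (of_nat j + 1) * (y i * of_nat (n - i) ^ l0 * of_nat ((n - i) choose Suc j))" for i
        proof -
          have "y i * of_nat (n - i) ^ Suc l0 * of_nat ((n - i) choose j)
            = y i * of_nat (n - i) ^ l0 * (of_nat (n - i) * of_nat ((n - i) choose j))"
            by (simp add: mult_ac)
          also have "\<dots> = y i * of_nat (n - i) ^ l0 * (of_nat j * of_nat ((n - i) choose j)
              + (of_nat j + 1) * of_nat ((n - i) choose Suc j))"
            by (simp only: mult_choose_eq)
          finally show ?thesis by (simp only: distrib_left distrib_right mult_ac mult_1_left mult_1_right)
        qed
        show ?thesis unfolding g_def e by (simp only: sum.distrib sum_distrib_left)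
      qed
      moreover have "approx (of_nat j * g l0 j + (of_nat j + 1) * g l0 (Suc j)) (times_x mu ! j)"
      proof (rule approx_comb)
        show "numeral (times_x mu ! j) = of_nat j * numeral (mu ! j) + (of_nat j + 1) * (numeral (mu ! Suc j) :: rat)"
          using Cons.prems(1) j by (intro nth_times_x_numeral) simp
        show "zp p (of_nat j + 1)" using zp_add[OF zp_of_nat zp_1] .
      qed (use Cons.prems(2) j in \<open>auto intro: zp_of_nat\<close>)
      ultimately show ?thesis by simp
    qed
    then have "approx (g (Suc l0 + l') (ds ! r) / 2 ^ clen d) (columns h d (map onum ds) f (times_x mu) ! l' ! r)"
      using Cons.prems Suc by (intro Cons.IH) auto
    then show ?thesis using Suc by simp
  qed
qed simp

end

lemma length_columns: "length (columns h d ds f mu) = length f"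
  by (induction f arbitrary: mu) auto

lemma length_columns_nth: "l < length f \<Longrightarrow> length (columns h d ds f mu ! l) = length ds"
proof (induction f arbitrary: mu l)
  case (Cons a f)
  then show ?case by (cases l) auto
qed simp

section \<open>Determinants and inverse matrices modulo prime powers\<close>

lemma (in prime_int) zp_unit_power: "zp_unit p x \<Longrightarrow> zp_unit p (x ^ n)"
proof (induction n)
  case 0
  have "\<not> p dvd 1" using prime not_prime_unit by blast
  from zp_unit_of_int[OF this] show ?case by simp
qed (simp add: zp_unit_mult)

text \<open>The condensation identity of Chio: multiply from the left by the block matrix that
clears the first column.\<close>

lemma det_pivot:
  fixes A :: "nat \<Rightarrow> nat \<Rightarrow> 'a :: field"
  assumes s: "s \<noteq> 0"
  shows "(A 0 0 / s) ^ m * det (mat (Suc m) (Suc m) (\<lambda>(i, j). A i j))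
    = A 0 0 * det (mat m m (\<lambda>(i, j). (A 0 0 * A (Suc i) (Suc j) - A (Suc i) 0 * A 0 (Suc j)) / s))"
proof -
  let ?A = "mat (Suc m) (Suc m) (\<lambda>(i, j). A i j)"
  let ?A' = "mat m m (\<lambda>(i, j). (A 0 0 * A (Suc i) (Suc j) - A (Suc i) 0 * A 0 (Suc j)) / s)"
  let ?A1 = "mat 1 1 (\<lambda>_. A 0 0)" and ?A2 = "mat 1 m (\<lambda>(i, j). A 0 (Suc j))"
    and ?A3 = "mat m 1 (\<lambda>(i, j). A (Suc i) 0)" and ?A4 = "mat m m (\<lambda>(i, j). A (Suc i) (Suc j))"
  let ?L3 = "mat m 1 (\<lambda>(i, j). - (A (Suc i) 0 / s))" and ?L4 = "(A 0 0 / s) \<cdot>\<^sub>m 1\<^sub>m m"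
  let ?L = "four_block_mat (1\<^sub>m 1) (0\<^sub>m 1 m) ?L3 ?L4"
  have A: "?A = four_block_mat ?A1 ?A2 ?A3 ?A4"
  proof (rule eq_matI)
    fix i j assume ij: "i < dim_row (four_block_mat ?A1 ?A2 ?A3 ?A4)" "j < dim_col (four_block_mat ?A1 ?A2 ?A3 ?A4)"
    then show "?A $$ (i, j) = four_block_mat ?A1 ?A2 ?A3 ?A4 $$ (i, j)"
      by (cases i; cases j) auto
  qed auto
  have z: "?L3 * ?A1 + ?L4 * ?A3 = 0\<^sub>m m 1"
  proof (rule eq_matI)
    fix i j assume "i < dim_row (0\<^sub>m m 1 :: 'a mat)" "j < dim_col (0\<^sub>m m 1 :: 'a mat)"
    then have ij: "i < m" "j = 0" by auto
    have "(?L4 * ?A3) $$ (i, j) = (A 0 0 / s) * A (Suc i) 0"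
      using ij by simp
    moreover have "(?L3 * ?A1) $$ (i, j) = - (A (Suc i) 0 / s) * A 0 0"
      using ij by (simp add: scalar_prod_def)
    ultimately show "(?L3 * ?A1 + ?L4 * ?A3) $$ (i, j) = 0\<^sub>m m 1 $$ (i, j)"
      using ij by simp
  qed auto
  have f: "?L3 * ?A2 + ?L4 * ?A4 = ?A'"
  proof (rule eq_matI)
    fix i j assume "i < dim_row ?A'" "j < dim_col ?A'"
    then have ij: "i < m" "j < m" by auto
    have "(?L4 * ?A4) $$ (i, j) = (A 0 0 / s) * A (Suc i) (Suc j)"
      using ij by simp
    moreover have "(?L3 * ?A2) $$ (i, j) = - (A (Suc i) 0 / s) * A 0 (Suc j)"
      using ij by (simp add: scalar_prod_def)
    ultimately show "(?L3 * ?A2 + ?L4 * ?A4) $$ (i, j) = ?A' $$ (i, j)"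
      using ij s by (simp add: field_simps)
  qed auto
  have t: "1\<^sub>m 1 * ?A1 + 0\<^sub>m 1 m * ?A3 = ?A1" "1\<^sub>m 1 * ?A2 + 0\<^sub>m 1 m * ?A4 = ?A2"
    by (auto intro!: eq_matI simp: scalar_prod_def)
  have "?L * ?A = four_block_mat (1\<^sub>m 1 * ?A1 + 0\<^sub>m 1 m * ?A3) (1\<^sub>m 1 * ?A2 + 0\<^sub>m 1 m * ?A4)
      (?L3 * ?A1 + ?L4 * ?A3) (?L3 * ?A2 + ?L4 * ?A4)"
    unfolding A by (rule mult_four_block_mat[of _ 1 1 _ m _ m _ _ 1 _ m]) auto
  then have "?L * ?A = four_block_mat ?A1 ?A2 (0\<^sub>m m 1) ?A'"
    unfolding z f t .
  then have "det (?L * ?A) = det ?A1 * det ?A'"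
    by (simp add: det_four_block_mat_lower_left_zero[of _ 1 _ m])
  also have "det ?A1 = A 0 0" by (subst det_single) auto
  also have "det (?L * ?A) = det ?L * det ?A"
    by (rule det_mult[of _ "Suc m"]) (use four_block_carrier_mat[of "1\<^sub>m 1" 1 1 ?L4 m m] in auto)
  also have "det ?L = (A 0 0 / s) ^ m"
    by (subst det_four_block_mat_upper_right_zero[of _ 1 _ m]) auto
  finally show ?thesis .
qed

context modulus begin

lemma approx_imp_mod_p: assumes "approx x a" shows "zp p ((x - of_int (numeral a)) / pr)"
proof -
  have "pr ^ k = pr ^ (k - 1) * pr" using k by (metis power_minus_mult less_eq_Suc_le One_nat_def)
  then have "(x - of_int (numeral a)) / pr = (x - numeral a) / pr ^ k * pr ^ (k - 1)"
    by simp
  moreover have "zp p ((x - numeral a) / pr ^ k * pr ^ (k - 1))"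
    using assms unfolding approx_def by (intro zp_mult zp_pr)
  ultimately show ?thesis by (simp only:)
qed

lemma zp_unit_R2: "zp_unit p (R ^ 2)" "zp_unit p R"
proof -
  show "zp_unit p R"
    using zp_unit_inverse[OF unit_R[of "clen c"]] by (simp add: R_def)
  then show "zp_unit p (R ^ 2)" by (rule zp_unit_power)
qed

lemma nonsingular_sound:
  assumes "nonsingular h c M1 P f rs" "length f = n" "length rs = n" "\<And>i. i < n \<Longrightarrow> length (rs ! i) = n"
    "\<And>i j. i < n \<Longrightarrow> j < n \<Longrightarrow> approx (A i j) (rs ! i ! j)" and M1: "approx (-1) M1"
  shows "zp_unit p (det (mat n n (\<lambda>(i, j). A i j)))"
  using assms(1-5)
proof (induction f arbitrary: n rs A)
  case Nil
  have "\<not> p dvd 1" using prime not_prime_unit by blast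
  from zp_unit_of_int[OF this] show ?case using Nil by simp
next
  case (Cons f0 f)
  define m where "m = length f"
  have n: "n = Suc m" using Cons.prems(2) by (simp add: m_def)
  obtain r0 rs' where rs: "rs = r0 # rs'" using Cons.prems(3) n by (cases rs) auto
  obtain a r where r0: "r0 = a # r" using Cons.prems(4)[of 0] n rs by (cases r0) auto
  let ?a = "mmul h c a num.One"
  let ?s = "map (eliminate h c M1 ?a r) rs'"
  let ?A = "\<lambda>i j. (A 0 0 * A (Suc i) (Suc j) - A (Suc i) 0 * A 0 (Suc j)) / R ^ 2"
  have lt: "redc h c a < P" and ns: "nonsingular h c M1 P f ?s"
    using Cons.prems(1) by (auto simp: rs r0)
  have a: "approx (A 0 0) a" using Cons.prems(5)[of 0 0] n by (simp add: rs r0)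
  have "zp_unit p (A 0 0 / R)"
  proof (rule zp_unit_cong)
    show "zp p ((A 0 0 / R - of_int (numeral (redc h c a))) / of_int p)"
      using approx_imp_mod_p[OF approx_redc[OF a, of c]] by (simp add: R_def)
    have "numeral (redc h c a) < p" using lt p by simp
    then show "\<not> p dvd numeral (redc h c a)"
      using zdvd_not_zless[of "numeral (redc h c a)" p] by simp
  qed
  from zp_unit_mult[OF this zp_unit_R2(2)] have uA: "zp_unit p (A 0 0)" by simp
  have "zp_unit p (det (mat m m (\<lambda>(i, j). ?A i j)))"
  proof (rule Cons.IH[OF ns])
    show "length f = m" by (simp add: m_def)
    show "length ?s = m" using Cons.prems(3) n by (simp add: rs)
    have row: "\<exists>b bs. rs' ! i = b # bs \<and> length bs = m" if "i < m" for i
      using Cons.prems(4)[of "Suc i"] that n by (cases "rs' ! i") (auto simp: rs)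
    have lr: "length r = m" using Cons.prems(4)[of 0] n by (simp add: rs r0)
    have len: "length rs' = m" using Cons.prems(3) n by (simp add: rs)
    show "length (?s ! i) = m" if i: "i < m" for i
      using row[OF i] i len lr by auto
    show "approx (?A i j) (?s ! i ! j)" if ij: "i < m" "j < m" for i j
    proof -
      obtain b bs where b: "rs' ! i = b # bs" "length bs = m" using row[OF ij(1)] by blast
      have e: "?s ! i ! j = mmul h c ?a (bs ! j) + mmul h c (mmul h c M1 b) (r ! j)"
        using ij len lr b by simp
      have "approx (A (Suc i) 0) b" "approx (A (Suc i) (Suc j)) (bs ! j)" "approx (A 0 (Suc j)) (r ! j)"
        using Cons.prems(5)[of "Suc i" 0] Cons.prems(5)[of "Suc i" "Suc j"] Cons.prems(5)[of 0 "Suc j"] ij n b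
        by (simp_all add: rs r0)
      then have "approx (A 0 0 * 1 / R * A (Suc i) (Suc j) / R + (-1) * A (Suc i) 0 / R * A 0 (Suc j) / R) (?s ! i ! j)"
        unfolding e by (intro approx_add approx_mmul a approx_One M1)
      moreover have "x * 1 / t * y / t + (-1) * z / t * w / t = (x * y - z * w) / t ^ 2" for x y z w t :: rat
        by (simp add: power2_eq_square diff_divide_distrib)
      ultimately show ?thesis by (simp only:)
    qed
  qed
  then have "zp_unit p (1 / (A 0 0 / R ^ 2) ^ m * (A 0 0 * det (mat m m (\<lambda>(i, j). ?A i j))))"
    using uA zp_unit_R2(1)
    by (intro zp_unit_mult zp_unit_inverse zp_unit_power)
       (use zp_unit_mult[OF uA zp_unit_inverse[OF zp_unit_R2(1)]] in auto)
  moreover have "A 0 0 / R ^ 2 \<noteq> 0" using zp_unit_nonzero[OF uA] by simp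
  then have "1 / (A 0 0 / R ^ 2) ^ m * ((A 0 0 / R ^ 2) ^ m * det (mat (Suc m) (Suc m) (\<lambda>(i, j). A i j)))
      = det (mat (Suc m) (Suc m) (\<lambda>(i, j). A i j))" by simp
  ultimately show ?case
    unfolding n using det_pivot[of "R ^ 2" A m] by simp
qed

lemma approx_dot:
  assumes "xs \<noteq> []" "\<And>i. i < length xs \<Longrightarrow> approx (x i) (snd (xs ! i))"
  shows "approx (\<Sum>i<length xs. numeral (fst (xs ! i)) * x i) (dot xs)"
  using assms
proof (induction xs arbitrary: x rule: dot.induct)
  case (2 a b)
  then show ?case using approx_mult[OF approx_numeral, of "x 0" b a] by simp
next
  case (3 a b q L)
  have "approx (\<Sum>i<length (q # L). numeral (fst ((q # L) ! i)) * x (Suc i)) (dot (q # L))"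
    using 3(3)[of "Suc _"] by (intro "3.IH") auto
  moreover have "approx (numeral a * x 0) (a * b)"
    using 3(3)[of 0] by (intro approx_mult approx_numeral) auto
  ultimately have "approx (numeral a * x 0 + (\<Sum>i<length (q # L). numeral (fst ((q # L) ! i)) * x (Suc i))) (dot ((a, b) # q # L))"
    unfolding dot.simps by (intro approx_add)
  then show ?case
    by (simp add: sum.lessThan_Suc_shift del: sum.lessThan_Suc dot.simps)
qed simp

end

lemma row_ok_nth: "row_ok h c z L \<Longrightarrow> l < length L \<Longrightarrow> redc h c (redc h c (dot (zip z (fst (L ! l))))) = snd (L ! l)"
proof (induction h c z L arbitrary: l rule: row_ok.induct)
  case (2 h c z y t L)
  then show ?case by (cases l) auto
qed simp

lemma rows_ok_nth: "rows_ok h c M cs ts zs \<Longrightarrow> r < length zs \<Longrightarrow> row_ok h c (zs ! r) (zip cs (replicate r M @ ts))"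
proof (induction zs arbitrary: ts r)
  case (Cons z zs)
  show ?case
  proof (cases r)
    case (Suc r')
    then have "row_ok h c (zs ! r') (zip cs (replicate r' M @ M # ts))"
      using Cons by auto
    then show ?thesis unfolding Suc by (simp add: replicate_app_Cons_same)
  qed (use Cons.prems in auto)
qed simp

lemma same_len_iff: "same_len xs ys \<longleftrightarrow> length xs = length ys"
  by (induction xs ys rule: same_len.induct) auto

context modulus begin

lemma rows_ok_sound:
  assumes rows: "rows_ok h c M cs (t # konst M f) zs" and S: "length f = S" "length zs = S" "length cs = S" "S > 0"
    and zs: "\<And>i. i < S \<Longrightarrow> length (zs ! i) = S" and cs: "\<And>i. i < S \<Longrightarrow> length (cs ! i) = S"
    and X: "\<And>i l. i < S \<Longrightarrow> l < S \<Longrightarrow> approx (X i l) (cs ! l ! i)" and rl: "r < S" "l < S"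
  shows "approx ((\<Sum>i<S. numeral (zs ! r ! i) * X i l) / R ^ 2) (if r = l then t else M)"
proof -
  have "(replicate r M @ t # konst M f) ! l = (if r = l then t else M)"
    using rl S by (auto simp: nth_append konst_replicate nth_Cons')
  moreover have "row_ok h c (zs ! r) (zip cs (replicate r M @ t # konst M f))"
    using rows_ok_nth[OF rows] rl S by simp
  ultimately have e: "redc h c (redc h c (dot (zip (zs ! r) (cs ! l)))) = (if r = l then t else M)"
    using rl S row_ok_nth[of h c "zs ! r" "zip cs (replicate r M @ t # konst M f)" l]
    by (simp add: konst_replicate)
  have "approx (\<Sum>i<length (zip (zs ! r) (cs ! l)). numeral (fst (zip (zs ! r) (cs ! l) ! i)) * X i l) (dot (zip (zs ! r) (cs ! l)))"
  proof (rule approx_dot)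
    have "length (zip (zs ! r) (cs ! l)) = S" using zs cs rl by simp
    then show "zip (zs ! r) (cs ! l) \<noteq> []" using S by auto
  qed (use zs cs rl X in auto)
  then have "approx (\<Sum>i<S. numeral (zs ! r ! i) * X i l) (dot (zip (zs ! r) (cs ! l)))"
    using zs cs rl by simp
  from approx_redc[OF approx_redc[OF this, of c], of c] e show ?thesis
    by (simp add: R_def power2_eq_square)
qed

lemma zp_shift: "d \<le> e \<Longrightarrow> zp p (x / pr ^ e) \<Longrightarrow> zp p (x / pr ^ d)"
proof -
  assume de: "d \<le> e" and x: "zp p (x / pr ^ e)"
  have "pr ^ e = pr ^ (e - d) * pr ^ d" using de by (simp flip: power_add)
  then have "x / pr ^ d = x / pr ^ e * pr ^ (e - d)" by simp
  then show ?thesis using x by (simp only: zp_mult zp_pr)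
qed

text \<open>The hypotheses of \<open>coeff_det_affine\<close> on $X$, for all matrices $T$ that are
divisible by $p^e$.\<close>

definition good_lattice :: "nat \<Rightarrow> nat \<Rightarrow> rat mat \<Rightarrow> bool" where
  "good_lattice S e X \<longleftrightarrow> (\<exists>Z c'. Z \<in> carrier_mat S S \<and>
    (\<forall>T\<in>carrier_mat S S. (\<forall>i<S. \<forall>j<S. zp p (T $$ (i, j) / pr ^ e)) \<longrightarrow> (\<forall>i<S. \<forall>j<S. zp p (c' * (Z * T) $$ (i, j)))) \<and>
    (\<forall>i<S. \<forall>j<S. zp p (c' * (Z * X) $$ (i, j))) \<and> zp_unit p (det (c' \<cdot>\<^sub>m (Z * X))))"

text \<open>Without a certificate $Z$ is the identity. With one, $ZX \equiv p^d$ modulo $p^k$ and $d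
< k$, so $p^{-d}ZX$ is congruent to the identity modulo $p$, and $p^{-d}ZT$ is integral because $d
\le 2e$.\<close>

lemma mat_ok_sound:
  assumes ok: "mat_ok P K E h c M f cert cs" and K: "k = nat_of_num K" and M: "numeral M = p ^ k" "approx (-1) (pred M)"
    and S: "length f = S" "length cs = S" "S > 0" and cs: "\<And>i. i < S \<Longrightarrow> length (cs ! i) = S"
    and X: "\<And>i l. i < S \<Longrightarrow> l < S \<Longrightarrow> approx (X i l) (cs ! l ! i)"
  shows "good_lattice S (2 * (nat_of_num E - 1)) (mat S S (\<lambda>(i, j). X i j))"
proof (cases cert)
  case None
  let ?X = "mat S S (\<lambda>(i, j). X i j)"
  have "zp_unit p (det (mat S S (\<lambda>(i, j). X j i)))"
    by (rule nonsingular_sound[of "pred M" f cs]) (use ok None S cs X M in auto)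
  moreover have "mat S S (\<lambda>(i, j). X j i) = transpose_mat ?X" by (rule eq_matI) auto
  ultimately have u: "zp_unit p (det ?X)" using det_transpose[of ?X S] by simp
  have "1 \<cdot>\<^sub>m (1\<^sub>m S * ?X) = ?X" by (rule eq_matI) auto
  moreover have "zp p (1 * (1\<^sub>m S * T) $$ (i, j))" if "T \<in> carrier_mat S S"
    "zp p (T $$ (i, j) / pr ^ (2 * (nat_of_num E - 1)))" for T i j
    using zp_shift[OF le0 that(2)] that(1) by (simp del: index_mult_mat(1))
  moreover have "zp p (1 * (1\<^sub>m S * ?X) $$ (i, j))" if "i < S" "j < S" for i j
    using approx_imp_zp[OF X[OF that]] that by (simp del: index_mult_mat(1) add: left_mult_one_mat[of _ S S])
  ultimately show ?thesis
    unfolding good_lattice_def using u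
    by (intro exI[of _ "1\<^sub>m S"] exI[of _ 1] conjI ballI allI impI) (auto simp del: index_mult_mat(1) mult_1)
next
  case (Some t)
  obtain D P' Z where t: "t = (D, P', Z)" by (metis prod.exhaust)
  let ?X = "mat S S (\<lambda>(i, j). X i j)"
  let ?zs = "map (map num_of_nat) Z"
  let ?Z = "mat S S (\<lambda>(i, j). numeral (?zs ! i ! j)) :: rat mat"
  define d where "d = nat_of_num (num_of_nat D) - 1"
  have pos: "nat_of_num (num_of_nat D) > 0" by (rule nat_of_num_pos)
  have conds: "num_of_nat D \<le> K" "num_of_nat D + num.One \<le> num.Bit0 E" "num_of_nat P' * P = ppow P (num_of_nat D)"
    "length Z = S" "\<forall>z\<in>set Z. length z = S" "rows_ok h c M cs (num_of_nat P' # konst M f) ?zs"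
    using ok S by (auto simp: Some t same_len_iff list_all_iff)
  have dk: "d < k" using conds(1) pos by (simp add: K d_def less_eq_num_def)
  have de: "d \<le> 2 * (nat_of_num E - 1)"
    using conds(2) pos by (simp add: d_def less_eq_num_def nat_of_num_add)
  have "numeral (num_of_nat P') * p = p ^ nat_of_num (num_of_nat D)"
    using arg_cong[OF conds(3), of "numeral :: num \<Rightarrow> int"] unfolding numeral_ppow by (simp only: numeral_mult p)
  moreover have "p ^ nat_of_num (num_of_nat D) = p ^ d * p"
    unfolding d_def by (rule power_minus_mult[OF pos, symmetric])
  ultimately have P': "numeral (num_of_nat P') = p ^ d" by simp
  have P'q: "numeral (num_of_nat P') = pr ^ d"
    using arg_cong[OF P', of "of_int :: int \<Rightarrow> rat"] by (simp only: of_int_numeral of_int_power)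
  have Mq: "numeral M = pr ^ k"
    using arg_cong[OF M(1), of "of_int :: int \<Rightarrow> rat"] by (simp only: of_int_numeral of_int_power)
  define c' where "c' = 1 / (R ^ 2 * pr ^ d)"
  have mul: "(?Z * T) $$ (r, l) = (\<Sum>i<S. numeral (?zs ! r ! i) * T $$ (i, l))" if "T \<in> carrier_mat S S" "r < S" "l < S" for T r l
    using that by (simp add: scalar_prod_def lessThan_atLeast0)
  have cong: "zp p ((c' * (?Z * ?X) $$ (r, l) - (if r = l then 1 else 0)) / pr)" if rl: "r < S" "l < S" for r l
  proof -
    let ?x = "(\<Sum>i<S. numeral (?zs ! r ! i) * X i l) / R ^ 2"
    have "approx ?x (if r = l then num_of_nat P' else M)"
      by (rule rows_ok_sound[OF conds(6)]) (use S conds cs X rl in auto)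
    then have "zp p ((?x - (if r = l then pr ^ d else pr ^ k)) / pr ^ k)"
      unfolding approx_def by (auto simp: P'q Mq split: if_splits)
    then have "zp p ((?x - (if r = l then pr ^ d else pr ^ k)) / pr ^ Suc d)"
      using dk by (intro zp_shift[of "Suc d" k]) auto
    moreover have "(?x - (if r = l then pr ^ d else pr ^ k)) / pr ^ Suc d
      = (c' * (?Z * ?X) $$ (r, l) - (if r = l then 1 else 0)) / pr - (if r = l then 0 else pr ^ (k - Suc d))"
    proof -
      have "pr ^ k = pr ^ (k - Suc d) * pr ^ Suc d" using dk by (simp flip: power_add del: power_Suc)
      moreover have "(?Z * ?X) $$ (r, l) = (\<Sum>i<S. numeral (?zs ! r ! i) * X i l)"
        using rl by (subst mul) auto
      moreover have "pr \<noteq> 0" "pr ^ d \<noteq> 0" by simp_all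
      ultimately show ?thesis unfolding c'_def by (auto simp: field_simps)
    qed
    ultimately have "zp p ((c' * (?Z * ?X) $$ (r, l) - (if r = l then 1 else 0)) / pr - (if r = l then 0 else pr ^ (k - Suc d)))"
      by (simp only:)
    moreover have "zp p (if r = l then 0 else pr ^ (k - Suc d))" using zp_0 zp_pr by simp
    ultimately show ?thesis using zp_add by fastforce
  qed
  have ZX: "zp p (c' * (?Z * ?X) $$ (r, l))" if rl: "r < S" "l < S" for r l
  proof -
    let ?d = "if r = l then 1 else 0 :: rat"
    have "zp p ((c' * (?Z * ?X) $$ (r, l) - ?d) / pr * of_int p + ?d)"
      using zp_0 zp_1 by (intro zp_add zp_mult zp_of_int cong[OF rl]) auto
    then show ?thesis by simp
  qed
  have u: "zp_unit p (det (c' \<cdot>\<^sub>m (?Z * ?X)))"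
  proof -
    have "zp p ((det (c' \<cdot>\<^sub>m (?Z * ?X)) - det (1\<^sub>m S)) / of_int p)"
    proof (rule zp_det_cong[of S])
      fix i j assume ij: "i < S" "j < S"
      have e: "(c' \<cdot>\<^sub>m (?Z * ?X)) $$ (i, j) = c' * (?Z * ?X) $$ (i, j)" using ij by simp
      show "zp p ((c' \<cdot>\<^sub>m (?Z * ?X)) $$ (i, j))" unfolding e by (rule ZX[OF ij])
      show "zp p (((c' \<cdot>\<^sub>m (?Z * ?X)) $$ (i, j) - 1\<^sub>m S $$ (i, j)) / of_int p)"
        unfolding e using cong[OF ij] ij by simp
      show "zp p (1\<^sub>m S $$ (i, j))" using ij zp_0 zp_1 by simp
    qed auto
    then have "zp p ((det (c' \<cdot>\<^sub>m (?Z * ?X)) - of_int 1) / of_int p)" by simp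
    moreover have "\<not> p dvd 1" using prime not_prime_unit by blast
    ultimately show ?thesis by (rule zp_unit_cong)
  qed
  have "zp p (c' * (?Z * T) $$ (r, l))" if T: "T \<in> carrier_mat S S"
    "\<forall>i<S. \<forall>j<S. zp p (T $$ (i, j) / pr ^ (2 * (nat_of_num E - 1)))" and rl: "r < S" "l < S" for T r l
  proof -
    have "c' * (?Z * T) $$ (r, l) = (\<Sum>i<S. (1 / R) * (1 / R) * numeral (?zs ! r ! i) * (T $$ (i, l) / pr ^ d))"
      unfolding mul[OF T(1) rl] sum_distrib_left c'_def by (simp add: power2_eq_square)
    also have "zp p \<dots>"
      using T(2) rl by (intro zp_sum zp_mult zp_R zp_numeral zp_shift[OF de]) auto
    finally show ?thesis .
  qed
  then show ?thesis
    unfolding good_lattice_def using u ZX by (intro exI[of _ ?Z] exI[of _ c']) auto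
qed

end

section \<open>Closed forms of the products\<close>

definition odd_product :: "nat \<Rightarrow> rat" where
  "odd_product m = (\<Prod>l<m. of_nat (2 * l + 3))"

lemma odd_product_nonzero: "odd_product m \<noteq> 0"
  unfolding odd_product_def by (simp add: prod_zero_iff add_eq_0_iff del: of_nat_add of_nat_mult)

lemma odd_product_Suc: "odd_product (Suc m) = odd_product m * of_nat (2 * Suc m + 1)"
  by (simp add: odd_product_def algebra_simps)

lemma PiB_od: "of_nat (PiB B i) = (odd_product (B + i) / odd_product i) ^ 2"
proof (induction B)
  case 0
  then show ?case using odd_product_nonzero[of i] by (simp add: PiB_def)
next
  case (Suc B)
  have "PiB (Suc B) i = PiB B i * (2 * Suc (B + i) + 1) ^ 2"
    by (simp add: PiB_def)
  then have "(of_nat (PiB (Suc B) i) :: rat) = of_nat (PiB B i) * of_nat (2 * Suc (B + i) + 1) ^ 2"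
    by (simp only: of_nat_mult of_nat_power)
  then show ?case
    unfolding Suc add_Suc odd_product_Suc by (simp only: power_divide power_mult_distrib times_divide_eq_left)
qed

lemma prod_od: "(\<Prod>j=1..S. of_nat (2 * (i + j) + 1)) = odd_product (i + S) / odd_product i"
proof (induction S)
  case 0
  then show ?case using odd_product_nonzero[of i] by simp
next
  case (Suc S)
  have "(\<Prod>j=1..Suc S. of_nat (2 * (i + j) + 1)) = (\<Prod>j=1..S. of_nat (2 * (i + j) + 1)) * (of_nat (2 * Suc (i + S) + 1) :: rat)"
    by simp
  then show ?case unfolding Suc add_Suc_right odd_product_Suc by simp
qed

lemma weight_od:
  assumes "i \<le> n"
  shows "weight n B S i = fact n / (fact i * fact (n - i)) * odd_product (B + i) ^ 2 / (odd_product i * odd_product (i + S))"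
proof -
  have "a * (x / y) ^ 2 / (z / y) = a * x ^ 2 / (y * z)" if "y \<noteq> 0" for a x y z :: rat
    using that by (simp add: power2_eq_square)
  then show ?thesis
    unfolding weight_def PiB_od prod_od binomial_fact[OF assms] using odd_product_nonzero by blast
qed

context modulus begin

text \<open>Products of consecutive factors from the top, each step being one Montgomery
multiplication. The initial factor $p$ keeps exponents positive.\<close>

definition down :: "(nat \<Rightarrow> rat) \<Rightarrow> nat \<Rightarrow> nat \<Rightarrow> rat" where
  "down f N j = pr * (\<Prod>i<j. f (N - i) / R)"

lemma down_fact: "j \<le> N \<Longrightarrow> down of_nat N j = pr * fact N / fact (N - j) / R ^ j"
proof (induction j)
  case (Suc j)
  then have e: "N - j = Suc (N - Suc j)" by simp
  have "fact (N - j) = (of_nat (N - j) * fact (N - Suc j) :: rat)"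
    unfolding e by simp
  moreover have "of_nat (N - j) \<noteq> (0 :: rat)" using Suc.prems by simp
  ultimately have "pr * fact N / fact (N - j) / R ^ j * (of_nat (N - j) / R) = pr * fact N / fact (N - Suc j) / R ^ Suc j"
    by simp
  then show ?case using Suc by (simp only: down_def prod.lessThan_Suc Suc_leD mult.assoc[symmetric])
qed (simp add: down_def)

lemma down_od: "j \<le> N \<Longrightarrow> down (\<lambda>l. of_nat (2 * l + 1)) N j = pr * odd_product N / odd_product (N - j) / R ^ j"
proof (induction j)
  case 0
  then show ?case using odd_product_nonzero[of N] by (simp add: down_def)
next
  case (Suc j)
  then have e: "N - j = Suc (N - Suc j)" by simp
  have "odd_product (N - j) = odd_product (N - Suc j) * of_nat (2 * (N - j) + 1)"
    unfolding e odd_product_Suc by simp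
  moreover have "of_nat (2 * (N - j) + 1) \<noteq> (0 :: rat)" unfolding of_nat_eq_0_iff by simp
  moreover have "a / (y * z) / r * (z / s) = a / y / (s * r)" if "z \<noteq> 0" for a y z r s :: rat
    using that by (simp add: mult_ac)
  ultimately have "pr * odd_product N / odd_product (N - j) / R ^ j * (of_nat (2 * (N - j) + 1) / R) = pr * odd_product N / odd_product (N - Suc j) / R ^ Suc j"
    by (simp only: power_Suc)
  then show ?case using Suc by (simp only: down_def prod.lessThan_Suc Suc_leD mult.assoc[symmetric])
qed

definition up :: "nat \<Rightarrow> rat" where
  "up j = pr * (\<Prod>i<j. of_nat (2 * Suc i + 1) / R)"

lemma up_od: "up j = pr * odd_product j / R ^ j"
proof -
  show ?thesis unfolding up_def odd_product_def prod_dividef by (simp add: add.commute)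
qed

definition summand_product :: "nat \<Rightarrow> nat \<Rightarrow> nat \<Rightarrow> nat \<Rightarrow> nat \<Rightarrow> rat" where
  "summand_product N d B S i = down of_nat N (d + i) * (down of_nat N (N - i) * down (\<lambda>l. of_nat (2 * l + 1)) (N + 4) (N + 4 - i))
    * down (\<lambda>l. of_nat (2 * l + 1)) (N + 4) (N + 4 - (S + i)) * (up (B + i) ^ 2 / R)"

text \<open>The powers of $R$ in the four products add up to the same exponent for every $i$, so the
summands are a constant times the weight.\<close>

lemma summand_product_weight:
  assumes N: "n + d = N" "d > 0" "S \<le> 5"
  shows "\<exists>\<kappa>. \<kappa> \<noteq> 0 \<and> (\<forall>i\<le>n. summand_product N d B S i = \<kappa> * weight n B S i)"
proof -
  define \<kappa> where "\<kappa> = (pr * fact N) ^ 2 * (pr * odd_product (N + 4)) ^ 2 * pr ^ 2 / R ^ (d + 3 * N + 9 + 2 * B - S) / fact n"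
  have "\<kappa> \<noteq> 0" using odd_product_nonzero by (simp add: \<kappa>_def)
  moreover have "summand_product N d B S i = \<kappa> * weight n B S i" if i: "i \<le> n" for i
  proof -
    have idx: "N - (d + i) = n - i" "N - (N - i) = i" "N + 4 - (N + 4 - i) = i" "N + 4 - (N + 4 - (S + i)) = i + S"
      and le: "d + i \<le> N" "N - i \<le> N" "N + 4 - i \<le> N + 4" "N + 4 - (S + i) \<le> N + 4"
      using N i by auto
    have ex: "d + 3 * N + 9 + 2 * B - S = (d + i) + (N - i) + (N + 4 - i) + (N + 4 - (S + i)) + (B + i) + (B + i) + 1"
      using N i by simp
    have gen: "(f / x1 / r1) * ((f / x2 / r2) * (b / x3 / r3)) * (b / x4 / r4) * ((P * g / r5) ^ 2 / r)
      = f ^ 2 * b ^ 2 * P ^ 2 / (r1 * r2 * r3 * r4 * r5 * r5 * r) / y * (y / (x2 * x1) * g ^ 2 / (x3 * x4))"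
      if "y \<noteq> 0" for f b P g r1 r2 r3 r4 r5 r x1 x2 x3 x4 y :: rat
      using that by (simp add: power2_eq_square mult_ac)
    have "R ^ (d + 3 * N + 9 + 2 * B - S)
      = R ^ (d + i) * R ^ (N - i) * R ^ (N + 4 - i) * R ^ (N + 4 - (S + i)) * R ^ (B + i) * R ^ (B + i) * R"
      unfolding ex by (simp only: power_add power_one_right)
    then show ?thesis
      unfolding summand_product_def down_fact[OF le(1)] down_fact[OF le(2)] down_od[OF le(3)] down_od[OF le(4)] up_od idx
        weight_od[OF i] \<kappa>_def
      by (simp only:) (rule gen, simp)
  qed
  ultimately show ?thesis by blast
qed

text \<open>The matrix is $X = C(t_0 M_1 - M_s)$ and $T = C M_1$. The entries of $T$ are $p^{2e}$
times sums of integral terms.\<close>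

lemma good_lattice_ratio:
  fixes n B S m e b' :: nat and ds :: "nat list" and \<kappa> D t0 :: rat
  defines "N \<equiv> mat S S (\<lambda>ij. [: - moment_mat n B S ds (\<lambda>i. ssum (Suc i)) $$ ij, moment_mat n B S ds (\<lambda>_. 1) $$ ij :])"
  assumes lat: "good_lattice S (2 * e) (mat S S (\<lambda>(r, l).
      (\<Sum>i\<le>n. \<kappa> * weight n B S i / pr ^ m * (pr ^ (2 * e) * (t0 - ssum (Suc i)) * D / R ^ 3) / R ^ 3
        * of_nat (n - i) ^ l * of_nat ((n - i) choose (ds ! r))) / 2 ^ b'))"
    and int: "\<And>i. i \<le> n \<Longrightarrow> zp p (\<kappa> * weight n B S i / pr ^ m)"
    and D: "zp p D" "D \<noteq> 0" and k0: "\<kappa> \<noteq> 0" and t0: "zp p t0"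
  shows "\<exists>r. zp p r \<and> coeff (det N) j = r * poly (det N) t0"
proof -
  let ?X = "mat S S (\<lambda>(r, l).
      (\<Sum>i\<le>n. \<kappa> * weight n B S i / pr ^ m * (pr ^ (2 * e) * (t0 - ssum (Suc i)) * D / R ^ 3) / R ^ 3
        * of_nat (n - i) ^ l * of_nat ((n - i) choose (ds ! r))) / 2 ^ b')"
  define C where "C = \<kappa> / pr ^ m * pr ^ (2 * e) * D * (1 / R ^ 3) * (1 / R ^ 3) * (1 / 2 ^ b')"
  have C0: "C \<noteq> 0" using k0 D by (simp add: C_def)
  let ?m1 = "moment_mat n B S ds (\<lambda>_. 1)" and ?ms = "moment_mat n B S ds (\<lambda>i. ssum (Suc i))"
  let ?T = "mat S S (\<lambda>ij. C * ?m1 $$ ij)"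
  have X: "?X $$ (r, l) = C * (t0 * ?m1 $$ (r, l) - ?ms $$ (r, l))" if "r < S" "l < S" for r l
  proof -
    have "t0 * ?m1 $$ (r, l) - ?ms $$ (r, l) = moment n B S (ds ! r) l (\<lambda>i. t0 * 1 - ssum (Suc i))"
      using that by (simp only: moment_mat_def index_mat split moment_diff moment_cmult)
    moreover have "?X $$ (r, l) = C * moment n B S (ds ! r) l (\<lambda>i. t0 * 1 - ssum (Suc i))"
      using that unfolding moment_def C_def
      by (simp add: sum_distrib_left sum_divide_distrib mult_ac)
    ultimately show ?thesis by (simp only:)
  qed
  have T: "zp p (?T $$ (r, l) / pr ^ (2 * e))" if "r < S" "l < S" for r l
  proof -
    have "?T $$ (r, l) / pr ^ (2 * e) = (\<Sum>i\<le>n. \<kappa> * weight n B S i / pr ^ m * D * (1 / R) * (1 / R) * (1 / R) * (1 / R) * (1 / R) * (1 / R)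
        * (1 / 2 ^ b') * of_nat ((n - i) choose (ds ! r)) * of_nat (n - i) ^ l)"
      using that unfolding C_def moment_mat_def moment_def
      by (simp add: sum_distrib_left sum_divide_distrib mult_ac power3_eq_cube)
    also have "zp p \<dots>"
      using int by (intro zp_sum zp_mult D zp_R zp_of_nat zp_power zp_unit_imp_zp[OF unit_R]) auto
    finally show ?thesis .
  qed
  obtain Z c' where Z: "Z \<in> carrier_mat S S"
    and ZT: "\<And>i j. i < S \<Longrightarrow> j < S \<Longrightarrow> zp p (c' * (Z * ?T) $$ (i, j))"
    and ZX: "\<And>i j. i < S \<Longrightarrow> j < S \<Longrightarrow> zp p (c' * (Z * ?X) $$ (i, j))"
    and u: "zp_unit p (det (c' \<cdot>\<^sub>m (Z * ?X)))"
  proof -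
    from lat obtain Z c' where Z: "Z \<in> carrier_mat S S" and
      *: "\<forall>T\<in>carrier_mat S S. (\<forall>i<S. \<forall>j<S. zp p (T $$ (i, j) / pr ^ (2 * e))) \<longrightarrow> (\<forall>i<S. \<forall>j<S. zp p (c' * (Z * T) $$ (i, j)))"
      "\<forall>i<S. \<forall>j<S. zp p (c' * (Z * ?X) $$ (i, j))" "zp_unit p (det (c' \<cdot>\<^sub>m (Z * ?X)))"
      unfolding good_lattice_def by blast
    have "?T \<in> carrier_mat S S" by simp
    with *(1) T have "\<forall>i<S. \<forall>j<S. zp p (c' * (Z * ?T) $$ (i, j))" by blast
    then show ?thesis using that Z *(2, 3) by blast
  qed
  let ?N = "mat S S (\<lambda>ij. [: ?X $$ ij - t0 * ?T $$ ij, ?T $$ ij :])"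
  have "\<exists>r. zp p r \<and> coeff (det ?N) j = r * poly (det ?N) t0"
    by (rule coeff_det_affine[OF _ _ Z ZX ZT u t0]) auto
  then obtain r where r: "zp p r" "coeff (det ?N) j = r * poly (det ?N) t0" by blast
  have "?N = [:C:] \<cdot>\<^sub>m N"
  proof (rule eq_matI)
    fix i j assume "i < dim_row ([:C:] \<cdot>\<^sub>m N)" "j < dim_col ([:C:] \<cdot>\<^sub>m N)"
    then have ij: "i < S" "j < S" by (auto simp: N_def)
    then have "?N $$ (i, j) = [: ?X $$ (i, j) - t0 * ?T $$ (i, j), ?T $$ (i, j) :]" by simp
    also have "?T $$ (i, j) = C * ?m1 $$ (i, j)" using ij by simp
    also have "?X $$ (i, j) - t0 * (C * ?m1 $$ (i, j)) = - (C * ?ms $$ (i, j))"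
      unfolding X[OF ij] by (simp add: algebra_simps)
    finally show "?N $$ (i, j) = ([:C:] \<cdot>\<^sub>m N) $$ (i, j)"
      using ij by (simp add: N_def)
  qed (auto simp: N_def)
  then have "det ?N = [:C ^ S:] * det N"
    by (simp add: N_def poly_const_pow)
  then have "C ^ S * coeff (det N) j = r * (C ^ S * poly (det N) t0)"
    using r(2) by simp
  then have "C ^ S * coeff (det N) j = C ^ S * (r * poly (det N) t0)"
    by (simp only: mult_ac)
  moreover have "C ^ S \<noteq> 0" using C0 by simp
  ultimately have "coeff (det N) j = r * poly (det N) t0" using mult_left_cancel by blast
  with r(1) show ?thesis by blast
qed

end

section \<open>Correctness of the certificates\<close>

lemma (in tail_list) common_denom_nonzero: "common_denom (length ON) \<noteq> 0"
proof -
  have "step j \<noteq> 0" if "j < length ON" for j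
    using zp_unit_nonzero[OF unit_part_unit[OF that]] by (simp add: step_def)
  then show ?thesis by (simp add: common_denom_def)
qed

fun valid_row :: "nat \<Rightarrow> row \<Rightarrow> bool" where
  "valid_row B (n, S, q, ds, L) \<longleftrightarrow> 0 < n \<and> 0 < B \<and> 0 < S \<and> S \<le> 5 \<and> 0 < L \<and> 0 < q \<and> q \<le> 2 \<and> length ds = S
    \<and> (\<forall>d\<in>set ds. d + S \<le> L)"

fun row_poly :: "nat \<Rightarrow> row \<Rightarrow> rat poly" where
  "row_poly B (n, S, q, ds, L) = det (mat S S (\<lambda>ij.
    [: - moment_mat n B S ds (\<lambda>i. ssum (Suc i)) $$ ij, moment_mat n B S ds (\<lambda>_. 1) $$ ij :]))"

fun row_point :: "row \<Rightarrow> rat" where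
  "row_point (n, S, q, ds, L) = 1 / of_nat q"

text \<open>Up to constant factors this is the second alternative of
\<open>gcd_H_Phi_eq_1\<close>.\<close>

definition row_ratio :: "int \<Rightarrow> nat \<Rightarrow> row \<Rightarrow> bool" where
  "row_ratio p B r \<longleftrightarrow> (\<forall>j. \<exists>x. zp p x \<and> coeff (row_poly B r) j = x * poly (row_poly B r) (row_point r))"

lemma nat_of_num_of_nat: "0 < n \<Longrightarrow> nat_of_num (num_of_nat n) = n"
  by (rule num_of_nat_inverse)

lemma length_fuel': "length (fuel n) = nat_of_num (num_of_nat n)"
  by (simp add: fuel_def length_iter_Cons)

text \<open>\<open>FL\<close> splits the numbers $1, \dots, N$, and \<open>OL\<close> the odd
numbers from 1; the latter splitting is complete.\<close>

locale factor_tables = modulus +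
  fixes N Bm K M :: num and FL OL :: "factor list"
  assumes K: "k = nat_of_num K" and M: "numeral M = p ^ k" "numeral (pred M) = p ^ k - 1"
    and FL: "length FL = nat_of_num N" "\<And>i. i < nat_of_num N \<Longrightarrow> represents_factor (of_nat (Suc i)) (FL ! i)"
    and OL: "length OL = nat_of_num N + nat_of_num Bm"
      "\<And>i. i < nat_of_num N + nat_of_num Bm \<Longrightarrow> represents_factor (of_nat (2 * i + 1)) (OL ! i)"
      "\<And>i. i < nat_of_num N + nat_of_num Bm \<Longrightarrow> zp_unit p (of_nat (2 * i + 1) / pr ^ exponent_of (fst (OL ! i)))"
    and Bm: "5 \<le> nat_of_num Bm"
begin

abbreviation nN :: nat where "nN \<equiv> nat_of_num N"

definition "fs = scan (advance h c) (num.One, num.One) (rev FL)"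
definition "rbs = scan (advance h c) (num.One, num.One) (rev (tl (take (nN + 5) OL)))"
definition "os = map (square h c) (scan (advance h c) (num.One, num.One) (tl OL))"
definition "ws = powers P num.One (iter (Cons ()) K [])"

abbreviation "odd_down \<equiv> down (\<lambda>l. of_nat (2 * l + 1)) (nN + 4)"

lemma fs: "length fs = Suc nN" "j \<le> nN \<Longrightarrow> represents (down of_nat nN j) (fs ! j)"
proof -
  show "length fs = Suc nN" by (simp add: fs_def FL)
  assume j: "j \<le> nN"
  have "represents (pr * (\<Prod>i<j. of_nat (nN - i) / R)) (scan (advance h c) (num.One, num.One) (rev FL) ! j)"
  proof (rule represents_scan)
    show "represents_factor (of_nat (nN - i)) (rev FL ! i)" if "i < length (rev FL)" for i
      using that FL(2)[of "nN - Suc i"] by (simp add: rev_nth FL(1) Suc_diff_Suc)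
  qed (use j FL in simp)
  then show "represents (down of_nat nN j) (fs ! j)" by (simp add: fs_def down_def)
qed

lemma rbs: "length rbs = nN + 5" "j \<le> nN + 4 \<Longrightarrow> represents (odd_down j) (rbs ! j)"
proof -
  let ?L = "tl (take (nN + 5) OL)"
  have len: "length ?L = nN + 4" using OL(1) Bm by simp
  then show "length rbs = nN + 5" by (simp add: rbs_def)
  assume j: "j \<le> nN + 4"
  have "represents (pr * (\<Prod>i<j. of_nat (2 * (nN + 4 - i) + 1) / R)) (scan (advance h c) (num.One, num.One) (rev ?L) ! j)"
  proof (rule represents_scan)
    show "represents_factor (of_nat (2 * (nN + 4 - i) + 1)) (rev ?L ! i)" if "i < length (rev ?L)" for i
    proof -
      have i: "i < nN + 4" using that len by simp
      then have "rev ?L ! i = ?L ! (nN + 4 - Suc i)"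
        using rev_nth[of i ?L] unfolding len by simp
      also have "\<dots> = take (nN + 5) OL ! Suc (nN + 4 - Suc i)"
        by (rule nth_tl) (use i len in simp)
      also have "Suc (nN + 4 - Suc i) = nN + 4 - i" using i by simp
      also have "take (nN + 5) OL ! (nN + 4 - i) = OL ! (nN + 4 - i)" by simp
      finally show ?thesis using OL(2)[of "nN + 4 - i"] Bm i by simp
    qed
  qed (use j len in simp)
  then show "represents (odd_down j) (rbs ! j)" by (simp add: rbs_def down_def)
qed

lemma os: "length os = nN + nat_of_num Bm" "j < nN + nat_of_num Bm \<Longrightarrow> represents (up j ^ 2 / R) (os ! j)"
proof -
  show len: "length os = nN + nat_of_num Bm" using OL(1) Bm by (simp add: os_def)
  assume j: "j < nN + nat_of_num Bm"
  have "represents (pr * (\<Prod>i<j. of_nat (2 * Suc i + 1) / R)) (scan (advance h c) (num.One, num.One) (tl OL) ! j)"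
  proof (rule represents_scan)
    show "represents_factor (of_nat (2 * Suc i + 1)) (tl OL ! i)" if "i < length (tl OL)" for i
      using that OL(2)[of "Suc i"] OL(1) by (simp add: nth_tl)
  qed (use j OL(1) in simp)
  then have "represents (up j) (scan (advance h c) (num.One, num.One) (tl OL) ! j)" by (simp add: up_def)
  from represents_square[OF this] show "represents (up j ^ 2 / R) (os ! j)"
    using j OL(1) by (simp add: os_def)
qed

lemma ws: "length ws = k" "t < k \<Longrightarrow> numeral (ws ! t) = pr ^ t"
proof -
  show len: "length ws = k" by (simp add: ws_def length_iter_Cons K)
  have "(numeral P :: rat) = pr" using p by simp
  then show "t < k \<Longrightarrow> numeral (ws ! t) = pr ^ t"
    using nth_powers[of t "iter (Cons ()) K []" P num.One, where 'a = rat] by (simp add: ws_def length_iter_Cons K)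
qed

text \<open>The list \<open>xs\<close> has the products of the weights with the partial sums,
computed once for all cases that use the same point and exponent. The other factors depend on the
case only by a shift of the index.\<close>

lemma case_ok_sound:
  assumes ok: "case_ok (P, K, N, Bm, h, c, M, ws, fs, rev rbs, os) E Q N' xs (B, dl, m, cert) (n, S, q, ds, L)"
    and row: "valid_row B (n, S, q, ds, L)"
    and xs: "nat_of_num N' \<le> length xs"
      "\<And>i. i < nat_of_num N' \<Longrightarrow> zp p (down of_nat nN (nN - i) * odd_down (nN + 4 - i) / pr ^ nat_of_num (fst (xs ! i)))"
      "\<And>i. i < nat_of_num N' \<Longrightarrow> approx_opt (down of_nat nN (nN - i) * odd_down (nN + 4 - i) / pr ^ nat_of_num (fst (xs ! i))
        * (pr ^ (2 * (nat_of_num E - 1)) * (1 / numeral Q - ssum (Suc i)) * D / R ^ 3)) (snd (xs ! i))"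
    and D: "zp p D" "D \<noteq> 0" and Q: "zp p (1 / numeral Q)"
  shows "row_ratio p B (n, S, q, ds, L)"
proof -
  define d where "d = nat_of_num (num_of_nat dl)"
  have row': "0 < n" "0 < B" "0 < S" "S \<le> 5" "0 < L" "0 < q" "length ds = S" "\<And>d. d \<in> set ds \<Longrightarrow> d + S \<le> L"
    using row by auto
  have d: "0 < d" by (simp add: d_def nat_of_num_pos)
  let ?m = "nat_of_num (num_of_nat m)"
  let ?cc = "ppow (num.Bit0 num.One) (num_of_nat 72)"
  let ?ss = "moments h c ws (num_of_nat m) (drop_num (num_of_nat dl) fs) xs (drop_num (num_of_nat S) (rev rbs)) (drop_num (num_of_nat B) os) (konst None (fuel L))"
  let ?cs = "columns h ?cc (map onum ds) (fuel S) (map (unopt M) ?ss)"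
  have conds: "num_of_nat n + num_of_nat dl = N" "num_of_nat n < N'" "num_of_nat B \<le> Bm" "num_of_nat q = Q"
    "length ?ss = L" "mat_ok P K E h c M (fuel S) cert ?cs"
    using ok row' by (auto simp: same_len_iff length_fuel)
  have nN: "n + d = nN"
    using arg_cong[OF conds(1), of nat_of_num] row' by (simp add: nat_of_num_add nat_of_num_of_nat d_def)
  have nN': "n < nat_of_num N'" using conds(2) row' by (simp add: less_num_def nat_of_num_of_nat)
  have BBm: "B \<le> nat_of_num Bm" using conds(3) row' by (simp add: less_eq_num_def nat_of_num_of_nat)
  have qQ: "numeral Q = (of_nat q :: rat)"
    using row' by (simp flip: conds(4) add: numeral_nat_of_num nat_of_num_of_nat)
  let ?w = "summand_product nN d B S" and ?z = "\<lambda>i. pr ^ (2 * (nat_of_num E - 1)) * (1 / of_nat q - ssum (Suc i)) * D / R ^ 3"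
  let ?f1 = "drop d fs" and ?f3 = "drop S (rev rbs)" and ?f4 = "drop B os"
  have len: "length ?f1 = Suc n" "Suc n \<le> length xs" "Suc n \<le> length ?f3" "Suc n \<le> length ?f4"
    using fs(1) rbs(1) os(1) nN nN' xs(1) d row' BBm by auto
  have items: "item_rep (?w i) (?z i) (?f1 ! i, xs ! i, ?f3 ! i, ?f4 ! i)" if i: "i < Suc n" for i
    unfolding summand_product_def
  proof (rule item_repI)
    show "represents (down of_nat nN (d + i)) (?f1 ! i)"
      using fs nN i by simp
    have "?f3 ! i = rbs ! (nN + 4 - (S + i))"
      using rbs(1) row' nN d i by (simp add: rev_nth add.commute[of 4])
    then show "represents (odd_down (nN + 4 - (S + i))) (?f3 ! i)"
      using rbs(2)[of "nN + 4 - (S + i)"] by simp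
    show "represents (up (B + i) ^ 2 / R) (?f4 ! i)"
      using os(2)[of "B + i"] os(1) BBm nN d i by simp
    have "i < nat_of_num N'" using i nN' by simp
    from xs(2, 3)[OF this]
    show "zp p (down of_nat nN (nN - i) * odd_down (nN + 4 - i) / pr ^ nat_of_num (fst (xs ! i)))"
      "approx_opt (down of_nat nN (nN - i) * odd_down (nN + 4 - i) / pr ^ nat_of_num (fst (xs ! i)) * ?z i) (snd (xs ! i))"
      by (simp_all add: qQ)
  qed
  have drps: "drop_num (num_of_nat dl) fs = ?f1" "drop_num (num_of_nat S) (rev rbs) = ?f3" "drop_num (num_of_nat B) os = ?f4"
    using row' by (simp_all add: drop_num_drop d_def nat_of_num_of_nat)
  have fuel: "length (fuel L) = L" by (simp add: length_fuel row')
  have sound: "partial_ok ?w ?z ?m (length (fuel L)) (0 + length ?f1) ?ss"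
    unfolding drps by (rule moments_sound) (use items len ws partial_ok_init in auto)
  have po: "partial_ok ?w ?z ?m L (Suc n) ?ss" using sound unfolding fuel len(1) add_0 .
  have "?ss \<noteq> []" using conds(5) row' by (metis list.size(3) less_irrefl)
  with po have zpw: "\<And>i. i \<le> n \<Longrightarrow> zp p (?w i / pr ^ ?m)"
    and sums: "\<And>j. j < L \<Longrightarrow> approx_opt (\<Sum>l<Suc n. ?w l / pr ^ ?m * ?z l / R ^ 3 * of_nat ((Suc n - 1 - l) choose j)) (?ss ! j)"
    by (auto simp: partial_ok_def less_Suc_eq_le)
  let ?y = "\<lambda>i. ?w i / pr ^ ?m * ?z i / R ^ 3"
  let ?g = "\<lambda>l j. \<Sum>i\<le>n. ?y i * of_nat (n - i) ^ l * of_nat ((n - i) choose j)"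
  have mu: "approx (?g 0 j) (map (unopt M) ?ss ! j)" if "j + 0 < L" for j
  proof -
    have "approx_opt (?g 0 j) (?ss ! j)" using sums[of j] that by (simp add: lessThan_Suc_atMost)
    from approx_unopt[OF M(1) this] show ?thesis using that conds(5) by simp
  qed
  let ?b = "clen ?cc"
  have cols: "approx (?g l (ds ! r) / 2 ^ ?b) (?cs ! l ! r)" if "r < S" "l < S" for r l
  proof -
    have "approx (?g (0 + l) (ds ! r) / 2 ^ clen ?cc) (?cs ! l ! r)"
    proof (rule columns_sound)
      have "ds ! r + S \<le> L" using row'(7, 8) that by auto
      then show "ds ! r + 0 + l < L" using that by simp
    qed (use mu conds(5) that row' in \<open>auto simp: length_fuel\<close>)
    then show ?thesis by simp
  qed
  have "approx (-1) (pred M)" by (rule approx_minus_1[OF M(2)])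
  then have lat: "good_lattice S (2 * (nat_of_num E - 1)) (mat S S (\<lambda>(r, l). ?g l (ds ! r) / 2 ^ ?b))"
    using row' cols
    by (intro mat_ok_sound[OF conds(6) K M(1)]) (auto simp: length_fuel length_columns length_columns_nth)
  obtain \<kappa> where k: "\<kappa> \<noteq> 0" "\<And>i. i \<le> n \<Longrightarrow> ?w i = \<kappa> * weight n B S i"
    using summand_product_weight[OF nN d row'(4), of B] by blast
  have g: "?g l j = (\<Sum>i\<le>n. \<kappa> * weight n B S i / pr ^ ?m * ?z i / R ^ 3 * of_nat (n - i) ^ l * of_nat ((n - i) choose j))" for l j
    using k(2) by (intro sum.cong) auto
  have zq: "zp p (1 / of_nat q)" using Q by (simp add: qQ)
  have zk: "zp p (\<kappa> * weight n B S i / pr ^ ?m)" if "i \<le> n" for i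
    using zpw[OF that] k(2)[OF that] by simp
  show ?thesis
    unfolding row_ratio_def row_poly.simps row_point.simps
    by (intro allI good_lattice_ratio[OF lat[unfolded g] zk D k(1) zq])
qed

end

lemma cases_ok_iff: "cases_ok T E q N' xs es \<longleftrightarrow> (\<forall>e\<in>set es. case_ok T E q N' xs e (find_row (fst e) case_table))"
  by (induction es) auto

lemma vals_below_nth: "vals_below E L \<Longrightarrow> i < length L \<Longrightarrow> exponent_of (fst (L ! i)) < nat_of_num E"
proof (induction E L arbitrary: i rule: vals_below.induct)
  case (2 E a L)
  then show ?case by (cases i) (auto simp: nat_of_num_pos)
next
  case (3 E v a L)
  then show ?case by (cases i) (auto simp: less_num_def)
qed simp

context factor_tables begin

text \<open>A power of $p$ that is not below the modulus vanishes modulo $p^k$.\<close>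

lemma cap_powers:
  assumes "v < length f"
  shows "approx_opt (pr ^ (2 * (length f - 1 - v))) (rev (map (cap M) (powers (P * P) num.One f)) ! v)"
proof -
  let ?t = "length f - 1 - v"
  let ?a = "powers (P * P) num.One f ! ?t"
  have t: "?t < length f" using assms by simp
  have nth: "rev (map (cap M) (powers (P * P) num.One f)) ! v = cap M ?a"
    using assms by (simp add: rev_nth)
  have "(numeral ?a :: int) = numeral num.One * numeral (P * P) ^ ?t" by (rule nth_powers[OF t])
  then have a: "numeral ?a = p ^ (2 * ?t)"
    unfolding numeral_mult p[symmetric] by (simp add: power_mult power2_eq_square)
  have aq: "numeral ?a = pr ^ (2 * ?t)"
    using arg_cong[OF a, of "of_int :: int \<Rightarrow> rat"] by (simp only: of_int_numeral of_int_power)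
  show ?thesis
  proof (cases "?a < M")
    case True
    then show ?thesis using approx_numeral[of ?a] unfolding nth cap_def aq by (simp add: approx_opt_def)
  next
    case False
    then have "(numeral M :: int) \<le> numeral ?a" by simp
    then have "p ^ k \<le> p ^ (2 * ?t)" unfolding a M .
    then have "k \<le> 2 * ?t" using prime_gt_1_int[OF prime] by (simp add: power_increasing_iff)
    then have "pr ^ (2 * ?t) = pr ^ (2 * ?t - k) * pr ^ k" by (simp flip: power_add)
    then have "zp p (pr ^ (2 * ?t) / pr ^ k)" using zp_pr by simp
    then show ?thesis unfolding nth cap_def using False by (simp add: approx_opt_def)
  qed
qed

lemma subgroup_ok_sound:
  assumes ok: "subgroup_ok (P, K, N, Bm, h, c, M, ws, fs, rev rbs, os) (drop_num (num.Bit0 (num.Bit0 num.One)) rbs) OL (E, q, N', d, es)"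
    and e: "e \<in> set es" and row: "valid_row (fst e) (find_row (fst e) case_table)"
  shows "row_ratio p (fst e) (find_row (fst e) case_table)"
proof -
  let ?E = "num_of_nat E" and ?Q = "num_of_nat q" and ?N' = "num_of_nat N'"
  define n' where "n' = nat_of_num ?N'"
  define d' where "d' = nat_of_num (num_of_nat d)"
  define ON where "ON = map snd (zip (fuel N') OL)"
  define gs where "gs = rev (map (cap M) (powers (P * P) num.One (fuel E)))"
  define Fs where "Fs = drop_num (num_of_nat d) fs"
  define Bs where "Bs = drop_num (num_of_nat d) (drop_num (num.Bit0 (num.Bit0 num.One)) rbs)"
  have nd: "?N' + num_of_nat d = N + num.One" and tails: "tails_ok (P, K, N, Bm, h, c, M, ws, fs, rev rbs, os) ?E ?Q ?N' es Fs Bs gs ON"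
    using ok by (auto simp: ON_def gs_def Fs_def Bs_def)
  have nd': "n' + d' = Suc nN" using arg_cong[OF nd, of nat_of_num] by (simp add: nat_of_num_add n'_def d'_def)
  have d0: "0 < d'" and n0: "0 < n'" by (simp_all add: d'_def n'_def nat_of_num_pos)
  have ON: "length ON = n'" "\<And>i. i < n' \<Longrightarrow> ON ! i = OL ! i"
    using nd' d0 OL(1) by (auto simp: ON_def length_fuel' n'_def[symmetric])
  have lgs: "length gs = nat_of_num ?E" by (simp add: gs_def length_fuel')
  have E0: "0 < nat_of_num ?E" by (rule nat_of_num_pos)
  interpret tl: tail_list p P h c k ON gs M ?Q
  proof
    show "numeral M = p ^ k" "numeral (pred M) = p ^ k - 1" by (rule M)+
    show "represents_factor (of_nat (2 * i + 1)) (ON ! i)" if "i < length ON" for i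
      using OL(2)[of i] that ON nd' d0 by simp
    show "zp_unit p (of_nat (2 * i + 1) / pr ^ exponent_of (fst (ON ! i)))" if "i < length ON" for i
      using OL(3)[of i] that ON nd' d0 by simp
    show "exponent_of (fst (ON ! i)) < length gs" if "i < length ON" for i
      unfolding lgs using tails that by (auto intro: vals_below_nth)
    show "gs \<noteq> []" using lgs E0 by auto
    show "approx_opt (pr ^ (2 * (length gs - 1 - v))) (gs ! v)" if "v < length gs" for v
      using cap_powers[of v "fuel E"] that by (simp add: gs_def)
  qed
  define hs where "hs = map (head_item h c) (zip tl.back (zip tl.cod (zip Fs Bs)))"
  have cok: "case_ok (P, K, N, Bm, h, c, M, ws, fs, rev rbs, os) ?E ?Q ?N' (rev hs) e (find_row (fst e) case_table)"
    using tails e by (auto simp: cases_ok_iff hs_def)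
  have lFs: "length Fs = n'" and lBs: "length Bs = n'"
    using nd' fs(1) rbs(1) by (auto simp: Fs_def Bs_def drop_num_drop d'_def[symmetric])
  have lhs: "length hs = n'" by (simp add: hs_def lFs lBs ON(1))
  have FsR: "represents (down of_nat nN (d' + j)) (Fs ! j)" if "j < n'" for j
    using fs that nd' by (simp add: Fs_def drop_num_drop d'_def[symmetric])
  have BsR: "represents (odd_down (4 + d' + j)) (Bs ! j)" if "j < n'" for j
  proof -
    have four: "nat_of_num (num.Bit0 (num.Bit0 num.One)) = 4" by simp
    have "Bs ! j = rbs ! (4 + d' + j)"
      unfolding Bs_def drop_num_drop d'_def[symmetric] four drop_drop using rbs(1) that nd'
      by (subst nth_drop) (simp_all add: add_ac)
    then show ?thesis using rbs(2)[of "4 + d' + j"] that nd' by simp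
  qed
  have xs: "zp p (down of_nat nN (nN - i) * odd_down (nN + 4 - i) / pr ^ nat_of_num (fst (rev hs ! i)))"
    "approx_opt (down of_nat nN (nN - i) * odd_down (nN + 4 - i) / pr ^ nat_of_num (fst (rev hs ! i))
        * (pr ^ (2 * (nat_of_num ?E - 1)) * (1 / numeral ?Q - ssum (Suc i)) * tl.common_denom n' / R ^ 3)) (snd (rev hs ! i))"
    if i: "i < n'" for i
  proof -
    define j where "j = n' - 1 - i"
    have j: "j < n'" and idx: "d' + j = nN - i" "4 + d' + j = nN + 4 - i" "n' - j = Suc i"
      using i nd' d0 by (auto simp: j_def)
    have nth: "rev hs ! i = hs ! j" using i lhs by (simp add: rev_nth j_def)
    note hi = tl.head_items[of "\<lambda>j. down of_nat nN (d' + j)" Fs "\<lambda>j. odd_down (4 + d' + j)" Bs j,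
        unfolded ON(1) lFs lBs, OF FsR BsR le_refl le_refl j, folded hs_def, unfolded idx]
    show "zp p (down of_nat nN (nN - i) * odd_down (nN + 4 - i) / pr ^ nat_of_num (fst (rev hs ! i)))"
      unfolding nth using hi(1) .
    show "approx_opt (down of_nat nN (nN - i) * odd_down (nN + 4 - i) / pr ^ nat_of_num (fst (rev hs ! i))
        * (pr ^ (2 * (nat_of_num ?E - 1)) * (1 / numeral ?Q - ssum (Suc i)) * tl.common_denom n' / R ^ 3)) (snd (rev hs ! i))"
      unfolding nth using hi(2) unfolding tl.scaled_tail_def lgs .
  qed
  have D: "zp p (tl.common_denom n')" "tl.common_denom n' \<noteq> 0"
    using tl.zp_common_denom tl.common_denom_nonzero by (simp_all add: ON(1))
  obtain B dl m cert n S q' ds L where er: "e = (B, dl, m, cert)" "find_row (fst e) case_table = (n, S, q', ds, L)"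
    by (metis prod.exhaust)
  have "num_of_nat q' = ?Q" using cok er by simp
  moreover have "q' = 1 \<or> q' = 2" using row unfolding er(2) by auto
  ultimately have Q: "zp p (1 / numeral ?Q)"
    using zp_1 zp_half by (auto simp: num_of_nat_simps numeral_One dest!: sym[of _ ?Q])
  have cok': "case_ok (P, K, N, Bm, h, c, M, ws, fs, rev rbs, os) ?E ?Q ?N' (rev hs) (B, dl, m, cert) (n, S, q', ds, L)"
    using cok unfolding er(2) by (simp only: er(1))
  have row': "valid_row B (n, S, q', ds, L)" using row unfolding er(2) by (simp only: er(1) fst_conv)
  have "row_ratio p B (n, S, q', ds, L)"
    by (rule case_ok_sound[OF cok' row' _ _ _ D Q, unfolded n'_def[symmetric]]) (use xs lhs in simp_all)
  then show ?thesis unfolding er(2) by (simp only: er(1) fst_conv)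
qed

end

text \<open>The odd numbers that are split are smaller than $p$ to the number of rounds, so all
exponents are known.\<close>

lemma group_ok_sound:
  assumes ok: "group_ok P ((K, lev, N, Bm), gs)" and prm: "prime p" "p = numeral P" "odd p"
    and sg: "sg \<in> set gs" "e \<in> set (snd (snd (snd (snd sg))))"
    and row: "valid_row (fst e) (find_row (fst e) case_table)"
  shows "row_ratio p (fst e) (find_row (fst e) case_table)"
proof -
  let ?K = "num_of_nat K" and ?N = "num_of_nat N" and ?Bm = "num_of_nat Bm" and ?lev = "num_of_nat lev"
  let ?M = "ppow P ?K" and ?PL = "ppow P ?lev"
  let ?h = "half ?M" and ?c = "num.Bit0 (num.Bit0 (num.Bit0 ?M)) + num_of_nat 4096"
  define k where "k = nat_of_num ?K"
  let ?fO = "iter (Cons ()) ?Bm (fuel N)"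
  define FL where "FL = iter (factors P num.One (fuel N) num.One num.One) ?lev []"
  define OL where "OL = iter (factors P (num.Bit0 num.One) ?fO (half P) num.One) ?lev []"
  have conds: "num.Bit0 (?N + ?Bm) < ?PL" "num.Bit0 (half P) = P + num.One" "num.Bit0 ?h = ?M + num.One"
    "pred ?M + num.One = ?M" "num.Bit1 (num.Bit0 num.One) \<le> ?Bm"
    and g2: "group_ok2 P ?K ?N ?Bm ?h ?c ?M gs (fuel N) FL OL"
    using ok by (simp_all add: group_ok1_def FL_def OL_def)
  have M: "numeral ?M = p ^ k" unfolding numeral_ppow k_def prm(2) by (rule refl)
  have "(numeral (num.Bit0 ?h) :: int) = numeral (?M + num.One)" by (simp only: conds(3))
  then have "numeral ?h + numeral ?h = p ^ k + 1" by (simp only: numeral_add numeral_Bit0 numeral_One M)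
  then have h: "2 * numeral ?h = p ^ k + 1" by (simp only: mult_2)
  have "(numeral (pred ?M + num.One) :: int) = numeral ?M" by (simp only: conds(4))
  then have pM: "numeral (pred ?M) = p ^ k - 1" by (simp only: numeral_add numeral_One M eq_diff_eq)
  have "(numeral (num.Bit0 (half P)) :: int) = numeral (P + num.One)" by (simp only: conds(2))
  then have "numeral (half P) + numeral (half P) = p + 1" by (simp only: numeral_add numeral_Bit0 numeral_One prm(2))
  then have hp: "2 * numeral (half P) = p + 1" by (simp only: mult_2)
  interpret modulus p P ?h ?c k
    by unfold_locales (use prm h nat_of_num_pos[of ?K] in \<open>auto simp: k_def\<close>)
  have p1: "1 < p" using prime_gt_1_int[OF prime] .
  have lN: "length (fuel N) = nat_of_num ?N" by (rule length_fuel')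
  have lO: "length ?fO = nat_of_num ?N + nat_of_num ?Bm" by (simp add: length_iter_Cons lN)
  note F1 = iter_factors_sound[of num.One num.One _ "fuel N" ?lev, folded FL_def]
  note O1 = iter_factors_sound[of "half P" "num.Bit0 num.One" _ ?fO ?lev, folded OL_def]
  have FL: "split_upto (nat_of_num ?lev) (1 + int i) (FL ! i)" "length FL = nat_of_num ?N" if "i < nat_of_num ?N" for i
    using F1[of i] that p1 by (simp_all add: lN)
  have OL: "split_upto (nat_of_num ?lev) (1 + 2 * int i) (OL ! i)" "length OL = nat_of_num ?N + nat_of_num ?Bm"
    if "i < nat_of_num ?N + nat_of_num ?Bm" for i
  proof -
    have "x \<le> p" "p = 1 + numeral (num.Bit0 num.One) * (p - x)" if "2 * x = p + 1" for x
      using that p1 by auto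
    note this[OF hp]
    from O1[OF this, of i] that show "split_upto (nat_of_num ?lev) (1 + 2 * int i) (OL ! i)" "length OL = nat_of_num ?N + nat_of_num ?Bm"
      by (simp_all add: lO)
  qed
  have "(numeral (num.Bit0 (?N + ?Bm)) :: int) < numeral ?PL" using conds(1) by simp
  then have "numeral (?N + ?Bm) + numeral (?N + ?Bm) < p ^ nat_of_num ?lev"
    unfolding numeral_ppow prm(2)[symmetric] numeral_Bit0 .
  then have "2 * (int (nat_of_num ?N) + int (nat_of_num ?Bm)) < p ^ nat_of_num ?lev"
    unfolding numeral_nat_of_num[of "?N + ?Bm"] nat_of_num_add of_nat_add mult_2 .
  then have small: "\<not> p ^ nat_of_num ?lev dvd 1 + 2 * int i" if "i < nat_of_num ?N + nat_of_num ?Bm" for i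
    using that by (intro zdvd_not_zless) auto
  interpret factor_tables p P ?h ?c k ?N ?Bm ?K ?M FL OL
  proof
    show "k = nat_of_num ?K" by (simp add: k_def)
    show "numeral ?M = p ^ k" "numeral (pred ?M) = p ^ k - 1" by (rule M, rule pM)
    show "length FL = nat_of_num ?N" by (rule FL(2)[of 0]) (rule nat_of_num_pos)
    show "represents_factor (of_nat (Suc i)) (FL ! i)" if "i < nat_of_num ?N" for i
      using FL(1)[OF that] by (simp add: split_upto_def)
    show "length OL = nat_of_num ?N + nat_of_num ?Bm" by (rule OL(2)[of 0]) (simp add: nat_of_num_pos)
    show "represents_factor (of_nat (2 * i + 1)) (OL ! i)" if "i < nat_of_num ?N + nat_of_num ?Bm" for i
      using OL(1)[OF that] by (simp add: split_upto_def add.commute)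
    show "zp_unit p (of_nat (2 * i + 1) / pr ^ exponent_of (fst (OL ! i)))" if "i < nat_of_num ?N + nat_of_num ?Bm" for i
      using OL(1)[OF that] small[OF that] by (simp add: split_upto_def add.commute)
    show "5 \<le> nat_of_num ?Bm" using conds(5) by (simp add: less_eq_num_def)
  qed
  have "5 \<le> nat_of_num ?Bm" using conds(5) by (simp add: less_eq_num_def)
  then have "min (length (() # () # () # () # () # fuel N)) (length OL) = nat_of_num ?N + 5"
    unfolding OL(1) list.size lN by linarith
  then have tk: "map snd (zip (() # () # () # () # () # fuel N) OL) = take (nat_of_num ?N + 5) OL"
    unfolding map_snd_zip_take by (simp only:)
  have "list_all (subgroup_ok (P, ?K, ?N, ?Bm, ?h, ?c, ?M, ws, fs, rev rbs, os) (drop_num (num.Bit0 (num.Bit0 num.One)) rbs) OL) gs"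
    using g2 unfolding group_ok2_def group_ok3_def tk fs_def rbs_def os_def ws_def .
  then have "subgroup_ok (P, ?K, ?N, ?Bm, ?h, ?c, ?M, ws, fs, rev rbs, os) (drop_num (num.Bit0 (num.Bit0 num.One)) rbs) OL sg"
    using sg(1) by (simp only: list_all_iff)
  moreover obtain E q N' d es where "sg = (E, q, N', d, es)" by (metis prod.exhaust)
  ultimately show ?thesis
    using sg(2) by (intro subgroup_ok_sound[OF _ _ row]) auto
qed

lemma occurs_iff: "occurs B xs \<longleftrightarrow> B \<in> set xs"
proof (induction xs)
  case (Cons x xs)
  then show ?case by (cases "B = x") auto
qed simp

lemma covered_iff: "covered p Bs rs \<longleftrightarrow> (\<forall>r\<in>set rs. p \<le> 6 * fst r + 2 * fst (snd (snd r)) + 5 \<longrightarrow> fst r \<in> set Bs)"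
proof (induction rs)
  case (Cons r rs)
  then show ?case by (cases "p \<le> 6 * fst r + 2 * fst (snd (snd r)) + 5") (auto simp: occurs_iff)
qed simp

lemma case_table_valid: "r \<in> set case_table \<Longrightarrow> valid_row (fst r) (snd r) \<and> find_row (fst r) case_table = snd r"
  unfolding case_table_def by (simp only: list.set insert_iff empty_iff) (elim disjE; simp)

lemma prime_ok_sound:
  assumes ok: "prime_ok (p, gs)" and p: "prime p" "odd p"
    and r: "r \<in> set case_table" "p \<le> 6 * fst r + 2 * fst (snd (snd r)) + 5"
  shows "row_ratio (int p) (fst r) (snd r)"
proof -
  have "fst r \<in> set (case_ids gs)" and groups: "list_all (group_ok (num_of_nat p)) gs"
    using ok r by (auto simp: covered_iff)
  then obtain g sg e where g: "g \<in> set gs" "sg \<in> set (snd g)" "e \<in> set (snd (snd (snd (snd sg))))" "fst r = fst e"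
    by (auto simp: case_ids_def)
  obtain K lev N Bm sgs where ge: "g = ((K, lev, N, Bm), sgs)" by (metis prod.exhaust)
  have "int p = numeral (num_of_nat p)"
    using prime_gt_0_nat[OF p(1)] by (simp add: numeral_nat_of_num nat_of_num_of_nat)
  moreover have "group_ok (num_of_nat p) ((K, lev, N, Bm), sgs)"
    using groups g(1) unfolding ge by (simp only: list_all_iff)
  moreover have "sg \<in> set sgs" using g(2) by (simp add: ge)
  ultimately have "row_ratio (int p) (fst e) (find_row (fst e) case_table)"
    using p g(3) case_table_valid[OF r(1)]
    by (intro group_ok_sound[where P = "num_of_nat p" and sg = sg]) (auto simp: g(4)[symmetric])
  then show ?thesis using case_table_valid[OF r(1)] by (simp add: g(4)[symmetric])
qed

text \<open>Only odd primes up to $6B + 2S + 5 \le 729$ need certificates. The scaling of the value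
by $q^S$ is harmless because $q \le 2$.\<close>

theorem gcd_eq_1_if_prime_ok:
  assumes data: "\<And>p. prime p \<Longrightarrow> odd p \<Longrightarrow> p \<le> 729 \<Longrightarrow> \<exists>gs. prime_ok (p, gs)"
    and r: "(B, n, S, q, ds, L) \<in> set case_table" and eps: "\<epsilon> \<in> {1, -1}"
    and xs: "sorted xs" "distinct xs" "length xs = S" "list_all (\<lambda>(x, d). x + d + 2 * B = n \<and> x \<le> S + 2) (zip xs ds)"
  shows "gcd (H \<epsilon> B S (set xs)) (Phi \<epsilon> B S (set xs) 1 (int q)) = 1"
proof (rule gcd_H_Phi_eq_1)
  have valid: "valid_row B (n, S, q, ds, L)" using case_table_valid[OF r] by simp
  then have S: "0 < S" "length ds = S" and q: "0 < q" "q \<le> 2" by auto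
  have big: "S + 1 \<le> B \<and> 6 * B + 2 * S + 5 \<le> 729"
    using r unfolding case_table_def by (simp only: list.set insert_iff empty_iff) (elim disjE; simp)
  show "int q \<noteq> 0" using q by simp
  have sl: "sorted_list_of_set (set xs) = xs"
    using xs by (intro sorted_list_of_set.idem_if_sorted_distinct)
  have nth: "xs ! i + ds ! i + 2 * B = n" "xs ! i \<le> S + 2" if "i < S" for i
    using xs(3, 4) S that by (auto simp: list_all_length)
  obtain \<kappa> where \<kappa>: "qhat \<epsilon> B S (set xs) = smult \<kappa> (row_poly B (n, S, q, ds, L))"
    using qhat_eq_det_moments[of S B ds "set xs" n \<epsilon>] big S nth unfolding sl row_poly.simps by auto
  show "(\<forall>k\<le>S. zp p (coeff (qhat \<epsilon> B S (set xs)) k)) \<or>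
      (\<forall>k\<le>S. \<exists>r. zp p r \<and> coeff (qhat \<epsilon> B S (set xs)) k = r * qval \<epsilon> B S (set xs) 1 (int q))"
    if p: "prime p" for p
  proof (cases "odd p \<and> p \<le> 6 * int B + 2 * int S + 5")
    case False
    interpret prime_int p using p by unfold_locales
    have "zpoly (qhat \<epsilon> B S (set xs))"
    proof (rule zpoly_qhat)
      fix m assume m: "m \<le> 3 * B + S + 2"
      show "\<not> p dvd int (2 * m + 1)"
      proof (cases "odd p")
        case True
        then show ?thesis using False m by (intro zdvd_not_zless) auto
      next
        case False
        then have "2 dvd p" by simp
        then show ?thesis using dvd_trans[of 2 p "int (2 * m + 1)"] by auto
      qed
    qed (use big nth sl eps in auto)
    then show ?thesis by (simp add: zpoly_def)
  next
    case True
    define p' where "p' = nat p"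
    have p': "p = int p'" using prime_gt_0_int[OF p] by (simp add: p'_def)
    have pp: "prime p'" "odd p'" "p' \<le> 6 * B + 2 * S + 5" using p True by (auto simp: p')
    interpret prime_int p using p by unfold_locales
    obtain gs where "prime_ok (p', gs)" using data[OF pp(1, 2)] pp(3) big by auto
    from prime_ok_sound[OF this pp(1, 2) r] pp(3) have ratio: "row_ratio p B (n, S, q, ds, L)"
      by (simp add: p')
    have "\<exists>r. zp p r \<and> coeff (qhat \<epsilon> B S (set xs)) k = r * qval \<epsilon> B S (set xs) 1 (int q)" for k
    proof -
      obtain x where x: "zp p x" "coeff (row_poly B (n, S, q, ds, L)) k = x * poly (row_poly B (n, S, q, ds, L)) (1 / of_nat q)"
        using ratio unfolding row_ratio_def row_point.simps by blast
      have "\<not> p dvd 2"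
      proof
        assume "p dvd 2"
        then have "p \<le> 2" by (rule zdvd_imp_le) simp
        with prime_gt_1_int[OF p] have "p = 2" by simp
        with True show False by simp
      qed
      then have "zp p (1 / of_int (int q))"
        using q zp_1 zp_inverse_int[of 2] by (cases "q = 1") (auto simp: le_Suc_eq numeral_2_eq_2)
      then have "zp p (x * (1 / of_int (int q)) ^ S)" using x by (intro zp_mult zp_power)
      moreover have "coeff (qhat \<epsilon> B S (set xs)) k = x * (1 / of_int (int q)) ^ S * qval \<epsilon> B S (set xs) 1 (int q)"
        unfolding qval_def \<kappa> coeff_smult x(2) poly_smult using q by (simp add: power_divide)
      ultimately show ?thesis by blast
    qed
    then show ?thesis by blast
  qed
qed

section \<open>The odd primes below 730\<close>

definition prime_list :: "nat list" where
  "prime_list = [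
    3, 5, 7, 11, 13, 17, 19, 23, 29, 31, 37, 41, 43, 47, 53, 59, 61, 67, 71, 73, 79, 83, 89, 97,
    101, 103, 107, 109, 113, 127, 131, 137, 139, 149, 151, 157, 163, 167, 173, 179, 181, 191,
    193, 197, 199, 211, 223, 227, 229, 233, 239, 241, 251, 257, 263, 269, 271, 277, 281, 283,
    293, 307, 311, 313, 317, 331, 337, 347, 349, 353, 359, 367, 373, 379, 383, 389, 397, 401,
    409, 419, 421, 431, 433, 439, 443, 449, 457, 461, 463, 467, 479, 487, 491, 499, 503, 509,
    521, 523, 541, 547, 557, 563, 569, 571, 577, 587, 593, 599, 601, 607, 613, 617, 619, 631,
    641, 643, 647, 653, 659, 661, 673, 677, 683, 691, 701, 709, 719, 727]"

text \<open>The odd numbers from 3 to 729 in order, each with its smallest divisor above 1 and the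
cofactor, or as a trivial product if it is prime.\<close>

definition odd_factorizations :: "(nat \<times> nat) list" where
  "odd_factorizations = [
    (1, 3), (1, 5), (1, 7), (3, 3), (1, 11), (1, 13), (3, 5), (1, 17), (1, 19), (3, 7), (1, 23),
    (5, 5), (3, 9), (1, 29), (1, 31), (3, 11), (5, 7), (1, 37), (3, 13), (1, 41), (1, 43),
    (3, 15), (1, 47), (7, 7), (3, 17), (1, 53), (5, 11), (3, 19), (1, 59), (1, 61), (3, 21),
    (5, 13), (1, 67), (3, 23), (1, 71), (1, 73), (3, 25), (7, 11), (1, 79), (3, 27), (1, 83),
    (5, 17), (3, 29), (1, 89), (7, 13), (3, 31), (5, 19), (1, 97), (3, 33), (1, 101), (1, 103),
    (3, 35), (1, 107), (1, 109), (3, 37), (1, 113), (5, 23), (3, 39), (7, 17), (11, 11), (3, 41),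
    (5, 25), (1, 127), (3, 43), (1, 131), (7, 19), (3, 45), (1, 137), (1, 139), (3, 47),
    (11, 13), (5, 29), (3, 49), (1, 149), (1, 151), (3, 51), (5, 31), (1, 157), (3, 53), (7, 23),
    (1, 163), (3, 55), (1, 167), (13, 13), (3, 57), (1, 173), (5, 35), (3, 59), (1, 179),
    (1, 181), (3, 61), (5, 37), (11, 17), (3, 63), (1, 191), (1, 193), (3, 65), (1, 197),
    (1, 199), (3, 67), (7, 29), (5, 41), (3, 69), (11, 19), (1, 211), (3, 71), (5, 43), (7, 31),
    (3, 73), (13, 17), (1, 223), (3, 75), (1, 227), (1, 229), (3, 77), (1, 233), (5, 47),
    (3, 79), (1, 239), (1, 241), (3, 81), (5, 49), (13, 19), (3, 83), (1, 251), (11, 23),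
    (3, 85), (1, 257), (7, 37), (3, 87), (1, 263), (5, 53), (3, 89), (1, 269), (1, 271), (3, 91),
    (5, 55), (1, 277), (3, 93), (1, 281), (1, 283), (3, 95), (7, 41), (17, 17), (3, 97),
    (1, 293), (5, 59), (3, 99), (13, 23), (7, 43), (3, 101), (5, 61), (1, 307), (3, 103),
    (1, 311), (1, 313), (3, 105), (1, 317), (11, 29), (3, 107), (17, 19), (5, 65), (3, 109),
    (7, 47), (1, 331), (3, 111), (5, 67), (1, 337), (3, 113), (11, 31), (7, 49), (3, 115),
    (1, 347), (1, 349), (3, 117), (1, 353), (5, 71), (3, 119), (1, 359), (19, 19), (3, 121),
    (5, 73), (1, 367), (3, 123), (7, 53), (1, 373), (3, 125), (13, 29), (1, 379), (3, 127),
    (1, 383), (5, 77), (3, 129), (1, 389), (17, 23), (3, 131), (5, 79), (1, 397), (3, 133),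
    (1, 401), (13, 31), (3, 135), (11, 37), (1, 409), (3, 137), (7, 59), (5, 83), (3, 139),
    (1, 419), (1, 421), (3, 141), (5, 85), (7, 61), (3, 143), (1, 431), (1, 433), (3, 145),
    (19, 23), (1, 439), (3, 147), (1, 443), (5, 89), (3, 149), (1, 449), (11, 41), (3, 151),
    (5, 91), (1, 457), (3, 153), (1, 461), (1, 463), (3, 155), (1, 467), (7, 67), (3, 157),
    (11, 43), (5, 95), (3, 159), (1, 479), (13, 37), (3, 161), (5, 97), (1, 487), (3, 163),
    (1, 491), (17, 29), (3, 165), (7, 71), (1, 499), (3, 167), (1, 503), (5, 101), (3, 169),
    (1, 509), (7, 73), (3, 171), (5, 103), (11, 47), (3, 173), (1, 521), (1, 523), (3, 175),
    (17, 31), (23, 23), (3, 177), (13, 41), (5, 107), (3, 179), (7, 77), (1, 541), (3, 181),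
    (5, 109), (1, 547), (3, 183), (19, 29), (7, 79), (3, 185), (1, 557), (13, 43), (3, 187),
    (1, 563), (5, 113), (3, 189), (1, 569), (1, 571), (3, 191), (5, 115), (1, 577), (3, 193),
    (7, 83), (11, 53), (3, 195), (1, 587), (19, 31), (3, 197), (1, 593), (5, 119), (3, 199),
    (1, 599), (1, 601), (3, 201), (5, 121), (1, 607), (3, 203), (13, 47), (1, 613), (3, 205),
    (1, 617), (1, 619), (3, 207), (7, 89), (5, 125), (3, 209), (17, 37), (1, 631), (3, 211),
    (5, 127), (7, 91), (3, 213), (1, 641), (1, 643), (3, 215), (1, 647), (11, 59), (3, 217),
    (1, 653), (5, 131), (3, 219), (1, 659), (1, 661), (3, 221), (5, 133), (23, 29), (3, 223),
    (11, 61), (1, 673), (3, 225), (1, 677), (7, 97), (3, 227), (1, 683), (5, 137), (3, 229),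
    (13, 53), (1, 691), (3, 231), (5, 139), (17, 41), (3, 233), (1, 701), (19, 37), (3, 235),
    (7, 101), (1, 709), (3, 237), (23, 31), (5, 143), (3, 239), (1, 719), (7, 103), (3, 241),
    (5, 145), (1, 727), (3, 243)]"

primrec odd_products :: "nat \<Rightarrow> (nat \<times> nat) list \<Rightarrow> bool" where
  "odd_products n [] = True"
| "odd_products n (x # xs) = (n = fst x * snd x \<and> fst x \<le> snd x \<and> odd_products (n + 2) xs)"

primrec trivial_products :: "(nat \<times> nat) list \<Rightarrow> nat list" where
  "trivial_products [] = []"
| "trivial_products (x # xs) = choose2 (fst x = 1) [snd x] [] @ trivial_products xs"

lemma odd_products_factorizations: "odd_products 3 odd_factorizations"
  by (simp only: odd_factorizations_def odd_products.simps fst_conv snd_conv mult_1_left numeral_times_numeral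
    numeral_plus_numeral numeral_eq_iff numeral_le_iff one_le_numeral and_simps add_simps mult_simps
    eq_num_simps le_num_simps less_num_simps)

lemma trivial_products_factorizations: "trivial_products odd_factorizations = prime_list"
  by (simp only: odd_factorizations_def prime_list_def trivial_products.simps fst_conv snd_conv choose2.simps
    append.simps simp_thms(6) numeral_eq_one_iff eq_num_simps)

lemma odd_productsD:
  "odd_products n xs \<Longrightarrow> i < length xs \<Longrightarrow> n + 2 * i = fst (xs ! i) * snd (xs ! i) \<and> fst (xs ! i) \<le> snd (xs ! i)"
proof (induction xs arbitrary: n i)
  case (Cons x xs)
  show ?case
  proof (cases i)
    case (Suc j)
    then have "odd_products (n + 2) xs" "j < length xs" using Cons.prems by auto
    from Cons.IH[OF this] show ?thesis by (simp add: Suc)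
  qed (use Cons.prems in simp)
qed simp

lemma trivial_productsI: "(1, p) \<in> set xs \<Longrightarrow> p \<in> set (trivial_products xs)"
  by (induction xs) auto

text \<open>A prime number has only a trivial factorization, so its entry is one of those with first
component 1.\<close>

lemma odd_prime_in_list:
  assumes "prime p" "odd p" "p \<le> 729"
  shows "p \<in> set prime_list"
proof -
  have "3 \<le> p" using prime_ge_2_nat[OF assms(1)] assms(2) by (cases "p = 2") auto
  define i where "i = (p - 3) div 2"
  have p: "p = 3 + 2 * i" using \<open>3 \<le> p\<close> assms(2) unfolding i_def by presburger
  have i: "i < length odd_factorizations"
    using p assms(3) by (simp add: odd_factorizations_def)
  obtain a b where ab: "odd_factorizations ! i = (a, b)" by force
  have "p = a * b" "a \<le> b"
    using odd_productsD[OF odd_products_factorizations i] p by (simp_all add: ab)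
  moreover from this have "a = 1"
    using assms(1) prime_product[of a b] prime_gt_1_nat[OF assms(1)] by auto
  ultimately have "(1, p) \<in> set odd_factorizations" using nth_mem[OF i] ab by simp
  then show ?thesis
    using trivial_productsI trivial_products_factorizations by metis
qed

section \<open>Certificates\<close>

text \<open>For each prime there is a list of groups of cases. A group begins with the exponent of
the modulus, the number of rounds of \<open>factors\<close> and the bounds $N$ and $B_m$. It is
divided according to the largest exponent of $p$ among the odd numbers that occur (plus one), the
denominator of the point, the number of partial sums and the shift of the products from $N$ to the
last of these sums. The exponents and matrices result from a computation outside the logic; the
lemmas verify them by evaluation.\<close>

lemma prime_ok_3: "prime_ok (3, [((1, 5, 80, 39), [(5, 2, 41, 40, [(20, 40, 158, None)]), (5, 1, 80, 1, [(21, 37, 158, None), (25, 30, 158, None), (35, 10, 158, None), (39, 1, 159, None)])]),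
   ((6, 6, 243, 119), [(5, 1, 120, 124, [(30, 182, 495, Some (2, 3, [[611]])), (40, 162, 495, Some (3, 9, [[674, 700], [325, 674]])), (50, 139, 492, Some (2, 3, [[200, 313], [337, 200]])), (59, 124, 495, Some (2, 3, [[194, 511], [322, 194]]))]), (6, 1, 243, 1, [(60, 121, 493, Some (5, 81, [[162, 324, 405], [668, 405, 243], [223, 81, 81]])), (70, 99, 492, Some (5, 81, [[57, 625, 14], [378, 531, 36], [69, 650, 439]])), (79, 80, 490, Some (5, 81, [[210, 138, 504], [475, 559, 33], [667, 328, 105]])), (80, 79, 490, Some (5, 81, [[366, 649, 512, 487], [276, 44, 517, 314], [615, 188, 682, 722], [453, 613, 539, 421]])), (90, 60, 492, Some (4, 27, [[189, 90, 189, 36], [489, 15, 102, 693], [309, 78, 239, 558], [312, 388, 77, 639]])), (99, 41, 492, Some (4, 27, [[570, 24, 318, 285], [191, 187, 461, 553], [14, 472, 140, 442], [368, 64, 251, 142]])), (100, 36, 490, Some (4, 27, [[720, 396, 171, 243, 378], [459, 682, 164, 538, 639], [630, 50, 514, 374, 522], [495, 143, 490, 239, 63], [729, 331, 272, 685, 423]])), (110, 19, 492, Some (4, 27, [[81, 243, 540, 432, 540], [260, 418, 443, 327, 648], [22, 224, 76, 600, 702], [478, 455, 580, 330, 324], [41, 19, 98, 327, 216]])), (119, 1, 492, Some (6, 243, [[612, 225, 126, 162, 702], [491, 340, 533, 345, 102], [481, 608, 535, 162, 96], [193, 128, 727, 672, 87], [617, 229, 167, 126, 444]]))])])])"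
  by (simp only: check_simps)

lemma prime_ok_5: "prime_ok (5, [((1, 4, 145, 70), [(3, 2, 41, 105, [(20, 105, 149, None)]), (3, 1, 62, 84, [(21, 102, 149, None), (25, 95, 150, None), (30, 84, 149, None)]), (4, 1, 145, 1, [(35, 75, 150, None), (39, 66, 149, None), (40, 64, 149, None), (50, 41, 149, None), (70, 1, 148, None)])]),
   ((5, 5, 243, 119), [(4, 1, 243, 1, [(59, 124, 245, Some (2, 5, [[3061, 318], [182, 3061]])), (60, 121, 245, Some (2, 5, [[489, 1081, 1759], [2234, 2156, 2399], [2102, 2168, 1807]])), (79, 80, 244, Some (2, 5, [[1820, 591, 1669], [2623, 829, 2806], [227, 1425, 910]])), (80, 79, 245, Some (2, 5, [[1865, 1179, 2913, 2334], [253, 2912, 2495, 341], [2217, 46, 2176, 2782], [174, 913, 2524, 2915]])), (90, 60, 245, Some (3, 25, [[70, 145, 2240, 3075], [6, 1536, 1002, 1670], [390, 2690, 1980, 1600], [2571, 2701, 2057, 2095]])), (99, 41, 242, Some (5, 625, [[2840, 1405, 2125, 375], [259, 2353, 25, 975], [1999, 2533, 100, 975], [2568, 191, 375, 1025]])), (100, 36, 242, Some (3, 25, [[2375, 2900, 2250, 1700, 2575], [2150, 995, 2614, 1248, 1600], [340, 2280, 2195, 1866, 200], [2655, 2075, 358, 2217, 2675], [2020, 1895, 193, 2454, 2300]])), (110, 19, 244, Some (2, 5, [[2460, 2040, 160, 90, 1285], [2932, 2938, 2750, 1635, 75], [1927, 1306, 215, 2810, 1750], [2426, 1787, 2785, 1785,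 2850], [1895, 2824, 310, 1945, 1665]])), (119, 1, 241, Some (4, 125, [[2850, 275, 1375, 250, 1750], [2320, 485, 2400, 375, 1025], [788, 331, 430, 635, 2950], [443, 426, 1580, 395, 2250], [2674, 1278, 1705, 2275, 275]]))])])])"
  by (simp only: check_simps)

lemma prime_ok_7: "prime_ok (7, [((1, 4, 145, 70), [(3, 1, 145, 1, [(21, 102, 98, None), (30, 84, 98, None), (39, 66, 97, None), (40, 64, 96, None), (59, 26, 98, None), (70, 1, 97, None)])]),
   ((4, 4, 243, 119), [(3, 2, 41, 203, [(20, 203, 163, Some (2, 7, [[668]]))]), (3, 1, 165, 79, [(25, 193, 164, Some (2, 7, [[1856]])), (35, 173, 164, Some (2, 7, [[1662]])), (50, 139, 163, Some (3, 49, [[1045, 2258], [1240, 1045]])), (60, 121, 163, Some (2, 7, [[896, 686, 2086], [1319, 153, 238], [1159, 1239, 448]])), (79, 80, 162, Some (4, 343, [[2276, 441, 2092], [2237, 910, 1704], [1655, 1946, 1138]])), (80, 79, 163, Some (2, 7, [[1442, 595, 763, 1330], [1111, 1207, 1317, 546], [1419, 1442, 982, 777], [1342, 100, 1217, 1841]]))]), (4, 1, 243, 1, [(90, 60, 162, Some (2, 7, [[2135, 91, 1883, 322], [1499, 545, 1932, 2149], [2019, 473, 287, 1379], [10, 683, 588, 756]])), (99, 41, 163, Some (2, 7, [[714, 539, 455, 2044], [1156, 1041, 906, 2317], [943, 1866, 575, 707], [1971, 1091, 1944, 1316]])), (100, 36, 162, Some (3, 49, [[323, 1424, 178, 1142,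 1582], [1809, 65, 1136, 24, 1533], [1926, 2222, 2250, 1478, 1351], [13, 1313, 1950, 244, 1232], [1477, 77, 504, 1631, 2233]])), (110, 19, 163, Some (3, 49, [[2044, 532, 1519, 1652, 1225], [702, 1835, 945, 1556, 959], [1095, 1853, 693, 1480, 630], [90, 1361, 2149, 1574, 378], [1444, 988, 756, 639, 2086]])), (119, 1, 163, Some (2, 7, [[1854, 1196, 1382, 352, 1575], [2267, 1530, 686, 465, 1254], [73, 844, 1375, 284, 514], [270, 509, 49, 611, 1508], [991, 525, 1109, 1765, 1192]]))])])])"
  by (simp only: check_simps)

lemma prime_ok_11: "prime_ok (11, [((1, 3, 225, 110), [(2, 2, 41, 185, [(20, 185, 93, None)]), (2, 1, 51, 175, [(21, 182, 93, None), (25, 175, 94, None)]), (3, 1, 225, 1, [(30, 164, 93, None), (35, 155, 94, None), (40, 144, 94, None), (90, 42, 93, None), (110, 1, 92, None)])]),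
   ((3, 3, 243, 119), [(3, 1, 243, 1, [(39, 164, 104, Some (2, 11, [[489]])), (50, 139, 103, Some (2, 11, [[946, 209], [425, 946]])), (59, 124, 104, Some (2, 11, [[521, 525], [453, 521]])), (60, 121, 104, Some (2, 11, [[336, 1011, 555], [557, 490, 1206], [787, 551, 1136]])), (70, 99, 103, Some (2, 11, [[1273, 442, 748], [1049, 900, 121], [835, 506, 198]])), (79, 80, 103, Some (3, 121, [[1126, 1107, 912], [811, 860, 159], [461, 1285, 981]])), (80, 79, 103, Some (3, 121, [[685, 101, 18, 581], [1266, 1272, 1321, 1316], [1325, 337, 201, 1039], [1027, 222, 1076, 1029]])), (99, 41, 102, Some (2, 11, [[324, 253, 143, 1276], [454, 341, 1276, 77], [687, 385, 209, 671], [349, 1001, 330, 88]])), (100, 36, 102, Some (2, 11, [[1181, 954, 1288, 1136, 533], [66, 33, 121, 1012, 946], [893, 1236, 611, 1250, 239], [98, 1153, 1295, 937, 194], [557, 256, 648, 250, 1304]])), (119, 1, 102, Some (3, 121, [[924, 737, 495, 759, 1045], [312, 616, 692, 757, 627], [1216, 824, 894, 1002, 121], [930, 77, 983, 723, 154], [922, 642, 967, 304, 99]]))])])])"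
  by (simp only: check_simps)

lemma prime_ok_13: "prime_ok (13, [((1, 3, 225, 110), [(2, 2, 41, 185, [(20, 185, 80, None)]), (2, 1, 82, 144, [(25, 175, 79, None), (30, 164, 80, None), (35, 155, 80, None), (39, 146, 80, None), (40, 144, 80, None)]), (3, 1, 225, 1, [(50, 121, 79, None), (59, 106, 80, None), (110, 1, 80, None)])]),
   ((3, 3, 243, 119), [(2, 1, 44, 200, [(21, 200, 84, Some (2, 13, [[154]]))]), (3, 1, 243, 1, [(60, 121, 84, Some (2, 13, [[496, 1685, 146], [763, 2025, 1437], [1851, 1307, 248]])), (70, 99, 83, Some (2, 13, [[570, 729, 2054], [1860, 677, 650], [235, 882, 2002]])), (79, 80, 83, Some (2, 13, [[1441, 1228, 1418], [1572, 328, 1606], [678, 1125, 1819]])), (80, 79, 83, Some (2, 13, [[467, 48, 264, 914], [1650, 896, 1120, 452], [994, 1566, 807, 551], [515, 1128, 949, 275]])), (90, 60, 83, Some (3, 169, [[1794, 2145, 1742, 962], [1394, 1957, 1495, 845], [1620, 1544, 91, 1612], [561, 763, 624, 1482]])), (99, 41, 83, Some (2, 13, [[988, 1430, 1768, 598], [678, 447, 1066, 429], [736, 757, 1937, 1638], [575, 109, 611, 1053]])), (100, 36, 83, Some (2, 13, [[909, 2195, 1821, 290, 750], [1546, 1038, 352, 1096, 1569], [2191, 1561, 656, 1974, 67], [1289, 693, 986, 2085, 2101], [2155, 1957, 1758, 1585, 2120]])), (119, 1, 83, Some (2, 13, [[599, 1572, 1165, 207, 723], [2195, 1820, 1489, 50,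 41], [533, 809, 466, 240, 740], [333, 1456, 154, 528, 1591], [1427, 914, 1284, 863, 370]]))])])])"
  by (simp only: check_simps)

lemma prime_ok_17: "prime_ok (17, [((1, 3, 184, 90), [(2, 2, 41, 144, [(20, 144, 50, None)]), (2, 1, 123, 62, [(21, 141, 50, None), (25, 134, 50, None), (30, 123, 49, None), (35, 114, 50, None), (39, 105, 50, None), (40, 103, 50, None), (59, 65, 50, None), (60, 62, 50, None)]), (3, 1, 184, 1, [(90, 1, 50, None)])]),
   ((2, 3, 243, 119), [(2, 1, 105, 139, [(50, 139, 65, Some (2, 17, [[178, 116], [245, 178]]))]), (3, 1, 243, 1, [(79, 80, 65, Some (2, 17, [[256, 233, 189], [189, 111, 139], [233, 58, 111]])), (80, 79, 65, Some (2, 17, [[55, 87, 206, 97], [135, 2, 138, 127], [216, 286, 64, 186], [124, 247, 99, 199]])), (100, 36, 65, Some (2, 17, [[102, 170, 170, 17, 68], [265, 139, 246, 284, 17], [12, 46, 113, 138, 102], [226, 7, 203, 29, 51], [237, 13, 40, 132, 17]])), (110, 19, 66, Some (2, 17, [[18, 104, 215, 78, 104], [74, 46, 219, 281, 97], [119, 17, 51, 170, 136], [124, 95, 72, 169, 61], [283, 22, 206, 25, 73]])), (119, 1, 65, Some (2, 17, [[136, 221, 102, 51, 238], [38, 259, 136, 221, 136], [266, 141, 256, 170, 51], [141, 160, 102, 272, 51], [116, 35, 288, 204, 102]]))])]),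
   ((3, 3, 203, 99), [(3, 1, 203, 1, [(99, 1, 53, Some (3, 289, [[1536, 1155, 3762, 2970], [2393, 2681, 3680, 2576], [4061, 3763, 4152, 659], [2046, 2770, 753, 3140]]))])]),
   ((4, 3, 145, 70), [(3, 1, 145, 1, [(70, 1, 41, Some (4, 4913, [[24854, 16473, 3179], [107, 59806, 82076], [31964, 81872, 56355]]))])])])"
  by (simp only: check_simps)

lemma prime_ok_19: "prime_ok (19, [((1, 3, 243, 119), [(2, 2, 41, 203, [(20, 203, 58, None)]), (2, 1, 165, 79, [(21, 200, 58, None), (25, 193, 58, None), (35, 173, 57, None), (59, 124, 58, None), (60, 121, 58, None), (79, 80, 58, None), (80, 79, 58, None)]), (3, 1, 243, 1, [(90, 60, 57, None), (99, 41, 58, None), (100, 36, 58, None), (119, 1, 58, None)])]),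
   ((2, 3, 225, 110), [(2, 1, 145, 81, [(30, 164, 54, Some (2, 19, [[17]])), (39, 146, 54, Some (2, 19, [[126]])), (40, 144, 54, Some (2, 19, [[253, 216], [71, 253]])), (50, 121, 53, Some (2, 19, [[114, 76], [134, 114]])), (70, 81, 53, Some (2, 19, [[268, 29, 57], [357, 336, 361], [189, 208, 228]]))]), (3, 1, 225, 1, [(110, 1, 53, Some (2, 19, [[333, 236, 174, 280, 74], [323, 342, 114, 19, 38], [140, 302, 99, 63, 257], [313, 87, 282, 347, 287], [275, 220, 130, 119, 59]]))])])])"
  by (simp only: check_simps)

lemma prime_ok_23: "prime_ok (23, [((1, 3, 225, 110), [(2, 1, 225, 1, [(21, 182, 43, None), (30, 164, 44, None), (35, 155, 44, None), (39, 146, 44, None), (40, 144, 43, None), (50, 121, 44, None), (59, 106, 44, None), (60, 103, 44, None), (70, 81, 44, None), (80, 61, 44, None), (99, 23, 44, None), (110, 1, 43, None)])]),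
   ((2, 3, 243, 119), [(2, 2, 41, 203, [(20, 203, 47, Some (2, 23, [[102]]))]), (2, 1, 243, 1, [(25, 193, 48, Some (2, 23, [[525]])), (79, 80, 47, Some (2, 23, [[152, 357, 123], [154, 254, 442], [506, 238, 260]])), (90, 60, 47, Some (2, 23, [[226, 353, 422, 109], [413, 261, 241, 340], [46, 154, 116, 144], [110, 409, 344, 122]])), (100, 36, 47, Some (2, 23, [[299, 299, 230, 368, 414], [448, 506, 404, 24, 322], [30, 511, 69, 382, 23], [46, 163, 231, 179, 230], [98, 495, 197, 48, 184]])), (119, 1, 47, Some (2, 23, [[190, 61, 495, 256, 171], [454, 233, 327, 2, 104], [304, 339, 215, 385, 260], [132, 214, 468, 466, 70], [425, 222, 473, 441, 236]]))])])])"
  by (simp only: check_simps)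

lemma prime_ok_29: "prime_ok (29, [((1, 2, 225, 110), [(2, 2, 41, 185, [(20, 185, 36, None)]), (2, 1, 225, 1, [(21, 182, 35, None), (25, 175, 35, None), (30, 164, 36, None), (35, 155, 36, None), (39, 146, 36, None), (40, 144, 36, None), (50, 121, 35, None), (59, 106, 36, None), (60, 103, 36, None), (70, 81, 36, None), (79, 62, 35, None), (80, 61, 35, None), (90, 42, 36, None), (110, 1, 35, None)])]),
   ((2, 2, 243, 119), [(2, 1, 243, 1, [(99, 41, 40, Some (2, 29, [[652, 167, 301, 485], [214, 299, 628, 437], [332, 385, 265, 237], [279, 832, 677, 85]])), (100, 36, 39, Some (2, 29, [[225, 734, 500, 158, 347], [368, 232, 448, 362, 18], [650, 183, 587, 529, 255], [775, 597, 112, 795, 217], [780, 486, 708, 677, 644]])), (119, 1, 39, Some (2, 29, [[29, 725, 754, 754, 87], [423, 298, 615, 841, 261], [34, 785, 413, 725, 203], [327, 381, 657, 725, 464], [260, 247, 519, 464, 667]]))])])])"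
  by (simp only: check_simps)

lemma prime_ok_31: "prime_ok (31, [((1, 2, 243, 119), [(2, 2, 41, 203, [(20, 203, 36, None)]), (2, 1, 243, 1, [(21, 200, 36, None), (25, 193, 35, None), (30, 182, 35, None), (40, 162, 36, None), (50, 139, 36, None), (59, 124, 35, None), (70, 99, 36, None), (79, 80, 36, None), (80, 79, 36, None), (99, 41, 36, None), (110, 19, 36, None), (119, 1, 35, None)])]),
   ((2, 2, 208, 100), [(2, 1, 208, 1, [(35, 138, 32, Some (2, 31, [[400]])), (39, 129, 32, Some (2, 31, [[658]])), (60, 86, 31, Some (2, 31, [[769, 574, 260], [161, 914, 670], [606, 864, 865]])), (90, 25, 31, Some (2, 31, [[900, 20, 128, 799], [857, 648, 638, 418], [302, 398, 154, 521], [107, 528, 211, 150]])), (100, 1, 32, Some (2, 31, [[71, 831, 15, 79, 922], [51, 679, 364, 427, 368], [89, 478, 696, 237, 317], [316, 27, 785, 621, 129], [380, 191, 592, 828, 172]]))])])])"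
  by (simp only: check_simps)

lemma prime_ok_37: "prime_ok (37, [((1, 2, 243, 119), [(2, 2, 41, 203, [(20, 203, 32, None)]), (2, 1, 243, 1, [(21, 200, 32, None), (25, 193, 32, None), (30, 182, 31, None), (35, 173, 31, None), (39, 164, 32, None), (40, 162, 32, None), (50, 139, 32, None), (59, 124, 32, None), (60, 121, 32, None), (70, 99, 31, None), (79, 80, 32, None), (80, 79, 32, None), (90, 60, 32, None), (99, 41, 32, None), (119, 1, 32, None)])]),
   ((2, 2, 225, 110), [(2, 1, 225, 1, [(110, 1, 29, Some (2, 37, [[994, 1107, 591, 29, 623], [482, 1222, 701, 1289, 927], [597, 776, 1012, 653, 213], [253, 976, 695, 813, 639], [850, 1255, 578, 649, 1247]]))])]),
   ((3, 2, 208, 100), [(2, 1, 208, 1, [(100, 1, 27, Some (3, 1369, [[25987, 16762, 15614, 37185, 49136], [42943, 20329, 47212, 40515, 23643], [19759, 40609, 16576, 1702, 34003], [23854, 30046, 49025, 49728, 31191], [22906, 9976, 3182, 2368, 18500]]))])])])"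
  by (simp only: check_simps)

lemma prime_ok_41: "prime_ok (41, [((1, 2, 225, 110), [(2, 2, 41, 185, [(20, 185, 28, None)]), (2, 1, 225, 1, [(21, 182, 28, None), (25, 175, 28, None), (30, 164, 27, None), (35, 155, 27, None), (39, 146, 27, None), (50, 121, 28, None), (59, 106, 28, None), (60, 103, 28, None), (79, 62, 27, None), (90, 42, 28, None), (99, 23, 28, Some (1, 1, [[29, 17, 24, 6], [37, 24, 7, 24], [12, 20, 13, 1], [33, 14, 9, 41]])), (110, 1, 28, None)])]),
   ((2, 2, 243, 119), [(2, 1, 243, 1, [(40, 162, 27, Some (2, 41, [[792, 1093], [1666, 792]])), (70, 99, 27, Some (2, 41, [[946, 486, 369], [780, 1564, 1353], [450, 445, 123]])), (80, 79, 27, Some (2, 41, [[136, 615, 277, 1083], [277, 254, 428, 90], [1629, 1271, 942, 1080], [696, 1403, 1076, 1403]])), (100, 36, 27, Some (2, 41, [[1343, 1250, 775, 1041, 492], [550, 337, 1207, 690, 246], [458, 220, 1060, 1307, 1353], [1117, 905, 970, 1239, 1066], [407, 887, 1674, 444, 861]])), (119, 1, 27, Some (2, 41, [[210, 832, 1140, 70, 666], [1417, 621, 570, 732, 5], [202, 698, 792, 1188, 1511], [272, 1522, 844, 1553, 1487], [30, 113, 1223, 10, 429]]))])])])"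
  by (simp only: check_simps)

lemma prime_ok_43: "prime_ok (43, [((1, 2, 243, 119), [(2, 2, 41, 203, [(20, 203, 28, None)]), (2, 1, 243, 1, [(25, 193, 28, None), (30, 182, 28, None), (35, 173, 27, None), (39, 164, 27, None), (40, 162, 27, None), (50, 139, 28, None), (59, 124, 28, None), (60, 121, 28, None), (70, 99, 28, None), (79, 80, 27, None), (80, 79, 27, None), (90, 60, 28, None), (99, 41, 28, None), (110, 19, 28, None), (119, 1, 27, None)])]),
   ((2, 2, 208, 100), [(2, 1, 208, 1, [(21, 165, 24, Some (2, 43, [[148]])), (100, 1, 24, Some (2, 43, [[982, 1537, 182, 480, 349], [408, 205, 615, 1570, 1060], [1364, 319, 1344, 270, 457], [313, 326, 1451, 633, 1005], [1759, 694, 835, 993, 826]]))])])])"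
  by (simp only: check_simps)

lemma prime_ok_47: "prime_ok (47, [((1, 2, 243, 119), [(2, 2, 41, 203, [(20, 203, 26, None)]), (2, 1, 243, 1, [(21, 200, 26, None), (25, 193, 26, None), (30, 182, 26, None), (35, 173, 25, None), (39, 164, 25, None), (40, 162, 25, Some (1, 1, [[47, 20], [3, 47]])), (50, 139, 26, None), (59, 124, 26, None), (60, 121, 26, None), (70, 99, 26, None), (79, 80, 26, None), (90, 60, 25, None), (99, 41, 26, None), (100, 36, 26, None), (110, 19, 26, None), (119, 1, 26, None)])]),
   ((2, 2, 165, 80), [(2, 1, 165, 1, [(80, 1, 19, Some (2, 47, [[282, 282, 282, 658], [1339, 413, 1023, 235], [924, 1203, 1593, 2209], [749, 211, 690, 47]]))])])])"
  by (simp only: check_simps)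

lemma prime_ok_53: "prime_ok (53, [((1, 2, 243, 119), [(2, 2, 41, 203, [(20, 203, 24, None)]), (2, 1, 243, 1, [(21, 200, 24, None), (25, 193, 24, None), (30, 182, 24, None), (35, 173, 24, None), (39, 164, 23, None), (40, 162, 23, None), (50, 139, 23, None), (59, 124, 24, None), (60, 121, 24, None), (70, 99, 24, None), (79, 80, 24, None), (80, 79, 24, None), (90, 60, 24, None), (99, 41, 23, None), (100, 36, 23, Some (1, 1, [[20, 24, 12, 31, 35], [47, 10, 5, 6, 10], [38, 43, 50, 3, 33], [19, 15, 27, 45, 7], [11, 11, 35, 6, 8]])), (110, 19, 24, None), (119, 1, 24, None)])])])"
  by (simp only: check_simps)

lemma prime_ok_59: "prime_ok (59, [((1, 2, 243, 119), [(2, 2, 41, 203, [(20, 203, 22, None)]), (2, 1, 243, 1, [(21, 200, 22, None), (25, 193, 22, None), (30, 182, 22, None), (35, 173, 22, None), (39, 164, 22, None), (40, 162, 22, None), (50, 139, 21, None), (59, 124, 22, None), (60, 121, 22, None), (70, 99, 22, None), (79, 80, 22, None), (80, 79, 22, None), (90, 60, 22, None), (99, 41, 22, None), (110, 19, 21, None), (119, 1, 22, None)])]),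
   ((2, 2, 208, 100), [(2, 1, 208, 1, [(100, 1, 19, Some (2, 59, [[3099, 2923, 1321, 2118, 1003], [1595, 2257, 1955, 196, 1947], [576, 1445, 1306, 2423, 1475], [1631, 1780, 3148, 3073, 1770], [1008, 2338, 3467, 2798, 590]]))])])])"
  by (simp only: check_simps)

lemma prime_ok_61: "prime_ok (61, [((1, 2, 208, 100), [(2, 2, 41, 168, [(20, 168, 18, None)]), (2, 1, 208, 1, [(21, 165, 18, None), (25, 158, 18, None), (30, 147, 18, None), (35, 138, 18, None), (39, 129, 18, None), (40, 127, 18, None), (50, 104, 17, None), (59, 89, 17, None), (70, 64, 18, None), (79, 45, 18, None), (80, 44, 18, None), (99, 6, 18, None), (100, 1, 18, None)])]),
   ((2, 2, 243, 119), [(2, 1, 243, 1, [(60, 121, 19, Some (2, 61, [[289, 1663, 1027], [3496, 1375, 3379], [697, 236, 2005]])), (90, 60, 19, Some (2, 61, [[2562, 3233, 1891, 1708], [75, 945, 3003, 2989], [80, 446, 1099, 2196], [677, 2249, 3392, 427]])), (110, 19, 19, Some (2, 61, [[344, 3544, 2759, 2374, 939], [1064, 1318, 249, 2765, 2710], [2934, 1662, 2780, 2763, 2866], [2340, 970, 1633, 1652, 1745], [2232, 212, 271, 47, 2495]])), (119, 1, 19, Some (2, 61, [[1447, 2765, 3292, 3353, 327], [3339, 2846, 2767, 568, 2821], [1979, 307, 3523, 1370, 3476], [702, 3488, 3706, 907, 460], [3537, 3346, 1753, 50, 1049]]))])])])"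
  by (simp only: check_simps)

lemma prime_ok_67: "prime_ok (67, [((1, 2, 243, 119), [(2, 2, 41, 203, [(20, 203, 20, None)]), (2, 1, 243, 1, [(21, 200, 20, None), (25, 193, 20, None), (30, 182, 20, None), (35, 173, 20, None), (39, 164, 20, None), (40, 162, 20, None), (50, 139, 19, None), (59, 124, 19, None), (60, 121, 19, None), (70, 99, 20, None), (79, 80, 20, None), (80, 79, 20, None), (90, 60, 20, None), (100, 36, 20, None), (110, 19, 20, Some (1, 1, [[53, 52, 48, 39, 10], [4, 36, 28, 47, 47], [33, 9, 22, 42, 53], [19, 42, 39, 32, 1], [54, 2, 39, 66, 5]])), (119, 1, 19, Some (1, 1, [[14, 22, 4, 15, 67], [25, 38, 3, 9, 28], [24, 22, 3, 36, 3], [23, 65, 56, 1, 56], [12, 7, 65, 37, 62]]))])]),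
   ((2, 2, 203, 99), [(2, 1, 203, 1, [(99, 1, 17, Some (2, 67, [[237, 17, 3778, 1381], [1725, 3374, 2654, 2170], [3027, 3649, 502, 1776], [1510, 1000, 2178, 2646]]))])])])"
  by (simp only: check_simps)

lemma prime_ok_71: "prime_ok (71, [((1, 2, 243, 119), [(2, 2, 41, 203, [(20, 203, 18, None)]), (2, 1, 243, 1, [(21, 200, 18, None), (25, 193, 18, None), (30, 182, 18, None), (35, 173, 18, None), (39, 164, 18, None), (40, 162, 18, None), (50, 139, 18, None), (59, 124, 17, None), (60, 121, 17, None), (79, 80, 18, None), (80, 79, 18, None), (90, 60, 18, None), (99, 41, 18, None), (100, 36, 18, None), (110, 19, 18, None), (119, 1, 18, None)])]),
   ((2, 2, 145, 70), [(2, 1, 145, 1, [(70, 1, 13, Some (2, 71, [[1372, 402, 973], [2498, 2386, 3937], [1502, 850, 3586]]))])])])"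
  by (simp only: check_simps)

lemma prime_ok_73: "prime_ok (73, [((1, 2, 243, 119), [(2, 2, 41, 203, [(20, 203, 18, None)]), (2, 1, 243, 1, [(21, 200, 18, None), (30, 182, 18, None), (35, 173, 18, None), (39, 164, 18, None), (40, 162, 18, None), (50, 139, 18, None), (59, 124, 17, None), (60, 121, 17, None), (70, 99, 17, None), (79, 80, 18, None), (80, 79, 18, None), (90, 60, 18, None), (99, 41, 18, None), (100, 36, 18, None), (110, 19, 18, None), (119, 1, 18, None)])]),
   ((2, 2, 51, 25), [(2, 1, 51, 1, [(25, 1, 8, Some (2, 73, [[4889]]))])])])"
  by (simp only: check_simps)

lemma prime_ok_79: "prime_ok (79, [((1, 2, 243, 119), [(2, 2, 41, 203, [(20, 203, 18, None)]), (2, 1, 243, 1, [(21, 200, 18, None), (25, 193, 18, None), (30, 182, 18, None), (35, 173, 18, None), (40, 162, 18, None), (50, 139, 18, None), (59, 124, 17, None), (60, 121, 17, None), (70, 99, 17, None), (79, 80, 18, None), (80, 79, 18, None), (90, 60, 18, None), (99, 41, 18, None), (100, 36, 18, None), (110, 19, 18, None), (119, 1, 18, None)])]),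
   ((2, 2, 80, 39), [(2, 1, 80, 1, [(39, 1, 10, Some (2, 79, [[2048]]))])])])"
  by (simp only: check_simps)

lemma prime_ok_83: "prime_ok (83, [((1, 2, 243, 119), [(1, 2, 41, 203, [(20, 203, 16, None)]), (2, 1, 243, 1, [(21, 200, 16, None), (25, 193, 16, None), (30, 182, 16, None), (35, 173, 16, None), (39, 164, 16, None), (40, 162, 16, None), (50, 139, 16, None), (59, 124, 16, None), (60, 121, 16, None), (70, 99, 15, None), (79, 80, 15, None), (90, 60, 16, None), (99, 41, 16, None), (100, 36, 16, None), (110, 19, 16, None), (119, 1, 16, Some (1, 1, [[78, 11, 2, 75, 48], [24, 63, 59, 10, 72], [50, 28, 76, 64, 52], [38, 27, 18, 14, 10], [73, 36, 77, 25, 24]]))])]),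
   ((2, 2, 165, 80), [(2, 1, 165, 1, [(80, 1, 11, Some (2, 83, [[256, 2805, 4191, 3548], [6240, 1007, 4558, 4022], [1830, 1342, 889, 4719], [2568, 3178, 1773, 2339]]))])])])"
  by (simp only: check_simps)

lemma prime_ok_89: "prime_ok (89, [((1, 2, 243, 119), [(1, 2, 41, 203, [(20, 203, 16, None)]), (1, 1, 44, 200, [(21, 200, 16, None)]), (2, 1, 243, 1, [(30, 182, 16, None), (35, 173, 16, None), (39, 164, 16, None), (40, 162, 16, None), (50, 139, 16, None), (59, 124, 16, None), (60, 121, 16, None), (70, 99, 15, None), (79, 80, 15, None), (80, 79, 15, None), (90, 60, 16, None), (99, 41, 16, None), (100, 36, 16, None), (110, 19, 16, None), (119, 1, 16, None)])]),
   ((2, 2, 51, 25), [(2, 1, 51, 1, [(25, 1, 8, Some (2, 89, [[458]]))])])])"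
  by (simp only: check_simps)

lemma prime_ok_97: "prime_ok (97, [((1, 2, 243, 119), [(1, 2, 41, 203, [(20, 203, 16, None)]), (1, 1, 44, 200, [(21, 200, 16, None)]), (2, 1, 243, 1, [(25, 193, 16, None), (30, 182, 16, None), (35, 173, 16, None), (39, 164, 16, None), (40, 162, 16, None), (50, 139, 16, None), (59, 124, 16, None), (60, 121, 16, None), (70, 99, 16, None), (79, 80, 15, None), (80, 79, 15, None), (90, 60, 15, None), (99, 41, 16, None), (100, 36, 16, Some (1, 1, [[88, 51, 35, 26, 11], [27, 59, 75, 59, 94], [27, 9, 36, 87, 80], [19, 36, 24, 93, 80], [68, 73, 13, 28, 17]])), (110, 19, 16, None), (119, 1, 16, None)])])])"
  by (simp only: check_simps)

lemma prime_ok_101: "prime_ok (101, [((1, 2, 243, 119), [(1, 2, 41, 203, [(20, 203, 14, None)]), (1, 1, 44, 200, [(21, 200, 14, None)]), (2, 1, 243, 1, [(25, 193, 14, None), (30, 182, 14, None), (39, 164, 14, None), (40, 162, 14, None), (50, 139, 14, None), (59, 124, 14, None), (60, 121, 14, None), (70, 99, 14, None), (79, 80, 13, None), (80, 79, 13, None), (90, 60, 13, None), (110, 19, 14, None), (119, 1, 14, None)])]),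
   ((2, 2, 208, 100), [(2, 1, 208, 1, [(35, 138, 14, Some (2, 101, [[8290]])), (99, 6, 13, Some (2, 101, [[1010, 8542, 1569, 1598], [4003, 9085, 6751, 5408], [3232, 2596, 3521, 6233], [1461, 2444, 3902, 487]])), (100, 1, 13, Some (2, 101, [[3496, 954, 3612, 5254, 2785], [9568, 5343, 811, 388, 2242], [3310, 9167, 4042, 9940, 1324], [1306, 3111, 3435, 9672, 934], [2363, 7481, 3756, 8562, 6773]]))])])])"
  by (simp only: check_simps)

lemma prime_ok_103: "prime_ok (103, [((1, 2, 243, 119), [(1, 2, 41, 203, [(20, 203, 14, None)]), (1, 1, 51, 193, [(21, 200, 14, None), (25, 193, 14, None)]), (2, 1, 243, 1, [(30, 182, 14, None), (35, 173, 14, None), (39, 164, 14, None), (40, 162, 14, None), (59, 124, 14, None), (60, 121, 14, None), (70, 99, 14, None), (79, 80, 13, None), (80, 79, 13, None), (90, 60, 13, None), (99, 41, 13, None), (110, 19, 14, None), (119, 1, 14, None)])]),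
   ((2, 2, 208, 100), [(2, 1, 208, 1, [(100, 1, 13, Some (2, 103, [[9704, 779, 3404, 7167, 10345], [7201, 4813, 9, 7791, 2313], [2838, 6742, 3428, 7277, 8558], [8482, 5159, 273, 3032, 3829], [6012, 5167, 10207, 8145, 5836]]))])]),
   ((3, 2, 105, 50), [(2, 1, 105, 1, [(50, 1, 9, Some (3, 10609, [[871890, 206211], [118764, 871890]]))])])])"
  by (simp only: check_simps)

lemma prime_ok_107: "prime_ok (107, [((1, 2, 243, 119), [(1, 2, 41, 203, [(20, 203, 14, None)]), (1, 1, 51, 193, [(21, 200, 14, None), (25, 193, 14, None)]), (2, 1, 243, 1, [(30, 182, 14, None), (35, 173, 14, None), (39, 164, 14, None), (40, 162, 14, None), (50, 139, 14, None), (59, 124, 14, None), (60, 121, 14, None), (70, 99, 14, None), (79, 80, 13, None), (80, 79, 13, None), (90, 60, 13, None), (99, 41, 13, None), (100, 36, 13, None), (110, 19, 14, None), (119, 1, 14, None)])])])"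
  by (simp only: check_simps)

lemma prime_ok_109: "prime_ok (109, [((1, 2, 243, 119), [(1, 2, 41, 203, [(20, 203, 14, None)]), (1, 1, 51, 193, [(21, 200, 14, None), (25, 193, 14, None)]), (2, 1, 243, 1, [(30, 182, 14, None), (35, 173, 14, None), (39, 164, 14, None), (40, 162, 14, None), (50, 139, 14, None), (59, 124, 14, None), (60, 121, 14, None), (70, 99, 14, None), (90, 60, 13, None), (99, 41, 13, None), (100, 36, 13, None), (110, 19, 14, None), (119, 1, 14, None)])]),
   ((2, 2, 165, 80), [(2, 1, 165, 1, [(79, 2, 11, Some (2, 109, [[218, 2071, 4142], [10545, 10429, 1962], [1445, 4251, 109]])), (80, 1, 11, Some (2, 109, [[8175, 8502, 8938, 2943], [931, 106, 7739, 7412], [6107, 1917, 9592, 6104], [5061, 5498, 7957, 7303]]))])])])"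
  by (simp only: check_simps)

lemma prime_ok_113: "prime_ok (113, [((1, 2, 243, 119), [(1, 2, 41, 203, [(20, 203, 14, None)]), (1, 1, 51, 193, [(21, 200, 14, None), (25, 193, 14, None)]), (2, 1, 243, 1, [(30, 182, 14, None), (35, 173, 14, None), (39, 164, 14, None), (40, 162, 14, None), (50, 139, 14, None), (59, 124, 14, None), (60, 121, 14, None), (70, 99, 14, None), (79, 80, 14, None), (80, 79, 14, None), (90, 60, 13, None), (99, 41, 13, None), (100, 36, 13, None), (119, 1, 14, None)])]),
   ((2, 2, 225, 110), [(2, 1, 225, 1, [(110, 1, 11, Some (2, 113, [[8209, 2874, 4498, 4313, 9612], [10342, 12051, 7037, 11749, 12750], [8889, 901, 3368, 8325, 12282], [8595, 12161, 9131, 3675, 1054], [2346, 9312, 5840, 7491, 3991]]))])])])"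
  by (simp only: check_simps)

lemma prime_ok_127: "prime_ok (127, [((1, 2, 243, 119), [(1, 2, 41, 203, [(20, 203, 12, None)]), (1, 1, 62, 182, [(21, 200, 12, None), (25, 193, 12, None), (30, 182, 12, None)]), (2, 1, 243, 1, [(35, 173, 12, None), (39, 164, 12, None), (40, 162, 12, None), (50, 139, 12, None), (59, 124, 12, None), (60, 121, 12, None), (70, 99, 12, None), (79, 80, 12, None), (80, 79, 12, None), (90, 60, 12, None), (99, 41, 11, None), (100, 36, 11, None), (110, 19, 11, None), (119, 1, 11, None)])])])"
  by (simp only: check_simps)

lemma prime_ok_131: "prime_ok (131, [((1, 2, 243, 119), [(1, 1, 62, 182, [(21, 200, 12, None), (25, 193, 12, None), (30, 182, 12, None)]), (2, 1, 243, 1, [(35, 173, 12, None), (39, 164, 12, None), (40, 162, 12, None), (50, 139, 12, None), (59, 124, 12, None), (60, 121, 12, None), (70, 99, 12, None), (79, 80, 12, None), (80, 79, 12, None), (90, 60, 12, None), (99, 41, 11, None), (100, 36, 11, None), (110, 19, 11, None), (119, 1, 11, None)])])])"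
  by (simp only: check_simps)

lemma prime_ok_137: "prime_ok (137, [((1, 2, 243, 119), [(1, 1, 62, 182, [(25, 193, 12, None), (30, 182, 12, None)]), (2, 1, 243, 1, [(35, 173, 12, None), (39, 164, 12, None), (40, 162, 12, None), (50, 139, 12, None), (59, 124, 12, None), (60, 121, 12, None), (70, 99, 12, None), (79, 80, 12, None), (80, 79, 12, None), (90, 60, 12, None), (99, 41, 12, None), (110, 19, 11, None), (119, 1, 11, None)])]),
   ((2, 2, 208, 100), [(2, 1, 208, 1, [(100, 1, 11, Some (2, 137, [[7413, 18001, 18429, 13545, 13015], [14663, 11843, 4663, 2751, 18084], [4974, 12588, 8733, 745, 2466], [3548, 7936, 956, 10437, 15344], [13964, 6096, 17187, 13612, 274]]))])])])"
  by (simp only: check_simps)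

lemma prime_ok_139: "prime_ok (139, [((1, 2, 243, 119), [(1, 1, 62, 182, [(25, 193, 12, None), (30, 182, 12, None)]), (2, 1, 243, 1, [(35, 173, 12, None), (39, 164, 12, None), (40, 162, 12, None), (50, 139, 12, None), (59, 124, 12, None), (60, 121, 12, None), (70, 99, 12, None), (79, 80, 12, None), (80, 79, 12, None), (90, 60, 12, None), (99, 41, 12, None), (100, 36, 12, None), (110, 19, 11, None), (119, 1, 11, None)])])])"
  by (simp only: check_simps)

lemma prime_ok_149: "prime_ok (149, [((1, 2, 243, 119), [(1, 1, 71, 173, [(25, 193, 12, None), (30, 182, 12, None), (35, 173, 12, None)]), (2, 1, 243, 1, [(39, 164, 12, None), (40, 162, 12, None), (50, 139, 12, None), (59, 124, 12, None), (60, 121, 12, None), (79, 80, 12, None), (80, 79, 12, None), (90, 60, 12, None), (99, 41, 12, None), (100, 36, 12, None), (119, 1, 11, None)])]),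
   ((2, 2, 225, 110), [(2, 1, 225, 1, [(70, 81, 12, Some (2, 149, [[2942, 7654, 21391], [9690, 13987, 15979], [3430, 14531, 20375]])), (110, 1, 11, Some (2, 149, [[20413, 18476, 18476, 11771, 10430], [18301, 4495, 7275, 4172, 16539], [9474, 2663, 16806, 2980, 10281], [10051, 16039, 8601, 6258, 18327], [4192, 10775, 2035, 7301, 11026]]))])])])"
  by (simp only: check_simps)

lemma prime_ok_151: "prime_ok (151, [((1, 2, 243, 119), [(1, 1, 71, 173, [(25, 193, 12, None), (30, 182, 12, None), (35, 173, 12, None)]), (2, 1, 243, 1, [(39, 164, 12, None), (40, 162, 12, None), (50, 139, 12, None), (59, 124, 12, None), (60, 121, 12, None), (70, 99, 12, None), (79, 80, 12, None), (80, 79, 12, None), (90, 60, 12, None), (99, 41, 12, None), (100, 36, 12, None), (110, 19, 12, None), (119, 1, 11, None)])])])"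
  by (simp only: check_simps)

lemma prime_ok_157: "prime_ok (157, [((1, 2, 243, 119), [(1, 1, 71, 173, [(25, 193, 12, None), (30, 182, 12, None), (35, 173, 12, None)]), (2, 1, 243, 1, [(39, 164, 12, None), (40, 162, 12, None), (50, 139, 12, None), (59, 124, 12, None), (60, 121, 12, None), (70, 99, 12, None), (79, 80, 12, None), (80, 79, 12, None), (90, 60, 12, None), (99, 41, 12, None), (100, 36, 12, None), (110, 19, 12, None), (119, 1, 11, None)])])])"
  by (simp only: check_simps)

lemma prime_ok_163: "prime_ok (163, [((1, 2, 243, 119), [(1, 1, 80, 164, [(30, 182, 12, None), (35, 173, 12, None), (39, 164, 12, None)]), (2, 1, 243, 1, [(50, 139, 12, None), (59, 124, 12, None), (60, 121, 12, None), (70, 99, 12, None), (90, 60, 12, None), (99, 41, 12, None), (100, 36, 12, None), (110, 19, 12, None), (119, 1, 12, None)])]),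
   ((2, 2, 165, 80), [(2, 1, 165, 1, [(79, 2, 9, Some (2, 163, [[24450, 13855, 19886], [5639, 6050, 1630], [18029, 17539, 12225]])), (80, 1, 9, Some (2, 163, [[25656, 15031, 18077, 2787], [17400, 6831, 10471, 22292], [23960, 11033, 13544, 6994], [22145, 17635, 21641, 15360]]))])]),
   ((3, 2, 82, 40), [(2, 1, 82, 1, [(40, 1, 8, Some (3, 26569, [[3958781, 4011919], [2883283, 3958781]]))])])])"
  by (simp only: check_simps)

lemma prime_ok_167: "prime_ok (167, [((1, 2, 243, 119), [(1, 1, 82, 162, [(30, 182, 10, None), (35, 173, 10, None), (39, 164, 10, None), (40, 162, 10, None)]), (2, 1, 243, 1, [(50, 139, 10, None), (59, 124, 10, None), (60, 121, 10, None), (70, 99, 10, None), (79, 80, 10, None), (80, 79, 10, None), (90, 60, 10, None), (99, 41, 10, None), (100, 36, 10, None), (110, 19, 10, None), (119, 1, 10, None)])])])"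
  by (simp only: check_simps)

lemma prime_ok_173: "prime_ok (173, [((1, 2, 243, 119), [(1, 1, 82, 162, [(30, 182, 10, None), (35, 173, 10, None), (39, 164, 10, None), (40, 162, 10, None)]), (2, 1, 243, 1, [(50, 139, 10, None), (59, 124, 10, None), (60, 121, 10, None), (70, 99, 10, None), (79, 80, 10, None), (80, 79, 10, None), (90, 60, 10, None), (99, 41, 10, None), (100, 36, 10, None), (110, 19, 10, None), (119, 1, 10, None)])])])"
  by (simp only: check_simps)

lemma prime_ok_179: "prime_ok (179, [((1, 2, 243, 119), [(1, 1, 82, 162, [(30, 182, 10, None), (35, 173, 10, None), (39, 164, 10, None), (40, 162, 10, None)]), (2, 1, 243, 1, [(50, 139, 10, None), (59, 124, 10, None), (60, 121, 10, None), (70, 99, 10, None), (79, 80, 10, None), (80, 79, 10, None), (90, 60, 10, None), (99, 41, 10, None), (100, 36, 10, None), (110, 19, 10, None), (119, 1, 10, None)])])])"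
  by (simp only: check_simps)

lemma prime_ok_181: "prime_ok (181, [((1, 2, 243, 119), [(1, 1, 82, 162, [(30, 182, 10, None), (35, 173, 10, None), (39, 164, 10, None), (40, 162, 10, None)]), (2, 1, 243, 1, [(50, 139, 10, None), (59, 124, 10, None), (60, 121, 10, None), (70, 99, 10, None), (79, 80, 10, None), (80, 79, 10, None), (90, 60, 10, None), (99, 41, 10, None), (100, 36, 10, None), (110, 19, 10, None), (119, 1, 10, None)])])])"
  by (simp only: check_simps)

lemma prime_ok_191: "prime_ok (191, [((1, 2, 243, 119), [(1, 1, 82, 162, [(35, 173, 10, None), (39, 164, 10, None), (40, 162, 10, None)]), (2, 1, 243, 1, [(50, 139, 10, None), (59, 124, 10, None), (60, 121, 10, None), (70, 99, 10, None), (79, 80, 10, None), (80, 79, 10, None), (90, 60, 10, None), (99, 41, 10, None), (100, 36, 10, None), (110, 19, 10, None), (119, 1, 10, None)])])])"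
  by (simp only: check_simps)

lemma prime_ok_193: "prime_ok (193, [((1, 2, 243, 119), [(1, 1, 82, 162, [(35, 173, 10, None), (39, 164, 10, None), (40, 162, 10, None)]), (2, 1, 243, 1, [(50, 139, 10, None), (59, 124, 10, Some (1, 1, [[193, 16], [17, 193]])), (60, 121, 10, None), (70, 99, 10, None), (80, 79, 10, None), (90, 60, 10, None), (99, 41, 10, None), (100, 36, 10, None), (110, 19, 10, None), (119, 1, 10, None)])]),
   ((2, 2, 164, 79), [(2, 1, 164, 1, [(79, 1, 8, Some (2, 193, [[23627, 17014, 36894], [23117, 23237, 23825], [20293, 21705, 30438]]))])])])"
  by (simp only: check_simps)

lemma prime_ok_197: "prime_ok (197, [((1, 2, 243, 119), [(1, 1, 82, 162, [(35, 173, 10, None), (39, 164, 10, None), (40, 162, 10, None)]), (2, 1, 243, 1, [(50, 139, 10, None), (59, 124, 10, None), (60, 121, 10, None), (70, 99, 10, None), (79, 80, 10, None), (80, 79, 10, None), (90, 60, 10, None), (99, 41, 10, None), (100, 36, 10, None), (110, 19, 10, None), (119, 1, 10, None)])])])"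
  by (simp only: check_simps)

lemma prime_ok_199: "prime_ok (199, [((1, 2, 243, 119), [(1, 1, 82, 162, [(35, 173, 10, None), (39, 164, 10, None), (40, 162, 10, None)]), (2, 1, 243, 1, [(50, 139, 10, None), (59, 124, 10, None), (60, 121, 10, None), (70, 99, 10, None), (79, 80, 10, None), (80, 79, 10, None), (90, 60, 10, None), (99, 41, 10, None), (100, 36, 10, None), (110, 19, 10, None), (119, 1, 10, None)])])])"
  by (simp only: check_simps)

lemma prime_ok_211: "prime_ok (211, [((1, 2, 243, 119), [(1, 1, 105, 139, [(35, 173, 10, None), (39, 164, 10, None), (40, 162, 10, None), (50, 139, 10, None)]), (2, 1, 243, 1, [(59, 124, 10, None), (60, 121, 10, None), (70, 99, 10, None), (79, 80, 10, None), (80, 79, 10, None), (90, 60, 10, None), (99, 41, 10, None), (100, 36, 10, None), (110, 19, 10, None), (119, 1, 10, None)])])])"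
  by (simp only: check_simps)

lemma prime_ok_223: "prime_ok (223, [((1, 2, 243, 119), [(1, 1, 105, 139, [(39, 164, 10, None), (40, 162, 10, None), (50, 139, 10, None)]), (2, 1, 243, 1, [(59, 124, 10, None), (60, 121, 10, None), (70, 99, 10, None), (79, 80, 10, None), (80, 79, 10, None), (90, 60, 10, None), (99, 41, 10, None), (100, 36, 10, None), (119, 1, 10, None)])]),
   ((2, 2, 225, 110), [(2, 1, 225, 1, [(110, 1, 9, Some (2, 223, [[13519, 48915, 39168, 18968, 10691], [3212, 11906, 43469, 39594, 47599], [559, 27233, 2224, 41038, 5569], [23245, 18060, 28129, 23158, 20773], [25027, 7170, 8545, 20408, 44485]]))])])])"
  by (simp only: check_simps)

lemma prime_ok_227: "prime_ok (227, [((1, 2, 243, 119), [(1, 1, 105, 139, [(39, 164, 10, None), (40, 162, 10, None), (50, 139, 10, None)]), (2, 1, 243, 1, [(59, 124, 10, None), (60, 121, 10, None), (70, 99, 10, None), (79, 80, 10, None), (80, 79, 10, None), (90, 60, 10, None), (99, 41, 10, None), (100, 36, 10, None), (110, 19, 10, None), (119, 1, 10, None)])])])"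
  by (simp only: check_simps)

lemma prime_ok_229: "prime_ok (229, [((1, 2, 243, 119), [(1, 1, 105, 139, [(39, 164, 10, None), (40, 162, 10, None), (50, 139, 10, None)]), (2, 1, 243, 1, [(59, 124, 10, None), (60, 121, 10, None), (79, 80, 10, None), (80, 79, 10, None), (90, 60, 10, None), (99, 41, 10, None), (100, 36, 10, None), (110, 19, 10, None), (119, 1, 10, None)])]),
   ((2, 2, 145, 70), [(2, 1, 145, 1, [(70, 1, 8, Some (2, 229, [[31755, 45954, 21421], [11224, 35736, 29512], [48797, 25041, 48889]]))])])])"
  by (simp only: check_simps)

lemma prime_ok_233: "prime_ok (233, [((1, 2, 243, 119), [(1, 1, 105, 139, [(39, 164, 10, None), (40, 162, 10, None), (50, 139, 10, None)]), (2, 1, 243, 1, [(59, 124, 10, None), (60, 121, 10, None), (70, 99, 10, None), (79, 80, 10, None), (80, 79, 10, None), (90, 60, 10, None), (99, 41, 10, None), (100, 36, 10, None), (110, 19, 10, None), (119, 1, 10, None)])])])"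
  by (simp only: check_simps)

lemma prime_ok_239: "prime_ok (239, [((1, 2, 243, 119), [(1, 1, 105, 139, [(39, 164, 10, None), (40, 162, 10, None), (50, 139, 10, None)]), (2, 1, 243, 1, [(60, 121, 10, None), (70, 99, 10, None), (79, 80, 10, None), (80, 79, 10, Some (1, 1, [[239, 139, 213, 139], [189, 23, 21, 24], [12, 217, 141, 189], [214, 218, 109, 239]])), (90, 60, 10, None), (99, 41, 10, Some (1, 1, [[201, 111, 93, 213], [57, 171, 223, 125], [196, 14, 62, 162], [132, 102, 140, 42]])), (100, 36, 10, None), (110, 19, 10, None), (119, 1, 10, None)])]),
   ((3, 2, 120, 59), [(2, 1, 120, 1, [(59, 1, 8, Some (3, 57121, [[11024353, 10053296], [9841778, 11024353]]))])])])"
  by (simp only: check_simps)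

lemma prime_ok_241: "prime_ok (241, [((1, 2, 225, 110), [(1, 1, 120, 106, [(39, 146, 8, None), (40, 144, 8, None), (50, 121, 8, None), (59, 106, 8, None)]), (2, 1, 225, 1, [(60, 103, 8, None), (70, 81, 8, None), (79, 62, 8, None), (80, 61, 8, None), (90, 42, 8, None), (99, 23, 8, None), (100, 18, 8, None), (110, 1, 8, None)])]),
   ((2, 2, 243, 119), [(2, 1, 243, 1, [(119, 1, 9, Some (2, 241, [[12951, 40300, 7189, 16605, 24], [26306, 19804, 7426, 21881, 30175], [56662, 2062, 36993, 29508, 15077], [40159, 29185, 31747, 48316, 21333], [26115, 18063, 19793, 54318, 8101]]))])])])"
  by (simp only: check_simps)

lemma prime_ok_251: "prime_ok (251, [((1, 2, 243, 119), [(1, 1, 123, 121, [(50, 139, 8, None), (59, 124, 8, None), (60, 121, 8, None)]), (2, 1, 243, 1, [(70, 99, 8, None), (79, 80, 8, None), (80, 79, 8, None), (90, 60, 8, None), (99, 41, 8, None), (100, 36, 8, None), (110, 19, 8, Some (1, 1, [[226, 127, 202, 224, 80], [51, 179, 208, 180, 67], [2, 140, 248, 168, 162], [97, 76, 221, 1, 132], [211, 27, 22, 151, 114]])), (119, 1, 8, None)])])])"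
  by (simp only: check_simps)

lemma prime_ok_257: "prime_ok (257, [((1, 2, 243, 119), [(1, 1, 123, 121, [(50, 139, 8, None), (59, 124, 8, None), (60, 121, 8, None)]), (2, 1, 243, 1, [(70, 99, 8, None), (79, 80, 8, None), (80, 79, 8, None), (90, 60, 8, None), (99, 41, 8, None), (110, 19, 8, None), (119, 1, 8, None)])]),
   ((2, 2, 208, 100), [(2, 1, 208, 1, [(100, 1, 8, Some (2, 257, [[26239, 48852, 23410, 60125, 11737], [27637, 19417, 55310, 10383, 44146], [63707, 324, 10058, 5556, 33817], [29079, 18044, 17953, 62092, 12361], [60305, 40681, 16982, 17163, 7759]]))])])])"
  by (simp only: check_simps)

lemma prime_ok_263: "prime_ok (263, [((1, 2, 243, 119), [(1, 1, 123, 121, [(50, 139, 8, None), (59, 124, 8, None), (60, 121, 8, None)]), (2, 1, 243, 1, [(70, 99, 8, None), (79, 80, 8, None), (80, 79, 8, None), (90, 60, 8, None), (99, 41, 8, None), (100, 36, 8, None), (110, 19, 8, None), (119, 1, 8, None)])])])"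
  by (simp only: check_simps)

lemma prime_ok_269: "prime_ok (269, [((1, 2, 243, 119), [(1, 1, 123, 121, [(50, 139, 8, None), (59, 124, 8, None), (60, 121, 8, None)]), (2, 1, 243, 1, [(70, 99, 8, None), (79, 80, 8, None), (80, 79, 8, None), (90, 60, 8, None), (99, 41, 8, None), (100, 36, 8, None), (110, 19, 8, None), (119, 1, 8, None)])])])"
  by (simp only: check_simps)

lemma prime_ok_271: "prime_ok (271, [((1, 2, 243, 119), [(1, 1, 123, 121, [(50, 139, 8, None), (59, 124, 8, None), (60, 121, 8, None)]), (2, 1, 243, 1, [(70, 99, 8, None), (79, 80, 8, None), (80, 79, 8, None), (90, 60, 8, None), (99, 41, 8, None), (100, 36, 8, None), (110, 19, 8, None), (119, 1, 8, None)])])])"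
  by (simp only: check_simps)

lemma prime_ok_277: "prime_ok (277, [((1, 2, 243, 119), [(1, 1, 123, 121, [(50, 139, 8, None), (59, 124, 8, None), (60, 121, 8, None)]), (2, 1, 243, 1, [(70, 99, 8, None), (79, 80, 8, None), (80, 79, 8, None), (90, 60, 8, None), (99, 41, 8, None), (100, 36, 8, None), (110, 19, 8, None), (119, 1, 8, None)])])])"
  by (simp only: check_simps)

lemma prime_ok_281: "prime_ok (281, [((1, 2, 243, 119), [(1, 1, 123, 121, [(50, 139, 8, None), (59, 124, 8, None), (60, 121, 8, None)]), (2, 1, 243, 1, [(70, 99, 8, None), (79, 80, 8, None), (80, 79, 8, None), (90, 60, 8, None), (99, 41, 8, None), (100, 36, 8, None), (110, 19, 8, None), (119, 1, 8, None)])])])"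
  by (simp only: check_simps)

lemma prime_ok_283: "prime_ok (283, [((1, 2, 243, 119), [(1, 1, 123, 121, [(50, 139, 8, None), (59, 124, 8, None), (60, 121, 8, None)]), (2, 1, 243, 1, [(79, 80, 8, None), (80, 79, 8, None), (90, 60, 8, None), (99, 41, 8, None), (100, 36, 8, None), (110, 19, 8, None), (119, 1, 8, None)])]),
   ((3, 2, 145, 70), [(2, 1, 145, 1, [(70, 1, 8, Some (3, 80089, [[17469423, 320356, 3043382], [13564870, 4004450, 16017800], [2694172, 15377088, 22024475]]))])])])"
  by (simp only: check_simps)

lemma prime_ok_293: "prime_ok (293, [((1, 2, 243, 119), [(1, 1, 145, 99, [(50, 139, 8, None), (59, 124, 8, None), (60, 121, 8, None), (70, 99, 8, None)]), (2, 1, 243, 1, [(79, 80, 8, None), (80, 79, 8, None), (90, 60, 8, None), (99, 41, 8, None), (100, 36, 8, None), (110, 19, 8, None), (119, 1, 8, None)])])])"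
  by (simp only: check_simps)

lemma prime_ok_307: "prime_ok (307, [((1, 2, 243, 119), [(1, 1, 145, 99, [(50, 139, 8, None), (59, 124, 8, None), (60, 121, 8, None), (70, 99, 8, None)]), (2, 1, 243, 1, [(79, 80, 8, None), (80, 79, 8, None), (90, 60, 8, None), (99, 41, 8, None), (100, 36, 8, None), (110, 19, 8, None), (119, 1, 8, None)])])])"
  by (simp only: check_simps)

lemma prime_ok_311: "prime_ok (311, [((1, 2, 243, 119), [(1, 1, 145, 99, [(59, 124, 8, None), (60, 121, 8, None), (70, 99, 8, None)]), (2, 1, 243, 1, [(79, 80, 8, None), (80, 79, 8, None), (90, 60, 8, None), (99, 41, 8, None), (100, 36, 8, None), (110, 19, 8, None), (119, 1, 8, None)])])])"
  by (simp only: check_simps)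

lemma prime_ok_313: "prime_ok (313, [((1, 2, 243, 119), [(1, 1, 145, 99, [(59, 124, 8, None), (60, 121, 8, None), (70, 99, 8, None)]), (2, 1, 243, 1, [(79, 80, 8, None), (80, 79, 8, None), (90, 60, 8, None), (99, 41, 8, None), (100, 36, 8, None), (110, 19, 8, None), (119, 1, 8, None)])])])"
  by (simp only: check_simps)

lemma prime_ok_317: "prime_ok (317, [((1, 2, 243, 119), [(1, 1, 145, 99, [(59, 124, 8, None), (60, 121, 8, None), (70, 99, 8, None)]), (2, 1, 243, 1, [(79, 80, 8, None), (80, 79, 8, None), (90, 60, 8, None), (99, 41, 8, None), (100, 36, 8, None), (110, 19, 8, None), (119, 1, 8, None)])])])"
  by (simp only: check_simps)

lemma prime_ok_331: "prime_ok (331, [((1, 2, 243, 119), [(1, 1, 165, 79, [(59, 124, 8, None), (60, 121, 8, None), (70, 99, 8, None), (79, 80, 8, None), (80, 79, 8, None)]), (2, 1, 243, 1, [(90, 60, 8, None), (99, 41, 8, None), (100, 36, 8, None), (110, 19, 8, None), (119, 1, 8, None)])])])"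
  by (simp only: check_simps)

lemma prime_ok_337: "prime_ok (337, [((1, 2, 243, 119), [(1, 1, 165, 79, [(59, 124, 8, None), (60, 121, 8, None), (70, 99, 8, None), (79, 80, 8, Some (1, 1, [[196, 306, 71], [319, 146, 208], [13, 166, 98]])), (80, 79, 8, None)]), (2, 1, 243, 1, [(90, 60, 8, None), (99, 41, 8, None), (100, 36, 8, None), (110, 19, 8, None), (119, 1, 8, None)])])])"
  by (simp only: check_simps)

lemma prime_ok_347: "prime_ok (347, [((1, 2, 243, 119), [(1, 1, 165, 79, [(59, 124, 8, None), (60, 121, 8, None), (70, 99, 8, None), (79, 80, 8, None), (80, 79, 8, None)]), (2, 1, 243, 1, [(90, 60, 8, None), (99, 41, 8, None), (100, 36, 8, None), (110, 19, 8, None), (119, 1, 8, None)])])])"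
  by (simp only: check_simps)

lemma prime_ok_349: "prime_ok (349, [((1, 2, 243, 119), [(1, 1, 165, 79, [(59, 124, 8, None), (60, 121, 8, None), (70, 99, 8, None), (79, 80, 8, None), (80, 79, 8, None)]), (2, 1, 243, 1, [(90, 60, 8, None), (99, 41, 8, None), (100, 36, 8, None), (110, 19, 8, None), (119, 1, 8, None)])])])"
  by (simp only: check_simps)

lemma prime_ok_353: "prime_ok (353, [((1, 2, 243, 119), [(1, 1, 165, 79, [(59, 124, 8, None), (60, 121, 8, None), (70, 99, 8, None), (79, 80, 8, None), (80, 79, 8, None)]), (2, 1, 243, 1, [(90, 60, 8, None), (99, 41, 8, None), (100, 36, 8, None), (110, 19, 8, None), (119, 1, 8, None)])])])"
  by (simp only: check_simps)

lemma prime_ok_359: "prime_ok (359, [((1, 2, 243, 119), [(1, 1, 165, 79, [(59, 124, 8, None), (60, 121, 8, None), (70, 99, 8, None), (79, 80, 8, None), (80, 79, 8, None)]), (2, 1, 243, 1, [(90, 60, 8, None), (99, 41, 8, None), (100, 36, 8, None), (110, 19, 8, None), (119, 1, 8, None)])])])"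
  by (simp only: check_simps)

lemma prime_ok_367: "prime_ok (367, [((1, 2, 243, 119), [(1, 1, 165, 79, [(60, 121, 8, None), (70, 99, 8, None), (79, 80, 8, None), (80, 79, 8, None)]), (2, 1, 243, 1, [(99, 41, 8, None), (100, 36, 8, None), (110, 19, 8, None), (119, 1, 8, None)])]),
   ((3, 2, 184, 90), [(2, 1, 184, 1, [(90, 1, 8, Some (3, 134689, [[7273206, 11179187, 15354546, 31113159], [34666242, 35120748, 4533912, 36904786], [3870088, 37333156, 40678682, 26668422], [48132675, 19155358, 15157854, 1212201]]))])])])"
  by (simp only: check_simps)

lemma prime_ok_373: "prime_ok (373, [((1, 2, 243, 119), [(1, 1, 184, 60, [(70, 99, 8, None), (79, 80, 8, None), (80, 79, 8, None), (90, 60, 8, None)]), (2, 1, 243, 1, [(99, 41, 8, None), (100, 36, 8, None), (110, 19, 8, None), (119, 1, 8, None)])])])"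
  by (simp only: check_simps)

lemma prime_ok_379: "prime_ok (379, [((1, 2, 243, 119), [(1, 1, 184, 60, [(70, 99, 8, None), (79, 80, 8, None), (80, 79, 8, None), (90, 60, 8, None)]), (2, 1, 243, 1, [(99, 41, 8, None), (100, 36, 8, None), (110, 19, 8, None), (119, 1, 8, None)])])])"
  by (simp only: check_simps)

lemma prime_ok_383: "prime_ok (383, [((1, 2, 243, 119), [(1, 1, 184, 60, [(70, 99, 8, None), (79, 80, 8, None), (80, 79, 8, None), (90, 60, 8, None)]), (2, 1, 243, 1, [(99, 41, 8, None), (100, 36, 8, None), (110, 19, 8, None), (119, 1, 8, None)])])])"
  by (simp only: check_simps)

lemma prime_ok_389: "prime_ok (389, [((1, 2, 243, 119), [(1, 1, 184, 60, [(70, 99, 8, None), (79, 80, 8, None), (80, 79, 8, None), (90, 60, 8, None)]), (2, 1, 243, 1, [(99, 41, 8, None), (100, 36, 8, None), (110, 19, 8, None), (119, 1, 8, None)])])])"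
  by (simp only: check_simps)

lemma prime_ok_397: "prime_ok (397, [((1, 2, 243, 119), [(1, 1, 184, 60, [(70, 99, 8, None), (79, 80, 8, None), (80, 79, 8, None), (90, 60, 8, None)]), (2, 1, 243, 1, [(99, 41, 8, None), (100, 36, 8, None), (110, 19, 8, None), (119, 1, 8, None)])])])"
  by (simp only: check_simps)

lemma prime_ok_401: "prime_ok (401, [((1, 2, 243, 119), [(1, 1, 184, 60, [(70, 99, 8, None), (79, 80, 8, None), (80, 79, 8, None), (90, 60, 8, None)]), (2, 1, 243, 1, [(100, 36, 8, None), (110, 19, 8, None), (119, 1, 8, None)])]),
   ((3, 2, 203, 99), [(2, 1, 203, 1, [(99, 1, 8, Some (3, 160801, [[48368046, 25357225, 60461176, 32321001], [25879323, 7660974, 53064330, 41004255], [840075, 37268076, 3859224, 49526708], [16091220, 33517538, 47436295, 25567359]]))])])])"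
  by (simp only: check_simps)

lemma prime_ok_409: "prime_ok (409, [((1, 2, 243, 119), [(1, 1, 203, 41, [(70, 99, 8, None), (79, 80, 8, None), (80, 79, 8, None), (90, 60, 8, None), (99, 41, 8, None)]), (2, 1, 243, 1, [(110, 19, 8, None), (119, 1, 8, None)])]),
   ((3, 2, 208, 100), [(2, 1, 208, 1, [(100, 1, 8, Some (3, 167281, [[65921137, 45026121, 10402556, 24757588, 36801820], [19987929, 2185756, 9174804, 66075995, 34961729], [15091586, 2403234, 44969640, 13382480, 38140068], [44343828, 68210732, 62602928, 63566780, 62897656], [260614, 1761161, 38985564, 3847463, 9367736]]))])])])"
  by (simp only: check_simps)

lemma prime_ok_419: "prime_ok (419, [((1, 2, 243, 119), [(1, 1, 208, 36, [(70, 99, 8, None), (79, 80, 8, None), (80, 79, 8, None), (90, 60, 8, None), (99, 41, 8, None), (100, 36, 8, None)]), (2, 1, 243, 1, [(110, 19, 8, None), (119, 1, 8, None)])])])"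
  by (simp only: check_simps)

lemma prime_ok_421: "prime_ok (421, [((1, 2, 243, 119), [(1, 1, 208, 36, [(70, 99, 8, None), (79, 80, 8, None), (80, 79, 8, None), (90, 60, 8, None), (99, 41, 8, None), (100, 36, 8, None)]), (2, 1, 243, 1, [(110, 19, 8, None), (119, 1, 8, None)])])])"
  by (simp only: check_simps)

lemma prime_ok_431: "prime_ok (431, [((1, 2, 243, 119), [(1, 1, 208, 36, [(70, 99, 8, None), (79, 80, 8, None), (80, 79, 8, None), (90, 60, 8, None), (99, 41, 8, None), (100, 36, 8, None)]), (2, 1, 243, 1, [(110, 19, 8, None), (119, 1, 8, None)])])])"
  by (simp only: check_simps)

lemma prime_ok_433: "prime_ok (433, [((1, 2, 243, 119), [(1, 1, 208, 36, [(79, 80, 8, None), (80, 79, 8, None), (90, 60, 8, None), (99, 41, 8, None), (100, 36, 8, None)]), (2, 1, 243, 1, [(110, 19, 8, None), (119, 1, 8, None)])])])"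
  by (simp only: check_simps)

lemma prime_ok_439: "prime_ok (439, [((1, 2, 243, 119), [(1, 1, 208, 36, [(79, 80, 8, None), (80, 79, 8, None), (90, 60, 8, None), (99, 41, 8, None), (100, 36, 8, None)]), (2, 1, 243, 1, [(110, 19, 8, None), (119, 1, 8, None)])])])"
  by (simp only: check_simps)

lemma prime_ok_443: "prime_ok (443, [((1, 2, 243, 119), [(1, 1, 208, 36, [(79, 80, 8, None), (80, 79, 8, None), (90, 60, 8, None), (99, 41, 8, None), (100, 36, 8, None)]), (2, 1, 243, 1, [(119, 1, 8, None)])]),
   ((3, 2, 225, 110), [(2, 1, 225, 1, [(110, 1, 8, Some (3, 196249, [[18643655, 47492258, 39446049, 47492258, 39446049], [50091300, 84387070, 67313407, 57500957, 75163367], [15121655, 74378371, 80854588, 70060893, 51613487], [71482441, 74378371, 18839904, 54753471, 53968475], [20107555, 26297366, 52594732, 75359616, 40623543]]))])])])"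
  by (simp only: check_simps)

lemma prime_ok_449: "prime_ok (449, [((1, 2, 243, 119), [(1, 1, 208, 36, [(79, 80, 8, None), (80, 79, 8, None), (90, 60, 8, None), (99, 41, 8, None), (100, 36, 8, None)]), (2, 1, 243, 1, [(119, 1, 8, None)])]),
   ((3, 2, 225, 110), [(2, 1, 225, 1, [(110, 1, 8, Some (3, 201601, [[57456285, 20160100, 85277223, 54432270, 87494834], [24262556, 65480287, 16897008, 52252915, 11692858], [37422248, 16102743, 80600081, 41757646, 47577836], [50326737, 81458061, 10108432, 8876350, 71971557], [42343887, 18437047, 39802139, 63755830, 13708868]]))])])])"
  by (simp only: check_simps)

lemma prime_ok_457: "prime_ok (457, [((1, 2, 243, 119), [(1, 1, 225, 19, [(79, 80, 8, None), (80, 79, 8, None), (90, 60, 8, None), (99, 41, 8, None), (100, 36, 8, None), (110, 19, 8, None)]), (2, 1, 243, 1, [(119, 1, 8, None)])])])"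
  by (simp only: check_simps)

lemma prime_ok_461: "prime_ok (461, [((1, 2, 243, 119), [(1, 1, 225, 19, [(79, 80, 8, None), (80, 79, 8, None), (90, 60, 8, None), (99, 41, 8, None), (100, 36, 8, None), (110, 19, 8, None)]), (2, 1, 243, 1, [(119, 1, 8, None)])])])"
  by (simp only: check_simps)

lemma prime_ok_463: "prime_ok (463, [((1, 2, 243, 119), [(1, 1, 225, 19, [(79, 80, 8, None), (80, 79, 8, None), (90, 60, 8, None), (99, 41, 8, None), (100, 36, 8, None), (110, 19, 8, None)]), (2, 1, 243, 1, [(119, 1, 8, None)])])])"
  by (simp only: check_simps)

lemma prime_ok_467: "prime_ok (467, [((1, 2, 243, 119), [(1, 1, 225, 19, [(79, 80, 8, None), (80, 79, 8, None), (90, 60, 8, None), (99, 41, 8, None), (100, 36, 8, None), (110, 19, 8, None)]), (2, 1, 243, 1, [(119, 1, 8, None)])])])"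
  by (simp only: check_simps)

lemma prime_ok_479: "prime_ok (479, [((1, 2, 225, 110), [(1, 1, 225, 1, [(79, 62, 6, None), (80, 61, 6, None), (90, 42, 6, None), (99, 23, 6, None), (100, 18, 6, None), (110, 1, 6, None)])]),
   ((3, 2, 243, 119), [(2, 1, 243, 1, [(119, 1, 8, Some (3, 229441, [[89481990, 66996772, 42905467, 66996772, 42905467], [86093397, 25467951, 78468822, 23173541, 82139878], [6327141, 67914536, 10095404, 17896398, 56442486], [22767681, 67685095, 57130809, 67685095, 7112671], [4121101, 94300251, 72732797, 78239381, 31203976]]))])])])"
  by (simp only: check_simps)

lemma prime_ok_487: "prime_ok (487, [((1, 2, 243, 119), [(1, 1, 243, 1, [(80, 79, 8, None), (90, 60, 8, None), (99, 41, 8, None), (100, 36, 8, None), (110, 19, 8, None), (119, 1, 8, None)])])])"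
  by (simp only: check_simps)

lemma prime_ok_491: "prime_ok (491, [((1, 2, 243, 119), [(1, 1, 243, 1, [(80, 79, 8, None), (90, 60, 8, None), (99, 41, 8, None), (100, 36, 8, None), (110, 19, 8, None), (119, 1, 8, None)])])])"
  by (simp only: check_simps)

lemma prime_ok_499: "prime_ok (499, [((1, 2, 243, 119), [(1, 1, 243, 1, [(90, 60, 6, None), (99, 41, 6, None), (100, 36, 6, None), (110, 19, 6, None), (119, 1, 6, None)])])])"
  by (simp only: check_simps)

lemma prime_ok_503: "prime_ok (503, [((1, 2, 243, 119), [(1, 1, 243, 1, [(90, 60, 6, None), (99, 41, 6, None), (100, 36, 6, None), (110, 19, 6, None), (119, 1, 6, None)])])])"
  by (simp only: check_simps)

lemma prime_ok_509: "prime_ok (509, [((1, 2, 243, 119), [(1, 1, 243, 1, [(90, 60, 6, None), (99, 41, 6, None), (100, 36, 6, None), (110, 19, 6, None), (119, 1, 6, None)])])])"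
  by (simp only: check_simps)

lemma prime_ok_521: "prime_ok (521, [((1, 2, 243, 119), [(1, 1, 243, 1, [(90, 60, 6, None), (99, 41, 6, None), (100, 36, 6, None), (110, 19, 6, None), (119, 1, 6, None)])])])"
  by (simp only: check_simps)

lemma prime_ok_523: "prime_ok (523, [((1, 2, 243, 119), [(1, 1, 243, 1, [(90, 60, 6, None), (99, 41, 6, None), (100, 36, 6, None), (110, 19, 6, None), (119, 1, 6, None)])])])"
  by (simp only: check_simps)

lemma prime_ok_541: "prime_ok (541, [((1, 2, 243, 119), [(1, 1, 243, 1, [(90, 60, 6, None), (99, 41, 6, None), (100, 36, 6, None), (110, 19, 6, None), (119, 1, 6, None)])])])"
  by (simp only: check_simps)

lemma prime_ok_547: "prime_ok (547, [((1, 2, 243, 119), [(1, 1, 243, 1, [(90, 60, 6, None), (99, 41, 6, None), (100, 36, 6, None), (110, 19, 6, None), (119, 1, 6, None)])])])"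
  by (simp only: check_simps)

lemma prime_ok_557: "prime_ok (557, [((1, 2, 243, 119), [(1, 1, 243, 1, [(99, 41, 6, None), (100, 36, 6, None), (110, 19, 6, None), (119, 1, 6, None)])])])"
  by (simp only: check_simps)

lemma prime_ok_563: "prime_ok (563, [((1, 2, 243, 119), [(1, 1, 243, 1, [(99, 41, 6, None), (100, 36, 6, None), (110, 19, 6, None), (119, 1, 6, None)])])])"
  by (simp only: check_simps)

lemma prime_ok_569: "prime_ok (569, [((1, 2, 243, 119), [(1, 1, 243, 1, [(99, 41, 6, None), (100, 36, 6, None), (110, 19, 6, None), (119, 1, 6, None)])])])"
  by (simp only: check_simps)

lemma prime_ok_571: "prime_ok (571, [((1, 2, 243, 119), [(1, 1, 243, 1, [(99, 41, 6, None), (100, 36, 6, None), (110, 19, 6, None), (119, 1, 6, None)])])])"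
  by (simp only: check_simps)

lemma prime_ok_577: "prime_ok (577, [((1, 2, 243, 119), [(1, 1, 243, 1, [(99, 41, 6, None), (100, 36, 6, None), (110, 19, 6, None), (119, 1, 6, None)])])])"
  by (simp only: check_simps)

lemma prime_ok_587: "prime_ok (587, [((1, 2, 243, 119), [(1, 1, 243, 1, [(99, 41, 6, None), (100, 36, 6, None), (110, 19, 6, None), (119, 1, 6, None)])])])"
  by (simp only: check_simps)

lemma prime_ok_593: "prime_ok (593, [((1, 2, 243, 119), [(1, 1, 243, 1, [(99, 41, 6, None), (100, 36, 6, None), (110, 19, 6, None), (119, 1, 6, Some (1, 1, [[593, 263, 137, 298, 468], [491, 396, 348, 489, 416], [107, 419, 354, 191, 530], [219, 447, 283, 287, 538], [50, 278, 587, 555, 593]]))])])])"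
  by (simp only: check_simps)

lemma prime_ok_599: "prime_ok (599, [((1, 2, 243, 119), [(1, 1, 243, 1, [(99, 41, 6, None), (100, 36, 6, None), (110, 19, 6, None), (119, 1, 6, None)])])])"
  by (simp only: check_simps)

lemma prime_ok_601: "prime_ok (601, [((1, 2, 243, 119), [(1, 1, 243, 1, [(99, 41, 6, None), (100, 36, 6, None), (110, 19, 6, None), (119, 1, 6, None)])])])"
  by (simp only: check_simps)

lemma prime_ok_607: "prime_ok (607, [((1, 2, 243, 119), [(1, 1, 243, 1, [(99, 41, 6, None), (100, 36, 6, None), (110, 19, 6, None), (119, 1, 6, None)])])])"
  by (simp only: check_simps)

lemma prime_ok_613: "prime_ok (613, [((1, 2, 243, 119), [(1, 1, 243, 1, [(100, 36, 6, None), (110, 19, 6, None), (119, 1, 6, None)])])])"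
  by (simp only: check_simps)

lemma prime_ok_617: "prime_ok (617, [((1, 2, 243, 119), [(1, 1, 243, 1, [(110, 19, 6, None), (119, 1, 6, None)])])])"
  by (simp only: check_simps)

lemma prime_ok_619: "prime_ok (619, [((1, 2, 243, 119), [(1, 1, 243, 1, [(110, 19, 6, None), (119, 1, 6, None)])])])"
  by (simp only: check_simps)

lemma prime_ok_631: "prime_ok (631, [((1, 2, 243, 119), [(1, 1, 243, 1, [(110, 19, 6, None), (119, 1, 6, None)])])])"
  by (simp only: check_simps)

lemma prime_ok_641: "prime_ok (641, [((1, 2, 243, 119), [(1, 1, 243, 1, [(110, 19, 6, None), (119, 1, 6, None)])])])"
  by (simp only: check_simps)

lemma prime_ok_643: "prime_ok (643, [((1, 2, 243, 119), [(1, 1, 243, 1, [(110, 19, 6, None), (119, 1, 6, None)])])])"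
  by (simp only: check_simps)

lemma prime_ok_647: "prime_ok (647, [((1, 2, 243, 119), [(1, 1, 243, 1, [(110, 19, 6, None), (119, 1, 6, None)])])])"
  by (simp only: check_simps)

lemma prime_ok_653: "prime_ok (653, [((1, 2, 243, 119), [(1, 1, 243, 1, [(110, 19, 6, None), (119, 1, 6, None)])])])"
  by (simp only: check_simps)

lemma prime_ok_659: "prime_ok (659, [((1, 2, 243, 119), [(1, 1, 243, 1, [(110, 19, 6, None), (119, 1, 6, None)])])])"
  by (simp only: check_simps)

lemma prime_ok_661: "prime_ok (661, [((1, 2, 243, 119), [(1, 1, 243, 1, [(110, 19, 6, None), (119, 1, 6, None)])])])"
  by (simp only: check_simps)

lemma prime_ok_673: "prime_ok (673, [((1, 2, 243, 119), [(1, 1, 243, 1, [(110, 19, 6, None), (119, 1, 6, None)])])])"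
  by (simp only: check_simps)

lemma prime_ok_677: "prime_ok (677, [((1, 2, 243, 119), [(1, 1, 243, 1, [(119, 1, 6, None)])])])"
  by (simp only: check_simps)

lemma prime_ok_683: "prime_ok (683, [((1, 2, 243, 119), [(1, 1, 243, 1, [(119, 1, 6, None)])])])"
  by (simp only: check_simps)

lemma prime_ok_691: "prime_ok (691, [((1, 2, 243, 119), [(1, 1, 243, 1, [(119, 1, 6, None)])])])"
  by (simp only: check_simps)

lemma prime_ok_701: "prime_ok (701, [((1, 2, 243, 119), [(1, 1, 243, 1, [(119, 1, 6, None)])])])"
  by (simp only: check_simps)

lemma prime_ok_709: "prime_ok (709, [((1, 2, 243, 119), [(1, 1, 243, 1, [(119, 1, 6, None)])])])"
  by (simp only: check_simps)

lemma prime_ok_719: "prime_ok (719, [((1, 2, 243, 119), [(1, 1, 243, 1, [(119, 1, 6, None)])])])"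
  by (simp only: check_simps)

lemma prime_ok_727: "prime_ok (727, [((1, 1, 243, 119), [(1, 1, 243, 1, [(119, 1, 6, None)])])])"
  by (simp only: check_simps)

lemmas all_prime_ok =
  prime_ok_3 prime_ok_5 prime_ok_7 prime_ok_11 prime_ok_13 prime_ok_17 prime_ok_19 prime_ok_23
  prime_ok_29 prime_ok_31 prime_ok_37 prime_ok_41 prime_ok_43 prime_ok_47 prime_ok_53 prime_ok_59
  prime_ok_61 prime_ok_67 prime_ok_71 prime_ok_73 prime_ok_79 prime_ok_83 prime_ok_89 prime_ok_97
  prime_ok_101 prime_ok_103 prime_ok_107 prime_ok_109 prime_ok_113 prime_ok_127 prime_ok_131
  prime_ok_137 prime_ok_139 prime_ok_149 prime_ok_151 prime_ok_157 prime_ok_163 prime_ok_167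
  prime_ok_173 prime_ok_179 prime_ok_181 prime_ok_191 prime_ok_193 prime_ok_197 prime_ok_199
  prime_ok_211 prime_ok_223 prime_ok_227 prime_ok_229 prime_ok_233 prime_ok_239 prime_ok_241
  prime_ok_251 prime_ok_257 prime_ok_263 prime_ok_269 prime_ok_271 prime_ok_277 prime_ok_281
  prime_ok_283 prime_ok_293 prime_ok_307 prime_ok_311 prime_ok_313 prime_ok_317 prime_ok_331
  prime_ok_337 prime_ok_347 prime_ok_349 prime_ok_353 prime_ok_359 prime_ok_367 prime_ok_373
  prime_ok_379 prime_ok_383 prime_ok_389 prime_ok_397 prime_ok_401 prime_ok_409 prime_ok_419
  prime_ok_421 prime_ok_431 prime_ok_433 prime_ok_439 prime_ok_443 prime_ok_449 prime_ok_457
  prime_ok_461 prime_ok_463 prime_ok_467 prime_ok_479 prime_ok_487 prime_ok_491 prime_ok_499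
  prime_ok_503 prime_ok_509 prime_ok_521 prime_ok_523 prime_ok_541 prime_ok_547 prime_ok_557
  prime_ok_563 prime_ok_569 prime_ok_571 prime_ok_577 prime_ok_587 prime_ok_593 prime_ok_599
  prime_ok_601 prime_ok_607 prime_ok_613 prime_ok_617 prime_ok_619 prime_ok_631 prime_ok_641
  prime_ok_643 prime_ok_647 prime_ok_653 prime_ok_659 prime_ok_661 prime_ok_673 prime_ok_677
  prime_ok_683 prime_ok_691 prime_ok_701 prime_ok_709 prime_ok_719 prime_ok_727

lemma certificate_exists: "list_all (\<lambda>p. \<exists>gs. prime_ok (p, gs)) prime_list"
  unfolding prime_list_def list.pred_inject
  by (intro conjI list.pred_inject(1)) (rule exI, rule all_prime_ok)+

section \<open>The eighteen cases\<close>

theorem lemma3p2: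
  fixes \<epsilon> :: rat and B S :: nat and A :: "nat set" and a q :: int
  assumes "\<epsilon> \<in> {1, -1}"
    and "(B, S, A, a, q) \<in>
      {(20, 1, {0}, 1, 2),
       (21, 1, {1}, 1, 1),
       (25, 1, {0}, 1, 1),
       (30, 1, {1}, 1, 1),
       (35, 1, {0}, 1, 1),
       (39, 1, {1}, 1, 1),
       (40, 2, {0, 1}, 1, 1),
       (50, 2, {3, 4}, 1, 1),
       (59, 2, {0, 1}, 1, 1),
       (60, 3, {0, 1, 2}, 1, 1),
       (70, 3, {0, 1, 4}, 1, 1),
       (79, 3, {3, 4, 5}, 1, 1),
       (80, 4, {1, 2, 3, 4}, 1, 1),
       (90, 4, {0, 1, 2, 3}, 1, 1),
       (99, 4, {0, 1, 3, 4}, 1, 1),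
       (100, 5, {1, 2, 3, 4, 7}, 1, 1),
       (110, 5, {0, 1, 2, 3, 4}, 1, 1),
       (119, 5, {0, 1, 2, 3, 4}, 1, 1)}"
  shows "gcd (H \<epsilon> B S A) (Phi \<epsilon> B S A a q) = 1
    \<and> den (qval \<epsilon> B S A a q) = H \<epsilon> B S A
    \<and> finite {den (qval \<epsilon> B S A a' q') | a' q'. coprime a' q' \<and> q' \<ge> 1}
    \<and> Max {den (qval \<epsilon> B S A a' q') | a' q'. coprime a' q' \<and> q' \<ge> 1} = H \<epsilon> B S A"
proof -
  have data: "\<exists>gs. prime_ok (p, gs)" if "prime p" "odd p" "p \<le> 729" for p
    using certificate_exists odd_prime_in_list[OF that] by (simp add: list_all_iff)
  have row: "gcd (H \<epsilon> B' S' (set xs)) (Phi \<epsilon> B' S' (set xs) 1 (int q')) = 1"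
    if "(B', n, S', q', ds, L) \<in> set case_table" "sorted xs" "distinct xs" "length xs = S'"
      "list_all (\<lambda>(x, d). x + d + 2 * B' = n \<and> x \<le> S' + 2) (zip xs ds)" for B' n S' q' ds L xs
    using data that assms(1) by (intro gcd_eq_1_if_prime_ok)
  have g20: "gcd (H \<epsilon> 20 1 {0}) (Phi \<epsilon> 20 1 {0} 1 2) = 1"
    using row[of 20 40 1 2 "[0]" 1 "[0]"] by (simp add: case_table_def)
  have g21: "gcd (H \<epsilon> 21 1 {1}) (Phi \<epsilon> 21 1 {1} 1 1) = 1"
    using row[of 21 43 1 1 "[0]" 1 "[1]"] by (simp add: case_table_def)
  have g25: "gcd (H \<epsilon> 25 1 {0}) (Phi \<epsilon> 25 1 {0} 1 1) = 1"
    using row[of 25 50 1 1 "[0]" 1 "[0]"] by (simp add: case_table_def)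
  have g30: "gcd (H \<epsilon> 30 1 {1}) (Phi \<epsilon> 30 1 {1} 1 1) = 1"
    using row[of 30 61 1 1 "[0]" 1 "[1]"] by (simp add: case_table_def)
  have g35: "gcd (H \<epsilon> 35 1 {0}) (Phi \<epsilon> 35 1 {0} 1 1) = 1"
    using row[of 35 70 1 1 "[0]" 1 "[0]"] by (simp add: case_table_def)
  have g39: "gcd (H \<epsilon> 39 1 {1}) (Phi \<epsilon> 39 1 {1} 1 1) = 1"
    using row[of 39 79 1 1 "[0]" 1 "[1]"] by (simp add: case_table_def)
  have g40: "gcd (H \<epsilon> 40 2 {0, 1}) (Phi \<epsilon> 40 2 {0, 1} 1 1) = 1"
    using row[of 40 81 2 1 "[1, 0]" 3 "[0, 1]"] by (simp add: case_table_def)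
  have g50: "gcd (H \<epsilon> 50 2 {3, 4}) (Phi \<epsilon> 50 2 {3, 4} 1 1) = 1"
    using row[of 50 104 2 1 "[1, 0]" 3 "[3, 4]"] by (simp add: case_table_def)
  have g59: "gcd (H \<epsilon> 59 2 {0, 1}) (Phi \<epsilon> 59 2 {0, 1} 1 1) = 1"
    using row[of 59 119 2 1 "[1, 0]" 3 "[0, 1]"] by (simp add: case_table_def)
  have g60: "gcd (H \<epsilon> 60 3 {0, 1, 2}) (Phi \<epsilon> 60 3 {0, 1, 2} 1 1) = 1"
    using row[of 60 122 3 1 "[2, 1, 0]" 5 "[0, 1, 2]"] by (simp add: case_table_def)
  have g70: "gcd (H \<epsilon> 70 3 {0, 1, 4}) (Phi \<epsilon> 70 3 {0, 1, 4} 1 1) = 1"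
    using row[of 70 144 3 1 "[4, 3, 0]" 7 "[0, 1, 4]"] by (simp add: case_table_def)
  have g79: "gcd (H \<epsilon> 79 3 {3, 4, 5}) (Phi \<epsilon> 79 3 {3, 4, 5} 1 1) = 1"
    using row[of 79 163 3 1 "[2, 1, 0]" 5 "[3, 4, 5]"] by (simp add: case_table_def)
  have g80: "gcd (H \<epsilon> 80 4 {1, 2, 3, 4}) (Phi \<epsilon> 80 4 {1, 2, 3, 4} 1 1) = 1"
    using row[of 80 164 4 1 "[3, 2, 1, 0]" 7 "[1, 2, 3, 4]"] by (simp add: case_table_def)
  have g90: "gcd (H \<epsilon> 90 4 {0, 1, 2, 3}) (Phi \<epsilon> 90 4 {0, 1, 2, 3} 1 1) = 1"
    using row[of 90 183 4 1 "[3, 2, 1, 0]" 7 "[0, 1, 2, 3]"] by (simp add: case_table_def)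
  have g99: "gcd (H \<epsilon> 99 4 {0, 1, 3, 4}) (Phi \<epsilon> 99 4 {0, 1, 3, 4} 1 1) = 1"
    using row[of 99 202 4 1 "[4, 3, 1, 0]" 8 "[0, 1, 3, 4]"] by (simp add: case_table_def)
  have g100: "gcd (H \<epsilon> 100 5 {1, 2, 3, 4, 7}) (Phi \<epsilon> 100 5 {1, 2, 3, 4, 7} 1 1) = 1"
    using row[of 100 207 5 1 "[6, 5, 4, 3, 0]" 11 "[1, 2, 3, 4, 7]"] by (simp add: case_table_def)
  have g110: "gcd (H \<epsilon> 110 5 {0, 1, 2, 3, 4}) (Phi \<epsilon> 110 5 {0, 1, 2, 3, 4} 1 1) = 1"
    using row[of 110 224 5 1 "[4, 3, 2, 1, 0]" 9 "[0, 1, 2, 3, 4]"] by (simp add: case_table_def)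
  have g119: "gcd (H \<epsilon> 119 5 {0, 1, 2, 3, 4}) (Phi \<epsilon> 119 5 {0, 1, 2, 3, 4} 1 1) = 1"
    using row[of 119 242 5 1 "[4, 3, 2, 1, 0]" 9 "[0, 1, 2, 3, 4]"] by (simp add: case_table_def)
  have "gcd (H \<epsilon> B S A) (Phi \<epsilon> B S A a q) = 1 \<and> 1 \<le> q \<and> coprime a q"
    using assms(2) unfolding insert_iff empty_iff prod.inject
    by (elim disjE conjE FalseE)
      (simp_all only: g20 g21 g25 g30 g35 g39 g40 g50 g59 g60 g70 g79 g80 g90 g99 g100 g110 g119
        order_refl one_le_numeral coprime_1_left simp_thms)
  then have q: "1 \<le> q" "coprime a q" and g: "gcd (H \<epsilon> B S A) (Phi \<epsilon> B S A a q) = 1"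
    by auto
  show ?thesis using g den_qval_max[OF q g] by blast
qed

end
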